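(* For generic limit-periodic $V:\mathbb{Z}\to\mathbb{R}$, the spectrum of $H_{\lambda V^{\circledast k}}$ is a Cantor set of zero Hausdorff dimension for all $\lambda\neq 0$ (real) and all $k\in\mathbb{N}$. That is, there is a dense $G_\delta$ set $\mathcal{G}\subseteq \mathrm{LP}(\mathbb{Z},\mathbb{R})$ such that for every $V\in\mathcal{G}$, every $\lambda\in\mathbb{R}\setminus\{0\}$ and every $k\in\mathbb{N}$, $\operatorname{spec}(H_{\lambda V^{\circledast k}})$ is a Cantor set of Hausdorff dimension zero.
   Context: $\mathbb{N}=\{1,2,\ldots\}$. $\mathrm{LP}(\mathbb{Z},\mathbb{R})$ is the set of limit-periodic functions $\mathbb{Z}\to\mathbb{R}$, i.e. the closure, in the uniform ($\ell^\infty$) metric, of the set of periodic functions $\mathbb{Z}\to\mathbb{R}$; it is a complete metric space with the uniform metric. A property holds for generic elements if it holds for all elements of a dense $G_\delta$ subset. For $V:\mathbb{Z}\to\mathbb{R}$ and $k\in\mathbb{N}$, $V^{\circledast k}:\mathbb{Z}\to\mathbb{R}$ is defined by $V^{\circledast k}(n)=V(\lfloor n/k\rfloor)$, $n\in\mathbb{Z}$ (each value is repeated $k$ times). For bounded $W:\mathbb{Z}\to\mathbb{R}$, $H_W$ is the discrete Schr\"odinger operator on $\ell^2(\mathbb{Z})$ given by $[H_W\psi](n)=\psi(n-1)+\psi(n+1)+W(n)\psi(n)$, and $\operatorname{spec}(H_W)\subseteq\mathbb{R}$ is its spectrum. A Cantor set in $\mathbb{R}$ here is a nonempty compact set without isolated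 points and with empty interior. *)

theory Defs
  imports "HOL-Analysis.Analysis"
begin

section \<open>Limit-periodic functions\<close>

text \<open>Every function on the discrete space \<^typ>\<open>int\<close> is continuous, so
  \<^typ>\<open>int \<Rightarrow>\<^sub>C real\<close> is the space of all bounded functions with the uniform metric.
  Periodic functions and their uniform limits are bounded, so taking the closure there
  agrees with taking it among all functions.\<close>

unbundle bcontfun.lifting

definition periodic :: "(int \<Rightarrow>\<^sub>C real) \<Rightarrow> bool" where
  "periodic V \<longleftrightarrow> (\<exists>p::nat. p \<ge> 1 \<and> (\<forall>n. V (n + int p) = V n))"

definition LP :: "(int \<Rightarrow>\<^sub>C real) set" where
  "LP = closure {V. periodic V}"

lift_definition repeat :: "(int \<Rightarrow>\<^sub>C real) \<Rightarrow> nat \<Rightarrow> (int \<Rightarrow>\<^sub>C real)"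
  is "\<lambda>V k n. V \<lfloor>real_of_int n / real k\<rfloor>"
  by (auto simp: bcontfun_def intro: bounded_subset)


section \<open>The Hilbert space of square-summable functions\<close>

typedef 'i ell2 = "{\<psi>::'i \<Rightarrow> complex. (\<lambda>n. (norm (\<psi> n))\<^sup>2) summable_on UNIV}"
  morphisms apply_ell2 Abs_ell2
  by (rule exI[of _ "\<lambda>_. 0"]) simp

setup_lifting type_definition_ell2

declare [[coercion apply_ell2]]

lemma ell2_eqI: "(\<And>n. apply_ell2 x n = apply_ell2 y n) \<Longrightarrow> x = y"
  by transfer auto

lemma summable_sq_add:
  fixes x y :: "'i \<Rightarrow> complex"
  assumes "(\<lambda>n. (norm (x n))\<^sup>2) summable_on UNIV" "(\<lambda>n. (norm (y n))\<^sup>2) summable_on UNIV"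
  shows "(\<lambda>n. (norm (x n + y n))\<^sup>2) summable_on UNIV"
proof (rule summable_on_comparison_test)
  show "(\<lambda>n. 2 * (norm (x n))\<^sup>2 + 2 * (norm (y n))\<^sup>2) summable_on UNIV"
    by (intro summable_on_add summable_on_cmult_right assms)
  fix n
  have "(norm (x n + y n))\<^sup>2 \<le> (norm (x n) + norm (y n))\<^sup>2"
    by (intro power_mono norm_triangle_ineq norm_ge_zero)
  also have "\<dots> \<le> 2 * (norm (x n))\<^sup>2 + 2 * (norm (y n))\<^sup>2"
    using sum_squares_ge_zero[of "norm (x n) - norm (y n)" 0]
    by (simp add: power2_eq_square algebra_simps)
  finally show "(norm (x n + y n))\<^sup>2 \<le> 2 * (norm (x n))\<^sup>2 + 2 * (norm (y n))\<^sup>2" .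
qed simp

lemma summable_sq_bounded_mult:
  fixes x c :: "'i \<Rightarrow> complex"
  assumes "(\<lambda>n. (norm (x n))\<^sup>2) summable_on UNIV" "\<And>n. norm (c n) \<le> C"
  shows "(\<lambda>n. (norm (c n * x n))\<^sup>2) summable_on UNIV"
proof (rule summable_on_comparison_test)
  show "(\<lambda>n. C\<^sup>2 * (norm (x n))\<^sup>2) summable_on UNIV"
    by (intro summable_on_cmult_right assms)
  show "(norm (c n * x n))\<^sup>2 \<le> C\<^sup>2 * (norm (x n))\<^sup>2" for n
    using assms(2)[of n]
    by (auto simp: norm_mult power_mult_distrib intro!: mult_right_mono power_mono)
qed simp

lemma summable_sq_inner:
  fixes x y :: "'i \<Rightarrow> complex"
  assumes "(\<lambda>n. (norm (x n))\<^sup>2) summable_on UNIV" "(\<lambda>n. (norm (y n))\<^sup>2) summable_on UNIV"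
  shows "(\<lambda>n. x n \<bullet> y n) summable_on UNIV"
proof -
  have "(\<lambda>n. ((norm (x n + y n))\<^sup>2 + - 1 * (norm (x n))\<^sup>2 + - 1 * (norm (y n))\<^sup>2) * (1/2)) summable_on UNIV"
    by (intro summable_on_cmult_left summable_on_add summable_on_cmult_right assms summable_sq_add)
  also have "(\<lambda>n. ((norm (x n + y n))\<^sup>2 + - 1 * (norm (x n))\<^sup>2 + - 1 * (norm (y n))\<^sup>2) * (1/2))
      = (\<lambda>n. x n \<bullet> y n)"
    by (simp add: power2_norm_eq_inner inner_add_left inner_add_right inner_commute)
  finally show ?thesis .
qed

instantiation ell2 :: (type) real_vector
begin
lift_definition zero_ell2 :: "'a ell2" is "\<lambda>_. 0" by simp
lift_definition plus_ell2 :: "'a ell2 \<Rightarrow> 'a ell2 \<Rightarrow> 'a ell2" is "\<lambda>x y n. x n + y n"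
  by (rule summable_sq_add)
lift_definition uminus_ell2 :: "'a ell2 \<Rightarrow> 'a ell2" is "\<lambda>x n. - x n" by simp
lift_definition minus_ell2 :: "'a ell2 \<Rightarrow> 'a ell2 \<Rightarrow> 'a ell2" is "\<lambda>x y n. x n - y n"
  using summable_sq_add[where y = "\<lambda>n. - _ n"] by fastforce
lift_definition scaleR_ell2 :: "real \<Rightarrow> 'a ell2 \<Rightarrow> 'a ell2" is "\<lambda>r x n. r *\<^sub>R x n"
  by (simp add: power_mult_distrib summable_on_cmult_right)
instance
  by standard (transfer; auto simp: algebra_simps)+
end

text \<open>The inner product below is the real part of the Hermitian one; both induce the same norm.\<close>

instantiation ell2 :: (type) real_inner
begin
lift_definition inner_ell2 :: "'a ell2 \<Rightarrow> 'a ell2 \<Rightarrow> real" is "\<lambda>x y. \<Sum>\<^sub>\<infinity>n. x n \<bullet> y n" .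
definition norm_ell2 :: "'a ell2 \<Rightarrow> real" where "norm_ell2 x = sqrt (x \<bullet> x)"
definition sgn_ell2 :: "'a ell2 \<Rightarrow> 'a ell2" where "sgn_ell2 x = x /\<^sub>R norm x"
definition dist_ell2 :: "'a ell2 \<Rightarrow> 'a ell2 \<Rightarrow> real" where "dist_ell2 x y = norm (x - y)"
definition uniformity_ell2 :: "('a ell2 \<times> 'a ell2) filter" where
  "uniformity_ell2 = (INF e\<in>{0<..}. principal {(x, y). dist x y < e})"
definition open_ell2 :: "'a ell2 set \<Rightarrow> bool" where
  "open_ell2 U \<longleftrightarrow> (\<forall>x\<in>U. eventually (\<lambda>(x', y). x' = x \<longrightarrow> y \<in> U) uniformity)"
instance
proof
  fix x y z :: "'a ell2" and r :: real
  show "x \<bullet> y = y \<bullet> x" by transfer (simp add: inner_commute)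
  show "(x + y) \<bullet> z = x \<bullet> z + y \<bullet> z"
    by transfer (simp add: inner_add_left infsum_add summable_sq_inner)
  show "(r *\<^sub>R x) \<bullet> y = r * (x \<bullet> y)"
    by transfer (simp add: infsum_cmult_right')
  show "0 \<le> x \<bullet> x" by transfer (simp add: infsum_nonneg)
  show "(x \<bullet> x = 0) = (x = 0)"
  proof
    assume "x \<bullet> x = 0"
    thus "x = 0"
    proof transfer
      fix x :: "'a \<Rightarrow> complex"
      assume "(\<lambda>n. (norm (x n))\<^sup>2) summable_on UNIV" "(\<Sum>\<^sub>\<infinity>n. x n \<bullet> x n) = 0"
      hence "x n \<bullet> x n = 0" for n
        by (intro nonneg_infsum_le_0D[of "\<lambda>n. x n \<bullet> x n" UNIV]) (auto simp: dot_square_norm)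
      thus "x = (\<lambda>_. 0)" by auto
    qed
  qed (transfer, simp)
qed (simp_all add: norm_ell2_def sgn_ell2_def dist_ell2_def uniformity_ell2_def open_ell2_def)
end

lemma norm_ell2_sq: "(norm (x :: 'i ell2))\<^sup>2 = (\<Sum>\<^sub>\<infinity>n. (norm (apply_ell2 x n))\<^sup>2)"
  unfolding power2_norm_eq_inner by transfer (simp add: dot_square_norm)

lemma summable_ell2: "(\<lambda>n. (norm (apply_ell2 x n))\<^sup>2) summable_on UNIV"
  using apply_ell2[of x] by simp

lemma sum_le_norm_ell2_sq:
  "finite F \<Longrightarrow> (\<Sum>n\<in>F. (norm (apply_ell2 x n))\<^sup>2) \<le> (norm x)\<^sup>2"
  unfolding norm_ell2_sq by (rule finite_sum_le_infsum[OF summable_ell2]) auto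

lemma norm_apply_ell2_le: "norm (apply_ell2 x n) \<le> norm x"
  by (rule power2_le_imp_le) (use sum_le_norm_ell2_sq[of "{n}" x] in simp_all)

lemma norm_ell2_le_mult:
  assumes "\<And>n. norm (apply_ell2 x n) \<le> C * norm (apply_ell2 y n)" "C \<ge> 0"
  shows "norm x \<le> C * norm y"
proof (rule power2_le_imp_le)
  have "(norm (apply_ell2 x n))\<^sup>2 \<le> C\<^sup>2 * (norm (apply_ell2 y n))\<^sup>2" for n
    using power_mono[OF assms(1) norm_ge_zero, of n 2] by (simp add: power_mult_distrib)
  hence "(norm x)\<^sup>2 \<le> (\<Sum>\<^sub>\<infinity>n. C\<^sup>2 * (norm (apply_ell2 y n))\<^sup>2)"
    unfolding norm_ell2_sq
    by (intro infsum_mono summable_on_cmult_right summable_ell2)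
  also have "\<dots> = (C * norm y)\<^sup>2"
    by (simp add: infsum_cmult_right' norm_ell2_sq power_mult_distrib)
  finally show "(norm x)\<^sup>2 \<le> (C * norm y)\<^sup>2" .
qed (use assms in simp)

lift_definition scaleC_ell2 :: "complex \<Rightarrow> 'i ell2 \<Rightarrow> 'i ell2" is "\<lambda>z x n. z * x n"
  by (rule summable_sq_bounded_mult[where C = "norm _"]) auto

lift_definition scalar_op :: "complex \<Rightarrow> ('i ell2 \<Rightarrow>\<^sub>L 'i ell2)" is scaleC_ell2
proof (rule bounded_linear_intro)
  fix z r and x y :: "'i ell2"
  show "scaleC_ell2 z (x + y) = scaleC_ell2 z x + scaleC_ell2 z y"
    by transfer (simp add: algebra_simps)
  show "scaleC_ell2 z (r *\<^sub>R x) = r *\<^sub>R scaleC_ell2 z x"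
    by transfer simp
  show "norm (scaleC_ell2 z x) \<le> norm x * norm z"
    by (subst mult.commute, rule norm_ell2_le_mult) (auto simp: scaleC_ell2.rep_eq norm_mult)
qed


section \<open>Schroedinger operators and their spectra\<close>

lift_definition shift_ell2 :: "int \<Rightarrow> int ell2 \<Rightarrow> int ell2" is "\<lambda>k \<psi> n. \<psi> (n + k)"
proof -
  fix k :: int and \<psi> :: "int \<Rightarrow> complex"
  have "bij (\<lambda>n. n + k)" by (rule bij_betw_byWitness[of _ "\<lambda>n. n - k"]) auto
  thus "(\<lambda>n. (norm (\<psi> n))\<^sup>2) summable_on UNIV \<Longrightarrow> (\<lambda>n. (norm (\<psi> (n + k)))\<^sup>2) summable_on UNIV"
    using summable_on_reindex_bij_betw[of "\<lambda>n. n + k" UNIV UNIV "\<lambda>n. (norm (\<psi> n))\<^sup>2"] by simp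
qed

lemma inner_shift_ell2: "shift_ell2 k x \<bullet> shift_ell2 k y = x \<bullet> y"
proof transfer
  fix k :: int and x y :: "int \<Rightarrow> complex"
  have "bij (\<lambda>n. n + k)" by (rule bij_betw_byWitness[of _ "\<lambda>n. n - k"]) auto
  thus "(\<Sum>\<^sub>\<infinity>n. x (n + k) \<bullet> y (n + k)) = (\<Sum>\<^sub>\<infinity>n. x n \<bullet> y n)"
    using infsum_reindex_bij_betw[of "\<lambda>n. n + k" UNIV UNIV "\<lambda>n. x n \<bullet> y n"] by simp
qed

lemma norm_shift_ell2: "norm (shift_ell2 k x) = norm x"
  by (simp add: norm_eq_sqrt_inner inner_shift_ell2)

lift_definition mult_ell2 :: "(int \<Rightarrow>\<^sub>C real) \<Rightarrow> int ell2 \<Rightarrow> int ell2"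
  is "\<lambda>W \<psi> n. complex_of_real (W n) * \<psi> n"
proof -
  fix W :: "int \<Rightarrow> real" and \<psi> :: "int \<Rightarrow> complex"
  assume "W \<in> bcontfun" and \<psi>: "(\<lambda>n. (norm (\<psi> n))\<^sup>2) summable_on UNIV"
  then obtain C where "norm (W n) \<le> C" for n by (auto simp: bcontfun_def bounded_iff)
  thus "(\<lambda>n. (norm (complex_of_real (W n) * \<psi> n))\<^sup>2) summable_on UNIV"
    by (intro summable_sq_bounded_mult[OF \<psi>, of _ C]) auto
qed

lemma norm_mult_ell2: "norm (mult_ell2 W x) \<le> norm W * norm x"
  by (rule norm_ell2_le_mult)
    (use norm_bounded[of W] in \<open>auto simp: mult_ell2.rep_eq norm_mult intro!: mult_right_mono\<close>)

lift_definition schroedinger_fun :: "(int \<Rightarrow>\<^sub>C real) \<Rightarrow> int ell2 \<Rightarrow> int ell2"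
  is "\<lambda>W \<psi> n. \<psi> (n - 1) + \<psi> (n + 1) + complex_of_real (W n) * \<psi> n"
proof -
  fix W :: "int \<Rightarrow> real" and \<psi> :: "int \<Rightarrow> complex"
  assume W: "W \<in> bcontfun" and \<psi>: "(\<lambda>n. (norm (\<psi> n))\<^sup>2) summable_on UNIV"
  define Z where "Z = shift_ell2 (-1) (Abs_ell2 \<psi>) + shift_ell2 1 (Abs_ell2 \<psi>)
    + mult_ell2 (Bcontfun W) (Abs_ell2 \<psi>)"
  have Z: "apply_ell2 Z = (\<lambda>n. \<psi> (n - 1) + \<psi> (n + 1) + complex_of_real (W n) * \<psi> n)"
    using W \<psi> by (simp add: Z_def fun_eq_iff plus_ell2.rep_eq shift_ell2.rep_eq mult_ell2.rep_eq
        Abs_ell2_inverse Bcontfun_inverse)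
  show "(\<lambda>n. (norm (\<psi> (n - 1) + \<psi> (n + 1) + complex_of_real (W n) * \<psi> n))\<^sup>2) summable_on UNIV"
    using apply_ell2[of Z] unfolding Z by simp
qed

lemma schroedinger_fun_eq:
  "schroedinger_fun W \<psi> = shift_ell2 (-1) \<psi> + shift_ell2 1 \<psi> + mult_ell2 W \<psi>"
  by transfer simp

lift_definition schroedinger :: "(int \<Rightarrow>\<^sub>C real) \<Rightarrow> (int ell2 \<Rightarrow>\<^sub>L int ell2)" is schroedinger_fun
proof (rule bounded_linear_intro)
  fix W r and x y :: "int ell2"
  show "schroedinger_fun W (x + y) = schroedinger_fun W x + schroedinger_fun W y"
    by transfer (simp add: algebra_simps)
  show "schroedinger_fun W (r *\<^sub>R x) = r *\<^sub>R schroedinger_fun W x"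
    by transfer (simp add: algebra_simps)
  have "norm (schroedinger_fun W x) \<le> norm x + norm x + norm W * norm x"
    unfolding schroedinger_fun_eq
    by (intro order_trans[OF norm_triangle_ineq] add_mono norm_mult_ell2)
      (simp_all add: norm_shift_ell2)
  thus "norm (schroedinger_fun W x) \<le> norm x * (2 + norm W)" by (simp add: algebra_simps)
qed

text \<open>\<^typ>\<open>'i ell2 \<Rightarrow>\<^sub>L 'i ell2\<close> consists of real-linear operators, but the inverse of a
  complex-linear operator, such as \<^term>\<open>schroedinger W - scalar_op z\<close>, is automatically
  complex-linear.\<close>

definition spectrum :: "('i ell2 \<Rightarrow>\<^sub>L 'i ell2) \<Rightarrow> complex set" where
  "spectrum A = {z. \<not> (\<exists>B. B o\<^sub>L (A - scalar_op z) = id_blinfun \<and>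
                          (A - scalar_op z) o\<^sub>L B = id_blinfun)}"

text \<open>The operators are self-adjoint, so their spectra are real
  (see \<open>spectrum_schroedinger_real\<close> below) and nothing is lost by passing to real spectral
  parameters.\<close>

definition spec :: "(int \<Rightarrow>\<^sub>C real) \<Rightarrow> real set" where
  "spec W = {E. complex_of_real E \<in> spectrum (schroedinger W)}"

instance ell2 :: (type) complete_space
proof
  fix X :: "nat \<Rightarrow> 'a ell2"
  assume X: "Cauchy X"
  have "Cauchy (\<lambda>m. apply_ell2 (X m) n)" for n
  proof (rule metric_CauchyI)
    fix e :: real assume "e > 0"
    then obtain M where M: "\<And>m k. m \<ge> M \<Longrightarrow> k \<ge> M \<Longrightarrow> dist (X m) (X k) < e"
      using metric_CauchyD[OF X] by blast
    have "dist (apply_ell2 (X m) n) (apply_ell2 (X k) n) \<le> dist (X m) (X k)" for m k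
      using norm_apply_ell2_le[of "X m - X k" n] by (simp add: minus_ell2.rep_eq dist_norm)
    thus "\<exists>M. \<forall>m\<ge>M. \<forall>k\<ge>M. dist (apply_ell2 (X m) n) (apply_ell2 (X k) n) < e"
      by (meson M le_less_trans)
  qed
  hence conv: "(\<lambda>m. apply_ell2 (X m) n) \<longlonglongrightarrow> lim (\<lambda>m. apply_ell2 (X m) n)" for n
    by (simp add: Cauchy_convergent convergent_LIMSEQ_iff[symmetric])
  define f where "f = (\<lambda>n. lim (\<lambda>m. apply_ell2 (X m) n))"
  have f: "(\<lambda>m. apply_ell2 (X m) n) \<longlonglongrightarrow> f n" for n
    unfolding f_def by (rule conv)
  have tail: "\<exists>M. \<forall>m\<ge>M. \<forall>F. finite F \<longrightarrow> (\<Sum>n\<in>F. (norm (apply_ell2 (X m) n - f n))\<^sup>2) \<le> e\<^sup>2"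
    if "e > 0" for e :: real
  proof -
    obtain M where M: "\<And>m k. m \<ge> M \<Longrightarrow> k \<ge> M \<Longrightarrow> dist (X m) (X k) < e"
      using metric_CauchyD[OF X \<open>e > 0\<close>] by blast
    have "(\<Sum>n\<in>F. (norm (apply_ell2 (X m) n - f n))\<^sup>2) \<le> e\<^sup>2" if "m \<ge> M" "finite F" for m F
    proof (rule tendsto_upperbound)
      show "(\<lambda>k. \<Sum>n\<in>F. (norm (apply_ell2 (X m) n - apply_ell2 (X k) n))\<^sup>2)
          \<longlonglongrightarrow> (\<Sum>n\<in>F. (norm (apply_ell2 (X m) n - f n))\<^sup>2)"
        by (intro tendsto_intros f)
      have "(\<Sum>n\<in>F. (norm (apply_ell2 (X m) n - apply_ell2 (X k) n))\<^sup>2) \<le> e\<^sup>2" if "k \<ge> M" for k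
      proof -
        have "(norm (X m - X k))\<^sup>2 \<le> e\<^sup>2"
          using M[OF \<open>m \<ge> M\<close> that] by (intro power_mono) (auto simp: dist_norm)
        thus ?thesis
          using sum_le_norm_ell2_sq[OF \<open>finite F\<close>, of "X m - X k"] by (simp add: minus_ell2.rep_eq)
      qed
      thus "\<forall>\<^sub>F k in sequentially.
          (\<Sum>n\<in>F. (norm (apply_ell2 (X m) n - apply_ell2 (X k) n))\<^sup>2) \<le> e\<^sup>2"
        by (auto simp: eventually_sequentially)
    qed simp
    thus ?thesis by blast
  qed
  have diff: "(\<lambda>n. (norm (apply_ell2 (X m) n - f n))\<^sup>2) summable_on UNIV"
    if "\<forall>F. finite F \<longrightarrow> (\<Sum>n\<in>F. (norm (apply_ell2 (X m) n - f n))\<^sup>2) \<le> e\<^sup>2" for m e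
    by (rule nonneg_bdd_above_summable_on) (use that in \<open>auto intro!: bdd_aboveI[of _ "e\<^sup>2"]\<close>)
  obtain m e where "\<forall>F. finite F \<longrightarrow> (\<Sum>n\<in>F. (norm (apply_ell2 (X m) n - f n))\<^sup>2) \<le> e\<^sup>2"
    using tail[OF zero_less_one] by (meson order_refl)
  hence "(\<lambda>n. (norm (f n - apply_ell2 (X m) n))\<^sup>2) summable_on UNIV"
    using diff[of m e] by (simp add: norm_minus_commute)
  from summable_sq_add[OF this summable_ell2[of "X m"]]
  have "(\<lambda>n. (norm (f n))\<^sup>2) summable_on UNIV" by simp
  hence Y: "apply_ell2 (Abs_ell2 f) = f" by (simp add: Abs_ell2_inverse)
  have "X \<longlonglongrightarrow> Abs_ell2 f"
  proof (rule metric_LIMSEQ_I)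
    fix r :: real assume "r > 0"
    then obtain M where M: "\<And>m F. m \<ge> M \<Longrightarrow> finite F \<Longrightarrow>
        (\<Sum>n\<in>F. (norm (apply_ell2 (X m) n - f n))\<^sup>2) \<le> (r/2)\<^sup>2"
      using tail[of "r/2"] by auto
    have "dist (X m) (Abs_ell2 f) < r" if "m \<ge> M" for m
    proof -
      have "(norm (X m - Abs_ell2 f))\<^sup>2 \<le> (r/2)\<^sup>2"
        unfolding norm_ell2_sq using M[OF that] diff[of m "r/2"]
        by (intro infsum_le_finite_sums) (auto simp: minus_ell2.rep_eq Y)
      thus ?thesis
        using \<open>r > 0\<close> power2_le_imp_le[of "norm (X m - Abs_ell2 f)" "r/2"] by (simp add: dist_norm)
    qed
    thus "\<exists>M. \<forall>m\<ge>M. dist (X m) (Abs_ell2 f) < r" by blast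
  qed
  thus "convergent X" by (auto simp: convergent_def)
qed

lemma coercive_imp_invertible:
  fixes A :: "'a :: {real_inner, complete_space} \<Rightarrow>\<^sub>L 'a"
  assumes "c > 0" and coercive: "\<And>x. blinfun_apply A x \<bullet> x \<ge> c * (norm x)\<^sup>2"
  shows "\<exists>B. B o\<^sub>L A = id_blinfun \<and> A o\<^sub>L B = id_blinfun"
proof -
  define K where "K = norm A + c"
  have K: "K \<ge> c" "K > 0" "norm A \<le> K" using \<open>c > 0\<close> by (auto simp: K_def add_pos_nonneg add_nonneg_pos)
  define t where "t = c / K\<^sup>2"
  have t: "t > 0" using K \<open>c > 0\<close> by (simp add: t_def)
  define q where "q = 1 - c\<^sup>2 / K\<^sup>2"
  have q: "0 \<le> q" "q < 1" using K \<open>c > 0\<close> by (auto simp: q_def power_mono)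
  have contr: "norm (x - t *\<^sub>R A x) \<le> sqrt q * norm x" for x
  proof -
    have "norm (A x) \<le> K * norm x"
      by (rule order_trans[OF norm_blinfun]) (auto intro: mult_right_mono K)
    hence 1: "(norm (A x))\<^sup>2 \<le> K\<^sup>2 * (norm x)\<^sup>2"
      using power_mono[of "norm (A x)" "K * norm x" 2] by (simp add: power_mult_distrib)
    have "(norm (x - t *\<^sub>R A x))\<^sup>2 = (norm x)\<^sup>2 - 2 * t * (A x \<bullet> x) + t\<^sup>2 * (norm (A x))\<^sup>2"
      unfolding power2_norm_eq_inner
      by (simp add: inner_diff_left inner_diff_right inner_commute power2_eq_square)
    also have "\<dots> \<le> (norm x)\<^sup>2 - 2 * t * (c * (norm x)\<^sup>2) + t\<^sup>2 * (K\<^sup>2 * (norm x)\<^sup>2)"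
      using coercive[of x] 1 t by (intro add_mono diff_mono mult_left_mono) auto
    also have "\<dots> = q * (norm x)\<^sup>2"
      using K by (simp add: t_def q_def field_simps power2_eq_square)
    finally have "sqrt ((norm (x - t *\<^sub>R A x))\<^sup>2) \<le> sqrt (q * (norm x)\<^sup>2)"
      by (rule real_sqrt_le_mono)
    thus ?thesis by (simp add: real_sqrt_mult)
  qed
  have "\<exists>!x. A x = y" for y
  proof -
    define g where "g x = x - t *\<^sub>R (A x - y)" for x
    have "\<exists>!x. g x = x"
    proof (rule banach_fix_type)
      show "\<forall>x x'. dist (g x) (g x') \<le> sqrt q * dist x x'"
      proof (intro allI)
        fix x x'
        have "g x - g x' = (x - x') - t *\<^sub>R A (x - x')"
          by (simp add: g_def blinfun.diff_right algebra_simps)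
        thus "dist (g x) (g x') \<le> sqrt q * dist x x'" using contr by (simp add: dist_norm)
      qed
    qed (use q in auto)
    moreover have "g x = x \<longleftrightarrow> A x = y" for x using t by (auto simp: g_def)
    ultimately show ?thesis by simp
  qed
  hence bij: "bij (blinfun_apply A)" by (simp add: bij_iff)
  define B where "B = inv (blinfun_apply A)"
  have AB: "A (B y) = y" for y using bij by (simp add: B_def surj_f_inv_f bij_is_surj)
  have BA: "B (A x) = x" for x using bij by (simp add: B_def bij_is_inj)
  have inj: "x = y" if "A x = A y" for x y using that BA by metis
  have "bounded_linear B"
  proof (rule bounded_linear_intro)
    fix x y r
    show "B (x + y) = B x + B y" by (rule inj) (simp add: AB blinfun.add_right)
    show "B (r *\<^sub>R x) = r *\<^sub>R B x" by (rule inj) (simp add: AB blinfun.scaleR_right)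
    have "c * (norm (B x))\<^sup>2 \<le> norm x * norm (B x)"
      using coercive[of "B x"] norm_cauchy_schwarz[of x "B x"] by (simp add: AB)
    hence "c * norm (B x) \<le> norm x"
      by (cases "B x = 0") (auto simp: power2_eq_square)
    thus "norm (B x) \<le> norm x * (1 / c)" using \<open>c > 0\<close> by (simp add: field_simps)
  qed
  thus ?thesis
    using AB BA by (intro exI[of _ "Blinfun B"] conjI blinfun_eqI) (auto simp: bounded_linear_Blinfun_apply)
qed

lemma spectrum_schroedinger_real: "spectrum (schroedinger W) \<subseteq> \<real>"
proof
  fix z assume z: "z \<in> spectrum (schroedinger W)"
  show "z \<in> \<real>"
  proof (rule ccontr)
    assume "z \<notin> \<real>"
    hence Im: "Im z \<noteq> 0" by (simp add: complex_is_Real_iff)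
    define s where "s = complex_of_real (sgn (Im z)) * \<i>"
    have ss: "- s * s = 1" using Im by (auto simp: s_def sgn_if)
    define T where "T = schroedinger W - scalar_op z"
    have sc: "scalar_op u (scalar_op v x) = scalar_op (u * v) x" for u v and x :: "int ell2"
      unfolding scalar_op.rep_eq by transfer (simp add: mult.assoc)
    have sc1: "scalar_op 1 x = x" for x :: "int ell2"
      unfolding scalar_op.rep_eq by transfer simp
    have skew: "scalar_op s x \<bullet> y = - (x \<bullet> scalar_op s y)" for x y :: "int ell2"
    proof -
      have "(s * u) \<bullet> v = - (u \<bullet> (s * v))" for u v
        by (simp add: s_def inner_complex_def algebra_simps)
      thus ?thesis unfolding scalar_op.rep_eq
        by transfer (simp add: infsum_uminus)
    qed
    have shift: "scalar_op s (shift_ell2 (-1) x) \<bullet> x + scalar_op s (shift_ell2 1 x) \<bullet> x = 0" for x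
    proof -
      have "scalar_op s (shift_ell2 (-1) x) \<bullet> x
          = shift_ell2 1 (scalar_op s (shift_ell2 (-1) x)) \<bullet> shift_ell2 1 x"
        by (simp add: inner_shift_ell2)
      also have "shift_ell2 1 (scalar_op s (shift_ell2 (-1) x)) = scalar_op s x"
        unfolding scalar_op.rep_eq by transfer simp
      finally show ?thesis using skew[of x "shift_ell2 1 x"] by (simp add: inner_commute)
    qed
    have mult: "scalar_op s (mult_ell2 W x) \<bullet> x = 0" for x
    proof -
      have "(s * (complex_of_real a * u)) \<bullet> u = 0" for a u
        by (simp add: s_def inner_complex_def algebra_simps)
      thus ?thesis unfolding scalar_op.rep_eq by transfer simp
    qed
    have scal: "scalar_op s (scalar_op z x) \<bullet> x = - \<bar>Im z\<bar> * (norm x)\<^sup>2" for x :: "int ell2"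
    proof -
      have "(s * (z * u)) \<bullet> u = - \<bar>Im z\<bar> * (u \<bullet> u)" for u
        by (simp add: s_def inner_complex_def algebra_simps sgn_if)
      thus ?thesis unfolding scalar_op.rep_eq power2_norm_eq_inner
        by transfer (simp add: infsum_cmult_right' infsum_uminus)
    qed
    have "blinfun_apply (scalar_op s o\<^sub>L T) x \<bullet> x \<ge> \<bar>Im z\<bar> * (norm x)\<^sup>2" for x
      using shift[of x] mult[of x] scal[of x]
      by (simp add: T_def blinfun.diff_left blinfun.diff_right schroedinger.rep_eq
          schroedinger_fun_eq blinfun.add_right inner_add_left inner_diff_left)
    then obtain B where B: "B o\<^sub>L (scalar_op s o\<^sub>L T) = id_blinfun" "(scalar_op s o\<^sub>L T) o\<^sub>L B = id_blinfun"
      using coercive_imp_invertible[of "\<bar>Im z\<bar>" "scalar_op s o\<^sub>L T"] Im by auto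
    have "T (B (scalar_op s x)) = x" for x
    proof -
      have "scalar_op s (T (B (scalar_op s x))) = scalar_op s x"
        using arg_cong[OF B(2), of "\<lambda>A. blinfun_apply A (scalar_op s x)"] by simp
      hence "scalar_op (-s) (scalar_op s (T (B (scalar_op s x)))) = scalar_op (-s) (scalar_op s x)"
        by simp
      thus ?thesis by (simp only: sc ss sc1)
    qed
    moreover have "B (scalar_op s (T x)) = x" for x
      using arg_cong[OF B(1), of "\<lambda>A. blinfun_apply A x"] by simp
    ultimately have "(B o\<^sub>L scalar_op s) o\<^sub>L T = id_blinfun \<and> T o\<^sub>L (B o\<^sub>L scalar_op s) = id_blinfun"
      by (auto intro!: blinfun_eqI)
    thus False using z unfolding spectrum_def T_def by blast
  qed
qed

lemma spectrum_schroedinger_eq: "spectrum (schroedinger W) = complex_of_real ` spec W"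
  using spectrum_schroedinger_real[of W] by (auto simp: spec_def elim!: Reals_cases)


section \<open>Cantor sets and Hausdorff dimension\<close>

definition cantor_set :: "real set \<Rightarrow> bool" where
  "cantor_set S \<longleftrightarrow> S \<noteq> {} \<and> compact S \<and> (\<forall>x\<in>S. \<not> x isolated_in S) \<and> interior S = {}"

text \<open>Boundedness is required because \<^const>\<open>diameter\<close> is unspecified on unbounded sets.
  Only exponents \<open>s > 0\<close> are meaningful here, as \<open>0 powr 0 = 0\<close>.\<close>

definition hausdorff_premeasure :: "real \<Rightarrow> real \<Rightarrow> 'a::metric_space set \<Rightarrow> ennreal" where
  "hausdorff_premeasure s \<delta> S =
     (INF U\<in>{U :: nat \<Rightarrow> 'a set. S \<subseteq> (\<Union>i. U i) \<and> (\<forall>i. bounded (U i) \<and> diameter (U i) \<le> \<delta>)}.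
        \<Sum>i. ennreal (diameter (U i) powr s))"

definition hausdorff_measure :: "real \<Rightarrow> 'a::metric_space set \<Rightarrow> ennreal" where
  "hausdorff_measure s S = (SUP \<delta>\<in>{0<..}. hausdorff_premeasure s \<delta> S)"

definition hausdorff_dim :: "'a::metric_space set \<Rightarrow> ennreal" where
  "hausdorff_dim S = (INF s\<in>{s. s > 0 \<and> hausdorff_measure s S = 0}. ennreal s)"

end

theory Submission
  imports Defs "HOL-Complex_Analysis.Conformal_Mappings" "HOL-Real_Asymp.Real_Asymp"
begin

text \<open>Being covered by few tiny intervals and having every spectral point close to another one are
  open conditions on the potential, uniformly for \<open>c\<close> in a compact set avoiding 0 and for finitely
  many \<open>k\<close>. By Baire's theorem it suffices to realise them on a dense set of periodic potentials.
  Periodic spectra never have isolated points, since the discriminant is an open map that takes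
  values in \<open>[-2, 2]\<close> only at real energies.

  For the covering, fix a periodic \<open>V\<close>. For each single energy and each \<open>(c, k)\<close> a small periodic
  perturbation of \<open>V\<close> opens a gap there: two elliptic monodromy matrices that do not commute
  have a hyperbolic commutator, which is approximated by a word in their positive powers. By
  compactness finitely many perturbations \<open>w\<^sub>1, \<dots>, w\<^sub>m\<close> of a common period suffice for all energies
  and all \<open>(c, k)\<close>. Let \<open>P\<close> run periodically through long stretches of \<open>w\<^sub>1\<close>, then \<open>w\<^sub>2\<close>, and so on.
  At each energy in the spectrum of \<open>P\<close> one of the stretches is gapped, so a Floquet solution is
  exponentially small in its middle and its restriction to a period cut there is an approximate
  eigenvector of a finite matrix. Approximate eigenvectors for separated energies are nearly
  orthogonal; hence the spectrum lies in polynomially many intervals of exponentially small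
  length.\<close>

section \<open>Approximate eigenvectors\<close>

text \<open>The obstacle is uniformity: one potential must serve every coupling and every
  repetition, whereas a perturbation opens a gap only near the triple \<open>(E, c, k)\<close> for
  which it was made. In a concatenation it is enough that some stretch is gapped, and which one may
  depend on the energy and the parameters. The number of perturbations, their common period and the
  gap size are all fixed before the stretches are made long. Lengthening them therefore changes only
  the decay and, linearly, the size of the finite matrices. Inverses of monodromy matrices are not
  transfer matrices. But an elliptic matrix is conjugate to a rotation, so some positive power is
  close to 1, and the power before it is close to the inverse. This needs strict ellipticity;
  energies at band edges are avoided by adding a small constant to the potential, which merely
  shifts the energy. A single scale \<open>s\<close> is both exponent and bound in the covering
  condition, so letting \<open>s\<close> tend to 0 settles all positive dimensions at once.\<close>

definition shifted :: "(int \<Rightarrow>\<^sub>C real) \<Rightarrow> complex \<Rightarrow> (int ell2 \<Rightarrow>\<^sub>L int ell2)" where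
  "shifted W z = schroedinger W - scalar_op z"

lemma shifted_apply:
  "apply_ell2 (shifted W z x) n = x (n - 1) + x (n + 1) + (complex_of_real (W n) - z) * x n"
  by (simp add: shifted_def blinfun.diff_left minus_ell2.rep_eq schroedinger.rep_eq
      schroedinger_fun.rep_eq scalar_op.rep_eq scaleC_ell2.rep_eq algebra_simps)

lemma shifted_eq:
  "shifted W z x = shift_ell2 (-1) x + shift_ell2 1 x + mult_ell2 W x - scaleC_ell2 z x"
  by (simp add: shifted_def blinfun.diff_left schroedinger.rep_eq schroedinger_fun_eq scalar_op.rep_eq)

lemma inner_shift_ell2_adjoint: "shift_ell2 k x \<bullet> y = x \<bullet> shift_ell2 (- k) y"
proof -
  have "shift_ell2 k (shift_ell2 (- k) y) = y" by transfer simp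
  thus ?thesis using inner_shift_ell2[of k x "shift_ell2 (- k) y"] by simp
qed

lemma inner_mult_ell2_adjoint: "mult_ell2 W x \<bullet> y = x \<bullet> mult_ell2 W y"
proof -
  have "(complex_of_real a * u) \<bullet> v = u \<bullet> (complex_of_real a * v)" for a u v
    by (simp add: inner_complex_def algebra_simps)
  thus ?thesis by transfer simp
qed

lemma scaleC_ell2_of_real: "scaleC_ell2 (complex_of_real E) x = E *\<^sub>R x"
  by transfer (simp add: scaleR_conv_of_real)

lemma inner_shifted:
  "shifted W (complex_of_real E) x \<bullet> y = x \<bullet> shifted W (complex_of_real E) y"
  by (simp add: shifted_eq inner_shift_ell2_adjoint inner_mult_ell2_adjoint scaleC_ell2_of_real
      inner_add_left inner_add_right inner_diff_left inner_diff_right)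

lemma norm_scaleC_ell2: "norm (scaleC_ell2 z x) = norm z * norm (x :: 'i ell2)"
proof (rule power2_eq_imp_eq)
  show "(norm (scaleC_ell2 z x))\<^sup>2 = (norm z * norm x)\<^sup>2"
    by (simp add: norm_ell2_sq scaleC_ell2.rep_eq norm_mult power_mult_distrib infsum_cmult_right')
qed auto

text \<open>For \<open>g > 0\<close> this says that \<open>E\<close> has distance at least
  \<open>g\<close> from the spectrum. For \<open>g \<le> 0\<close> it is vacuous, which keeps
  perturbation estimates free of case distinctions.\<close>

definition gap :: "(int \<Rightarrow>\<^sub>C real) \<Rightarrow> real \<Rightarrow> real \<Rightarrow> bool" where
  "gap W E g \<longleftrightarrow> (\<forall>x. g * norm x \<le> norm (shifted W (complex_of_real E) x))"

lemma spec_iff_shifted: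
  "E \<notin> spec W \<longleftrightarrow> (\<exists>B. B o\<^sub>L shifted W (complex_of_real E) = id_blinfun \<and>
     shifted W (complex_of_real E) o\<^sub>L B = id_blinfun)"
  by (simp add: spec_def spectrum_def shifted_def)

text \<open>For a symmetric \<open>T\<close> that is bounded below, the square is coercive, hence
  invertible. The inverse \<open>C\<close> of the square commutes with \<open>T\<close>, so
  \<open>C o\<^sub>L T\<close> is a two-sided inverse of \<open>T\<close>.\<close>

lemma gap_imp_not_spec:
  assumes "g > 0" "gap W E g"
  shows "E \<notin> spec W"
proof -
  define T where "T = shifted W (complex_of_real E)"
  have "blinfun_apply (T o\<^sub>L T) x \<bullet> x \<ge> g\<^sup>2 * (norm x)\<^sup>2" for x
  proof -
    have "g * norm x \<le> norm (T x)" using assms(2) by (simp add: gap_def T_def)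
    hence "(g * norm x)\<^sup>2 \<le> (norm (T x))\<^sup>2" using assms(1) by (intro power_mono) auto
    thus ?thesis
      by (simp add: power_mult_distrib T_def inner_shifted power2_norm_eq_inner)
  qed
  then obtain C where C: "C o\<^sub>L (T o\<^sub>L T) = id_blinfun" "(T o\<^sub>L T) o\<^sub>L C = id_blinfun"
    using coercive_imp_invertible[of "g\<^sup>2" "T o\<^sub>L T"] assms(1) by auto
  have a: "C (T (T x)) = x" "T (T (C x)) = x" for x
    using arg_cong[OF C(1), of "\<lambda>A. blinfun_apply A x"] arg_cong[OF C(2), of "\<lambda>A. blinfun_apply A x"]
    by auto
  have "C (T x) = T (C x)" for x
    by (metis a)
  hence "(C o\<^sub>L T) o\<^sub>L T = id_blinfun \<and> T o\<^sub>L (C o\<^sub>L T) = id_blinfun"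
    using a by (auto intro!: blinfun_eqI)
  thus ?thesis unfolding spec_iff_shifted T_def by blast
qed

lemma not_spec_imp_gap:
  assumes "E \<notin> spec W"
  obtains g where "g > 0" "gap W E g"
proof -
  from assms obtain B where B: "B o\<^sub>L shifted W (complex_of_real E) = id_blinfun"
    unfolding spec_iff_shifted by blast
  define K where "K = norm B + 1"
  have K: "K > 0" "norm B \<le> K" by (auto simp: K_def add_nonneg_pos)
  have "1 / K * norm x \<le> norm (shifted W (complex_of_real E) x)" for x
  proof -
    have "x = B (shifted W (complex_of_real E) x)"
      using arg_cong[OF B, of "\<lambda>A. blinfun_apply A x"] by simp
    hence "norm x \<le> norm B * norm (shifted W (complex_of_real E) x)"
      by (metis norm_blinfun)
    also have "\<dots> \<le> K * norm (shifted W (complex_of_real E) x)"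
      using K by (intro mult_right_mono) auto
    finally show ?thesis using K by (simp add: field_simps)
  qed
  thus ?thesis using K by (intro that[of "1 / K"]) (auto simp: gap_def)
qed

lemma norm_shifted_diff:
  "norm (shifted W z x - shifted W' z' x) \<le> (dist W W' + dist z z') * norm x"
proof -
  have "mult_ell2 W x - mult_ell2 W' x = mult_ell2 (W - W') x"
    by (rule ell2_eqI) (simp add: minus_ell2.rep_eq mult_ell2.rep_eq algebra_simps)
  moreover have "scaleC_ell2 z x - scaleC_ell2 z' x = scaleC_ell2 (z - z') x"
    by (rule ell2_eqI) (simp add: minus_ell2.rep_eq scaleC_ell2.rep_eq algebra_simps)
  ultimately have "shifted W z x - shifted W' z' x = mult_ell2 (W - W') x - scaleC_ell2 (z - z') x"
    unfolding shifted_eq by (simp add: algebra_simps)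
  also have "norm \<dots> \<le> norm (W - W') * norm x + norm (z - z') * norm x"
    by (rule order_trans[OF norm_triangle_ineq4])
      (intro add_mono norm_mult_ell2, simp add: norm_scaleC_ell2)
  finally show ?thesis by (simp add: dist_norm algebra_simps)
qed

lemma gap_perturb:
  assumes "gap W E g"
  shows "gap W' E' (g - dist W W' - dist E E')"
  unfolding gap_def
proof
  fix x :: "int ell2"
  let ?T = "shifted W (complex_of_real E) x" and ?T' = "shifted W' (complex_of_real E') x"
  have "norm (?T - ?T') \<le> (dist W W' + dist E E') * norm x"
    using norm_shifted_diff[of W "complex_of_real E" x W' "complex_of_real E'"] by simp
  moreover have "norm ?T \<le> norm ?T' + norm (?T - ?T')"
    by (metis add.commute diff_add_cancel norm_triangle_ineq)
  moreover have "g * norm x \<le> norm ?T" using assms by (simp add: gap_def)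
  ultimately show "(g - dist W W' - dist E E') * norm x \<le> norm ?T'"
    by (simp add: algebra_simps)
qed

lemma gap_far: "gap W E (\<bar>E\<bar> - 2 - norm W)"
  unfolding gap_def
proof
  fix x :: "int ell2"
  let ?T = "shifted W (complex_of_real E) x"
  have "\<bar>E\<bar> * norm x = norm (shift_ell2 (-1) x + shift_ell2 1 x + mult_ell2 W x - ?T)"
    unfolding shifted_eq by (simp add: scaleC_ell2_of_real)
  also have "\<dots> \<le> norm x + norm x + norm W * norm x + norm ?T"
    by (intro order_trans[OF norm_triangle_ineq4] order_trans[OF norm_triangle_ineq] add_mono norm_mult_ell2)
      (simp_all add: norm_shift_ell2)
  finally show "(\<bar>E\<bar> - 2 - norm W) * norm x \<le> norm ?T" by (simp add: algebra_simps)
qed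

text \<open>With \<open>r\<close> the infimum of \<open>norm (A x) / norm x\<close>, the operator \<open>A\<^sup>2 - r\<^sup>2\<close> is
  positive without being bounded below, so one of \<open>A - r\<close>, \<open>A + r\<close> is not invertible.\<close>

lemma spec_near:
  assumes "x \<noteq> 0" "norm (shifted W (complex_of_real E) x) \<le> c * norm x"
  shows "\<exists>E'\<in>spec W. dist E' E \<le> c"
proof -
  define A where "A = shifted W (complex_of_real E)"
  define R where "R = (\<lambda>x. norm (A x) / norm x) ` (- {0})"
  define r where "r = Inf R"
  have R: "R \<noteq> {}" "bdd_below R" using \<open>x \<noteq> 0\<close> by (auto simp: R_def intro!: bdd_belowI[of _ 0])
  have r0: "r \<ge> 0" unfolding r_def by (rule cInf_greatest) (use R in \<open>auto simp: R_def\<close>)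
  have "norm (A x) / norm x \<in> R" using \<open>x \<noteq> 0\<close> by (auto simp: R_def)
  hence "r \<le> norm (A x) / norm x" unfolding r_def by (rule cInf_lower) (rule R)
  also have "\<dots> \<le> c" using assms by (simp add: A_def divide_le_eq)
  finally have rc: "r \<le> c" .
  have lower: "r * norm y \<le> norm (A y)" for y
  proof (cases "y = 0")
    case False
    hence "norm (A y) / norm y \<in> R" by (auto simp: R_def)
    hence "r \<le> norm (A y) / norm y" unfolding r_def by (rule cInf_lower) (rule R)
    thus ?thesis using False by (simp add: field_simps)
  qed simp
  have sym: "A x \<bullet> y = x \<bullet> A y" for x y unfolding A_def by (rule inner_shifted)
  define T where "T y = A (A y) - r\<^sup>2 *\<^sub>R y" for y
  define K where "K = norm A * norm A + r\<^sup>2 + 1"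
  have K: "K > 0" by (auto simp: K_def intro!: add_nonneg_pos)
  have TK: "norm (T y) \<le> K * norm y" for y
  proof -
    have "norm (A (A y)) \<le> norm A * (norm A * norm y)"
      by (rule order_trans[OF norm_blinfun]) (intro mult_left_mono norm_blinfun norm_ge_zero)
    moreover have "norm (T y) \<le> norm (A (A y)) + r\<^sup>2 * norm y"
      unfolding T_def by (rule order_trans[OF norm_triangle_ineq4]) simp
    ultimately show ?thesis by (simp add: K_def algebra_simps) (use norm_ge_zero[of y] in linarith)
  qed
  have Tform: "T y \<bullet> y = (norm (A y))\<^sup>2 - r\<^sup>2 * (norm y)\<^sup>2" for y
    by (simp add: T_def inner_diff_left sym power2_norm_eq_inner)
  have Tpos: "T y \<bullet> y \<ge> 0" for y
  proof -
    have "(r * norm y)\<^sup>2 \<le> (norm (A y))\<^sup>2" using lower r0 by (intro power_mono) auto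
    thus ?thesis by (simp add: Tform power_mult_distrib)
  qed
  have Tsym: "T y \<bullet> z = y \<bullet> T z" for y z
    by (simp add: T_def inner_diff_left inner_diff_right sym)
  have Tlin: "T (y - t *\<^sub>R z) = T y - t *\<^sub>R T z" for y z t
    by (simp add: T_def blinfun.diff_right blinfun.scaleR_right algebra_simps)
  \<comment> \<open>Cauchy-Schwarz for the positive form of \<open>T\<close>, obtained from its
    nonnegative value at \<open>y - T y / K\<close>. Vectors that nearly minimise the form are thus
    nearly annihilated by \<open>T\<close>.\<close>
  have T2: "(norm (T y))\<^sup>2 \<le> K * (T y \<bullet> y)" for y
  proof -
    define t where "t = 1 / K"
    have t: "t > 0" "t * K = 1" using K by (auto simp: t_def)
    have "0 \<le> T (y - t *\<^sub>R T y) \<bullet> (y - t *\<^sub>R T y)" by (rule Tpos)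
    also have "\<dots> = T y \<bullet> y - 2 * t * (norm (T y))\<^sup>2 + t\<^sup>2 * (T (T y) \<bullet> T y)"
      unfolding Tlin power2_norm_eq_inner
      by (simp add: inner_diff_left inner_diff_right Tsym[of "T y" y] power2_eq_square algebra_simps)
    also have "T (T y) \<bullet> T y \<le> K * (norm (T y))\<^sup>2"
    proof -
      have "T (T y) \<bullet> T y \<le> norm (T (T y)) * norm (T y)" by (rule norm_cauchy_schwarz)
      also have "\<dots> \<le> K * norm (T y) * norm (T y)" by (intro mult_right_mono TK) auto
      finally show ?thesis by (simp add: power2_eq_square)
    qed
    hence "T y \<bullet> y - 2 * t * (norm (T y))\<^sup>2 + t\<^sup>2 * (T (T y) \<bullet> T y)
        \<le> T y \<bullet> y - 2 * t * (norm (T y))\<^sup>2 + t\<^sup>2 * (K * (norm (T y))\<^sup>2)"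
      by (intro add_left_mono mult_left_mono) auto
    also have "\<dots> = T y \<bullet> y - t * (norm (T y))\<^sup>2"
    proof -
      have "t\<^sup>2 * (K * (norm (T y))\<^sup>2) = t * (t * K) * (norm (T y))\<^sup>2"
        by (simp add: power2_eq_square)
      also have "\<dots> = t * (norm (T y))\<^sup>2" using t by simp
      finally show ?thesis by simp
    qed
    finally have "t * (norm (T y))\<^sup>2 \<le> T y \<bullet> y" by simp
    thus ?thesis using K by (simp add: t_def field_simps)
  qed
  have "E + r \<in> spec W \<or> E - r \<in> spec W"
  proof (rule ccontr)
    assume "\<not> ?thesis"
    then obtain g1 g2 where g: "g1 > 0" "gap W (E + r) g1" "g2 > 0" "gap W (E - r) g2"
      by (metis not_spec_imp_gap)
    have sh: "shifted W (complex_of_real (E + s)) y = A y - s *\<^sub>R y" for s y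
      by (rule ell2_eqI) (simp add: A_def shifted_apply minus_ell2.rep_eq scaleR_ell2.rep_eq
          scaleR_conv_of_real algebra_simps)
    define g where "g = g1 * g2"
    have g0: "g > 0" using g by (simp add: g_def)
    have T_low: "g * norm y \<le> norm (T y)" for y
    proof -
      have "T y = (A (A y + r *\<^sub>R y)) - r *\<^sub>R (A y + r *\<^sub>R y)"
        by (simp add: T_def blinfun.add_right blinfun.scaleR_right power2_eq_square algebra_simps)
      hence "norm (T y) \<ge> g1 * norm (A y + r *\<^sub>R y)"
        using g(2) by (simp add: gap_def sh[of r] del: of_real_add)
      moreover have "norm (A y + r *\<^sub>R y) \<ge> g2 * norm y"
        using g(4) sh[of "-r"] by (simp add: gap_def)
      hence "g1 * norm (A y + r *\<^sub>R y) \<ge> g1 * (g2 * norm y)"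
        using g by (intro mult_left_mono) auto
      ultimately show ?thesis by (simp add: g_def mult.assoc)
    qed
    define e where "e = sqrt (r\<^sup>2 + g\<^sup>2 / (2 * K))"
    have "r\<^sup>2 < r\<^sup>2 + g\<^sup>2 / (2 * K)" using g0 K by simp
    hence "sqrt (r\<^sup>2) < e" unfolding e_def by (rule real_sqrt_less_mono)
    hence "r < e" using r0 by simp
    then obtain q where "q \<in> R" "q < e"
      unfolding r_def using R cInf_lessD by blast
    then obtain y where y: "y \<noteq> 0" "norm (A y) / norm y < e"
      by (auto simp: R_def)
    hence y: "y \<noteq> 0" "norm (A y) < e * norm y" by (auto simp: divide_less_eq)
    have "(norm (A y))\<^sup>2 \<le> (e * norm y)\<^sup>2" using y by (intro power_mono) auto
    also have "\<dots> = (r\<^sup>2 + g\<^sup>2 / (2 * K)) * (norm y)\<^sup>2"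
      using K g0 by (simp add: e_def power_mult_distrib)
    finally have "T y \<bullet> y \<le> g\<^sup>2 / (2 * K) * (norm y)\<^sup>2" by (simp add: Tform algebra_simps)
    hence "K * (T y \<bullet> y) \<le> K * (g\<^sup>2 / (2 * K) * (norm y)\<^sup>2)" using K by (intro mult_left_mono) auto
    also have "\<dots> = g\<^sup>2 / 2 * (norm y)\<^sup>2" using K by simp
    finally have "(norm (T y))\<^sup>2 \<le> g\<^sup>2 / 2 * (norm y)\<^sup>2" using T2[of y] by simp
    moreover have "(g * norm y)\<^sup>2 \<le> (norm (T y))\<^sup>2" using T_low g0 by (intro power_mono) auto
    ultimately have "g\<^sup>2 * (norm y)\<^sup>2 \<le> g\<^sup>2 / 2 * (norm y)\<^sup>2" by (simp add: power_mult_distrib)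
    thus False using y g0 by simp
  qed
  thus ?thesis
    using rc r0 by (auto simp: dist_norm intro: bexI[of _ "E + r"] bexI[of _ "E - r"])
qed

section \<open>Dependence of the spectrum on the potential\<close>

lemma spec_approx_eigenvector:
  assumes "E \<in> spec W" "c > 0"
  obtains x where "x \<noteq> 0" "norm (shifted W (complex_of_real E) x) \<le> c * norm x"
proof -
  from assms have "\<not> gap W E c" using gap_imp_not_spec by blast
  then obtain x where "norm (shifted W (complex_of_real E) x) < c * norm x"
    by (auto simp: gap_def not_le)
  thus ?thesis by (intro that[of x]) auto
qed

text \<open>An approximate eigenvector for \<open>W\<close> is one for \<open>W'\<close>, with an
  error larger by at most \<open>dist W W'\<close>. So the spectrum moves, in Hausdorff distance, no
  more than the potential; the strict bound \<open>d\<close> leaves room for the error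
  \<open>c\<close>.\<close>

lemma spec_dist:
  assumes "E \<in> spec W" "dist W W' < d"
  obtains E' where "E' \<in> spec W'" "dist E' E < d"
proof -
  define c where "c = (d - dist W W') / 2"
  have "c > 0" using assms by (simp add: c_def)
  then obtain x where x: "x \<noteq> 0" "norm (shifted W (complex_of_real E) x) \<le> c * norm x"
    using spec_approx_eigenvector[OF assms(1)] by blast
  have "norm (shifted W' (complex_of_real E) x) \<le> norm (shifted W (complex_of_real E) x)
      + norm (shifted W' (complex_of_real E) x - shifted W (complex_of_real E) x)"
    by (metis add.commute diff_add_cancel norm_triangle_ineq)
  also have "\<dots> \<le> c * norm x + (dist W' W + dist (complex_of_real E) (complex_of_real E)) * norm x"
    by (intro add_mono x norm_shifted_diff)
  also have "\<dots> = (c + dist W W') * norm x" by (simp add: dist_commute algebra_simps)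
  finally obtain E' where "E' \<in> spec W'" "dist E' E \<le> c + dist W W'"
    using spec_near[OF x(1)] by blast
  moreover have "c + dist W W' < d" using assms by (simp add: c_def field_simps)
  ultimately show ?thesis using that by force
qed

lemma closed_spec_pairs: "closed {(W, E). E \<in> spec W}"
proof -
  have "\<exists>e>0. \<forall>q. dist q p < e \<longrightarrow> q \<in> - {(W, E). E \<in> spec W}" if "p \<in> - {(W, E). E \<in> spec W}" for p
  proof -
    obtain W E where p: "p = (W, E)" by (cases p)
    with that have "E \<notin> spec W" by simp
    then obtain g where g: "g > 0" "gap W E g" using not_spec_imp_gap by blast
    have "E' \<notin> spec W'" if "dist (W', E') p < g / 2" for W' E'
    proof -
      have "dist W W' < g / 2" "dist E E' < g / 2"
        using that dist_fst_le[of "(W', E')" p] dist_snd_le[of "(W', E')" p]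
        by (auto simp: dist_commute p)
      hence "g - dist W W' - dist E E' > 0" by linarith
      thus ?thesis using gap_perturb[OF g(2)] gap_imp_not_spec by blast
    qed
    thus ?thesis using g(1) by (intro exI[of _ "g / 2"]) auto
  qed
  hence "open (- {(W, E). E \<in> spec W})" unfolding open_dist by blast
  thus ?thesis by (simp add: closed_def)
qed

lemma spec_bounded: "spec W \<subseteq> cball 0 (2 + norm W)"
proof
  fix E assume "E \<in> spec W"
  hence "\<not> \<bar>E\<bar> - 2 - norm W > 0" using gap_far gap_imp_not_spec by blast
  thus "E \<in> cball 0 (2 + norm W)" by simp
qed

lemma compact_spec: "compact (spec W)"
proof -
  have "closed (Pair W -` {(W, E). E \<in> spec W})"
    by (intro closed_vimage closed_spec_pairs continuous_intros)
  hence "closed (spec W)" by (simp add: vimage_def)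
  thus ?thesis using spec_bounded bounded_cball bounded_subset compact_eq_bounded_closed by metis
qed

text \<open>The value is 0 for infinite \<open>D\<close>, which makes this a total function into
  square-summable sequences. It serves to truncate solutions of the eigenvalue equation, which need
  not be square-summable themselves.\<close>

lift_definition cutoff :: "'i set \<Rightarrow> ('i \<Rightarrow> complex) \<Rightarrow> 'i ell2" is
  "\<lambda>D u n. if finite D \<and> n \<in> D then u n else 0"
proof -
  fix D and u :: "'i \<Rightarrow> complex"
  have "(\<lambda>n. (norm (if finite D \<and> n \<in> D then u n else 0))\<^sup>2) summable_on (if finite D then D else {})"
    by (rule summable_on_finite) auto
  thus "(\<lambda>n. (norm (if finite D \<and> n \<in> D then u n else 0))\<^sup>2) summable_on UNIV"
    by (rule summable_on_cong_neutral[THEN iffD1, rotated -1]) (auto split: if_splits)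
qed

lemma cutoff_apply: "finite D \<Longrightarrow> apply_ell2 (cutoff D u) n = (if n \<in> D then u n else 0)"
  by (simp add: cutoff.rep_eq)

lemma norm_sq_finite_support:
  assumes "finite D" "\<And>n. n \<notin> D \<Longrightarrow> apply_ell2 x n = 0"
  shows "(norm x)\<^sup>2 = (\<Sum>n\<in>D. (norm (apply_ell2 x n))\<^sup>2)"
proof -
  have "(norm x)\<^sup>2 = (\<Sum>\<^sub>\<infinity>n\<in>D. (norm (apply_ell2 x n))\<^sup>2)"
    unfolding norm_ell2_sq by (rule infsum_cong_neutral) (use assms in auto)
  thus ?thesis using assms by simp
qed

lemma inner_finite_support:
  assumes "finite D" "\<And>n. n \<notin> D \<Longrightarrow> apply_ell2 x n = 0"
  shows "x \<bullet> y = (\<Sum>n\<in>D. apply_ell2 x n \<bullet> apply_ell2 y n)"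
proof -
  have "x \<bullet> y = (\<Sum>\<^sub>\<infinity>n\<in>D. apply_ell2 x n \<bullet> apply_ell2 y n)"
    unfolding inner_ell2.rep_eq by (rule infsum_cong_neutral) (use assms in auto)
  thus ?thesis using assms by simp
qed

lemma spec_nonempty: "spec W \<noteq> {}"
proof -
  define x :: "int ell2" where "x = cutoff {0} (\<lambda>_. 1)"
  have "x 0 = 1" by (simp add: x_def cutoff_apply)
  hence "x \<noteq> 0" by (auto simp: zero_ell2.rep_eq)
  hence "norm (shifted W (complex_of_real 0) x) \<le> norm (shifted W (complex_of_real 0) x) / norm x * norm x"
    by simp
  thus ?thesis using spec_near[OF \<open>x \<noteq> 0\<close>] by blast
qed

section \<open>Two-by-two matrices\<close>

datatype 'a m2 = M2 (m11: 'a) (m12: 'a) (m21: 'a) (m22: 'a)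

instantiation m2 :: (comm_ring_1) ring_1
begin
definition "0 = M2 0 0 0 0"
definition "1 = M2 1 0 0 1"
definition "X + Y = M2 (m11 X + m11 Y) (m12 X + m12 Y) (m21 X + m21 Y) (m22 X + m22 Y)"
definition "X - Y = M2 (m11 X - m11 Y) (m12 X - m12 Y) (m21 X - m21 Y) (m22 X - m22 Y)"
definition "- X = M2 (- m11 X) (- m12 X) (- m21 X) (- m22 X)"
definition "X * Y = M2 (m11 X * m11 Y + m12 X * m21 Y) (m11 X * m12 Y + m12 X * m22 Y)
                       (m21 X * m11 Y + m22 X * m21 Y) (m21 X * m12 Y + m22 X * m22 Y)"
instance
  by standard (simp_all add: zero_m2_def one_m2_def plus_m2_def minus_m2_def uminus_m2_def
      times_m2_def algebra_simps)
end

lemmas m2_defs = zero_m2_def one_m2_def plus_m2_def minus_m2_def uminus_m2_def times_m2_def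

lemma m2_entries [simp]:
  "m11 (X + Y) = m11 X + m11 Y" "m12 (X + Y) = m12 X + m12 Y"
  "m21 (X + Y) = m21 X + m21 Y" "m22 (X + Y) = m22 X + m22 Y"
  "m11 (X - Y) = m11 X - m11 Y" "m12 (X - Y) = m12 X - m12 Y"
  "m21 (X - Y) = m21 X - m21 Y" "m22 (X - Y) = m22 X - m22 Y"
  "m11 (X * Y) = m11 X * m11 Y + m12 X * m21 Y" "m12 (X * Y) = m11 X * m12 Y + m12 X * m22 Y"
  "m21 (X * Y) = m21 X * m11 Y + m22 X * m21 Y" "m22 (X * Y) = m21 X * m12 Y + m22 X * m22 Y"
  "m11 (1 :: 'a m2) = 1" "m12 (1 :: 'a m2) = 0" "m21 (1 :: 'a m2) = 0" "m22 (1 :: 'a m2) = 1"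
  for X Y :: "'a :: comm_ring_1 m2"
  by (simp_all add: m2_defs)

lemma m2_eq_iff: "X = Y \<longleftrightarrow> m11 X = m11 Y \<and> m12 X = m12 Y \<and> m21 X = m21 Y \<and> m22 X = m22 Y"
  by (cases X; cases Y) auto

definition mtr :: "'a :: comm_ring_1 m2 \<Rightarrow> 'a" where "mtr X = m11 X + m22 X"
definition mdet :: "'a :: comm_ring_1 m2 \<Rightarrow> 'a" where "mdet X = m11 X * m22 X - m12 X * m21 X"
definition madj :: "'a :: comm_ring_1 m2 \<Rightarrow> 'a m2" where "madj X = M2 (m22 X) (- m12 X) (- m21 X) (m11 X)"

lemma madj_entries [simp]:
  "m11 (madj X) = m22 X" "m12 (madj X) = - m12 X" "m21 (madj X) = - m21 X" "m22 (madj X) = m11 X"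
  by (simp_all add: madj_def)

lemma mdet_mult: "mdet (X * Y) = mdet X * mdet Y"
  by (simp add: mdet_def algebra_simps)

lemma mdet_one [simp]: "mdet 1 = 1" by (simp add: mdet_def)

lemma mdet_power: "mdet (X ^ n) = mdet X ^ n"
  by (induction n) (simp_all add: mdet_mult)

lemma mtr_commute: "mtr (X * Y) = mtr (Y * X)"
  by (simp add: mtr_def algebra_simps)

lemma madj_mult: "mdet X = 1 \<Longrightarrow> madj X * X = 1" "mdet X = 1 \<Longrightarrow> X * madj X = 1"
  by (simp_all add: m2_eq_iff mdet_def algebra_simps)

text \<open>With \<open>C\<close> the group commutator, \<open>C - 1\<close> is
  \<open>X * Y - Y * X\<close> times matrices of determinant 1, while the determinant of
  \<open>C - 1\<close> is \<open>2 - mtr C\<close> because \<open>C\<close> has determinant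
  1.\<close>

lemma mdet_commutator:
  assumes "mdet X = 1" "mdet Y = 1"
  shows "mtr (X * Y * madj X * madj Y) = 2 - mdet (X * Y - Y * X)"
proof -
  have "mtr (X * Y * madj X * madj Y) = 2 * (mdet X * mdet Y) - mdet (X * Y - Y * X)"
    unfolding mtr_def mdet_def by (simp add: algebra_simps)
  thus ?thesis using assms by simp
qed

text \<open>Traceless matrices form a space of signature (2,1) under \<open>- mdet\<close>. The traceless part of an
  elliptic \<open>X\<close> is timelike and orthogonal to the commutator, which is therefore spacelike.\<close>

lemma commutator_elliptic:
  fixes X Y :: "real m2"
  assumes X: "mdet X = 1" "\<bar>mtr X\<bar> < 2" and Y: "mdet Y = 1" and ne: "X * Y \<noteq> Y * X"
  shows "mtr (X * Y * madj X * madj Y) > 2"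
proof -
  define x where "x = (m11 X - m22 X) / 2"
  define b where "b = m12 X"
  define c where "c = m21 X"
  define Z where "Z = X * Y - Y * X"
  define z where "z = m11 Z"
  define u where "u = m12 Z"
  define v where "v = m21 Z"
  have z22: "m22 Z = - z" by (simp add: Z_def z_def)
  \<comment> \<open>The trace of \<open>X * Z\<close> vanishes; in coordinates this is the
    orthogonality to the commutator.\<close>
  have orth: "2 * z * x + u * c + v * b = 0"
    by (simp add: Z_def z_def u_def v_def x_def b_def c_def field_simps)
  have "(mtr X)\<^sup>2 < 2\<^sup>2" using X(2) by (metis abs_ge_zero power2_abs power_strict_mono pos2)
  moreover have "(mtr X)\<^sup>2 = 4 * (mdet X + x\<^sup>2 + b * c)"
    by (simp add: mtr_def mdet_def x_def b_def c_def power2_eq_square field_simps)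
  ultimately have D: "x\<^sup>2 + b * c < 0" using X(1) by simp
  hence bc: "b * c < 0" using zero_le_power2[of x] by linarith
  have "Z \<noteq> 0" using ne by (simp add: Z_def)
  hence Z0: "z \<noteq> 0 \<or> u \<noteq> 0 \<or> v \<noteq> 0"
    using z22 by (auto simp: m2_eq_iff z_def u_def v_def zero_m2_def)
  have zx: "(z * x)\<^sup>2 \<ge> u * v * (b * c)"
  proof -
    have "z * x = - (u * c + v * b) / 2" using orth by simp
    hence "(z * x)\<^sup>2 = (- (u * c + v * b) / 2)\<^sup>2" by (rule arg_cong)
    hence "(z * x)\<^sup>2 = (u * c + v * b)\<^sup>2 / 4" by (simp only: power_divide power2_minus) simp
    also have "\<dots> = u * v * (b * c) + (u * c - v * b)\<^sup>2 / 4"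
      by (simp add: power2_eq_square field_simps)
    finally show ?thesis by simp
  qed
  have "z\<^sup>2 + u * v > 0"
  proof (cases "u * v \<ge> 0")
    case True
    show ?thesis
    proof (rule ccontr)
      assume "\<not> ?thesis"
      hence "z = 0" "u * v = 0" using True zero_le_power2[of z] by (auto simp: not_less add_nonpos_eq_0_iff)
          (metis add_increasing2 antisym mult_eq_0_iff order.refl power2_eq_square zero_le_square add_nonneg_eq_0_iff zero_le_power2)+
      thus False using orth bc Z0 by auto
    qed
  next
    case False
    hence uv: "u * v < 0" by simp
    hence pos: "u * v * (b * c) > 0" using bc by (rule mult_neg_neg)
    hence "(z * x)\<^sup>2 > 0" using zx by linarith
    hence x2: "x\<^sup>2 > 0" by (cases "x = 0") auto
    have "(- (u * v)) * x\<^sup>2 < (- (u * v)) * (- (b * c))"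
      using uv D by (intro mult_strict_left_mono) auto
    also have "\<dots> \<le> z\<^sup>2 * x\<^sup>2" using zx by (simp add: power_mult_distrib)
    finally have "- (u * v) < z\<^sup>2" using x2 by (metis mult_less_cancel_right_pos)
    thus ?thesis by simp
  qed
  moreover have "mdet Z = - (z\<^sup>2 + u * v)"
    unfolding mdet_def z22 by (simp add: z_def u_def v_def power2_eq_square)
  ultimately show ?thesis using mdet_commutator[OF X(1) Y] by (simp add: Z_def)
qed

text \<open>Everything commuting with \<open>X\<close> has the form \<open>s + y * X0\<close>, where
  \<open>X0\<close> is the traceless part of \<open>X\<close>, of determinant \<open>D > 0\<close>.
  Determinant 1 then means \<open>s^2 + D * y^2 = 1\<close>, an ellipse. The entry
  \<open>m21 X\<close> is nonzero because \<open>D > 0\<close> forces \<open>b * c < 0\<close>, so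
  \<open>y\<close> can be read off from \<open>m21 Y\<close>.\<close>

lemma commutant_elliptic_bounded:
  fixes X :: "real m2"
  assumes X: "mdet X = 1" "\<bar>mtr X\<bar> < 2"
  obtains K where "\<And>Y. mdet Y = 1 \<Longrightarrow> X * Y = Y * X \<Longrightarrow>
     \<bar>m11 Y\<bar> \<le> K \<and> \<bar>m12 Y\<bar> \<le> K \<and> \<bar>m21 Y\<bar> \<le> K \<and> \<bar>m22 Y\<bar> \<le> K"
proof -
  define x where "x = (m11 X - m22 X) / 2"
  define b where "b = m12 X"
  define c where "c = m21 X"
  define D where "D = - (x\<^sup>2 + b * c)"
  have "(mtr X)\<^sup>2 < 2\<^sup>2" using X(2) by (metis abs_ge_zero power2_abs power_strict_mono pos2)
  moreover have "(mtr X)\<^sup>2 = 4 * (mdet X + x\<^sup>2 + b * c)"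
    by (simp add: mtr_def mdet_def x_def b_def c_def power2_eq_square field_simps)
  ultimately have D: "D > 0" using X(1) by (simp add: D_def)
  hence "b * c < 0" using zero_le_power2[of x] unfolding D_def by linarith
  hence c0: "c \<noteq> 0" by auto
  define K0 where "K0 = 1 / sqrt D"
  define K where "K = 1 + (\<bar>x\<bar> + \<bar>b\<bar> + \<bar>c\<bar>) * K0"
  have K0: "K0 > 0" using D by (simp add: K0_def)
  have "\<bar>m11 Y\<bar> \<le> K \<and> \<bar>m12 Y\<bar> \<le> K \<and> \<bar>m21 Y\<bar> \<le> K \<and> \<bar>m22 Y\<bar> \<le> K"
    if Y: "mdet Y = 1" "X * Y = Y * X" for Y
  proof -
    define y where "y = m21 Y / c"
    define s where "s = (m11 Y + m22 Y) / 2"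
    have g: "m21 Y = c * y" using c0 by (simp add: y_def)
    have "b * m21 Y = m12 Y * c"
      using arg_cong[OF Y(2), of m11] by (simp add: b_def c_def algebra_simps)
    hence f: "m12 Y = b * y" using c0 by (simp add: y_def field_simps)
    have "c * m11 Y + m22 X * m21 Y = m21 Y * m11 X + m22 Y * c"
      using arg_cong[OF Y(2), of m21] by (simp add: c_def)
    hence "c * (m11 Y - m22 Y) = c * (2 * x * y)" by (simp add: x_def g algebra_simps)
    hence "m11 Y - m22 Y = 2 * x * y" using c0 by simp
    hence e: "m11 Y = s + x * y" "m22 Y = s - x * y" by (simp_all add: s_def field_simps)
    have "s\<^sup>2 + D * y\<^sup>2 = 1"
      using Y(1) unfolding mdet_def f g e D_def by (simp add: power2_eq_square algebra_simps)
    moreover have "D * y\<^sup>2 \<ge> 0" using D by simp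
    ultimately have s: "s\<^sup>2 \<le> 1" and y: "D * y\<^sup>2 \<le> 1" using zero_le_power2[of s] by linarith+
    have s: "\<bar>s\<bar> \<le> 1" using s by (simp add: abs_square_le_1)
    have "y\<^sup>2 \<le> K0\<^sup>2" using y D by (simp add: K0_def power_divide field_simps)
    hence y: "\<bar>y\<bar> \<le> K0" using K0 by (simp add: abs_le_square_iff[symmetric])
    have le: "\<bar>t * y\<bar> \<le> \<bar>t\<bar> * K0" for t using y by (simp add: abs_mult mult_left_mono)
    have nn: "0 \<le> \<bar>t\<bar> * K0" for t using K0 by simp
    show ?thesis unfolding e f g K_def using le[of x] le[of b] le[of c] nn[of x] nn[of b] nn[of c] s
      by (auto simp: distrib_right abs_le_iff)
  qed
  thus ?thesis by (rule that)
qed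

text \<open>Up to conjugation \<open>X\<close> is a rotation by \<open>t\<close>, and Dirichlet
  approximation finds multiples of \<open>t\<close> close to multiples of \<open>2 * pi\<close>.
  Exponents are at least 1 so that one factor can be cancelled later, leaving nonnegative powers
  that approximate the inverse. Limits are entrywise, as \<open>m2\<close> carries no
  topology.\<close>

lemma elliptic_recurrent:
  fixes X :: "real m2"
  assumes X: "mdet X = 1" "\<bar>mtr X\<bar> < 2"
  obtains r :: "nat \<Rightarrow> nat" where "\<And>i. r i \<ge> 1"
    "(\<lambda>i. m11 (X ^ r i)) \<longlonglongrightarrow> 1" "(\<lambda>i. m12 (X ^ r i)) \<longlonglongrightarrow> 0"
    "(\<lambda>i. m21 (X ^ r i)) \<longlonglongrightarrow> 0" "(\<lambda>i. m22 (X ^ r i)) \<longlonglongrightarrow> 1"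
proof -
  define t where "t = arccos (mtr X / 2)"
  have ct: "2 * cos t = mtr X" using X(2) by (simp add: t_def cos_arccos_abs)
  have "(sin t)\<^sup>2 = 1 - (mtr X / 2)\<^sup>2" by (simp add: sin_squared_eq ct[symmetric])
  moreover have "(mtr X / 2)\<^sup>2 < 1" using X(2) by (simp add: abs_square_less_1)
  ultimately have st: "sin t \<noteq> 0" by auto
  \<comment> \<open>The Chebyshev form of Cayley-Hamilton: \<open>sin t * X^n\<close> equals
    \<open>sin (n t) * X - sin ((n - 1) t) * 1\<close>, and \<open>S n\<close> is the right-hand
    side.\<close>
  define S where "S n = M2 (sin (real n * t) * m11 X - sin (real n * t - t)) (sin (real n * t) * m12 X)
     (sin (real n * t) * m21 X) (sin (real n * t) * m22 X - sin (real n * t - t))" for n :: nat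
  have rec: "M2 (sin t) 0 0 (sin t) * X ^ n = S n" for n
  proof (induction n)
    case 0
    show ?case by (simp add: S_def m2_eq_iff)
  next
    case (Suc n)
    have a: "sin (real (Suc n) * t - t) = sin (real n * t)" by (simp add: algebra_simps)
    have b: "sin (real (Suc n) * t) = mtr X * sin (real n * t) - sin (real n * t - t)"
      unfolding ct[symmetric] by (simp add: algebra_simps sin_add sin_diff)
    have d: "m11 X * m22 X = 1 + m12 X * m21 X" using X(1) by (simp add: mdet_def)
    have "M2 (sin t) 0 0 (sin t) * X ^ Suc n = S n * X"
      unfolding Suc[symmetric] power_Suc2 by (simp add: mult.assoc)
    also have "\<dots> = S (Suc n)"
      using arg_cong[OF d, of "\<lambda>y. y * sin (real n * t)"]
      unfolding S_def a b m2_eq_iff mtr_def by (simp add: algebra_simps)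
    finally show ?case .
  qed
  have ent: "m11 (X ^ n) = (sin (real n * t) * m11 X - sin (real n * t - t)) / sin t"
    "m12 (X ^ n) = sin (real n * t) * m12 X / sin t"
    "m21 (X ^ n) = sin (real n * t) * m21 X / sin t"
    "m22 (X ^ n) = (sin (real n * t) * m22 X - sin (real n * t - t)) / sin t" for n
    using arg_cong[OF rec[of n], of m11] arg_cong[OF rec[of n], of m12]
      arg_cong[OF rec[of n], of m21] arg_cong[OF rec[of n], of m22] st
    by (simp_all add: S_def field_simps)
  have "\<exists>k::nat. k \<ge> 1 \<and> (\<exists>h::int. \<bar>real k * (t / (2 * pi)) - of_int h\<bar> < 1 / real (Suc i))" for i
  proof -
    obtain h k where "0 < k" "k \<le> int (Suc i)" "\<bar>of_int k * (t / (2 * pi)) - of_int h\<bar> < 1 / real (Suc i)"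
      by (rule Dirichlet_approx[of "Suc i" "t / (2 * pi)"]) simp
    thus ?thesis by (intro exI[of _ "nat k"] conjI exI[of _ h]) auto
  qed
  then obtain r h where r: "\<And>i. r i \<ge> (1::nat)"
    "\<And>i. \<bar>real (r i) * (t / (2 * pi)) - of_int (h i)\<bar> < 1 / real (Suc i)"
    by metis
  define d where "d i = real (r i) * (t / (2 * pi)) - of_int (h i)" for i
  have "d \<longlonglongrightarrow> 0"
  proof (rule Lim_null_comparison)
    show "\<forall>\<^sub>F i in sequentially. norm (d i) \<le> 1 / real (Suc i)"
      using r(2) by (intro always_eventually allI) (simp only: d_def real_norm_def less_imp_le)
    show "(\<lambda>i. 1 / real (Suc i)) \<longlonglongrightarrow> 0" by real_asymp
  qed
  moreover have rt: "real (r i) * t = 2 * pi * d i + 2 * pi * of_int (h i)" for i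
    by (simp add: d_def field_simps)
  have per: "sin (y + 2 * pi * of_int k) = sin y" "cos (y + 2 * pi * of_int k) = cos y" for y :: real and k :: int
    by (simp_all add: sin_add cos_add sin_int_2pin cos_int_2pin)
  ultimately have s: "(\<lambda>i. sin (real (r i) * t)) \<longlonglongrightarrow> 0" and c: "(\<lambda>i. cos (real (r i) * t)) \<longlonglongrightarrow> 1"
    unfolding rt per by (auto intro!: tendsto_eq_intros)
  hence s2: "(\<lambda>i. sin (real (r i) * t - t)) \<longlonglongrightarrow> - sin t"
    unfolding sin_diff using tendsto_diff[OF tendsto_mult[OF s tendsto_const[of "cos t"]]
        tendsto_mult[OF c tendsto_const[of "sin t"]]] by simp
  have "(\<lambda>i. sin (real (r i) * t) * x / sin t) \<longlonglongrightarrow> 0"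
    and "(\<lambda>i. (sin (real (r i) * t) * x - sin (real (r i) * t - t)) / sin t) \<longlonglongrightarrow> 1" for x
    using tendsto_divide[OF tendsto_mult[OF s tendsto_const[of x]] tendsto_const st]
      tendsto_divide[OF tendsto_diff[OF tendsto_mult[OF s tendsto_const[of x]] s2] tendsto_const st] st
    by simp_all
  thus ?thesis by (intro that[of r, OF r(1)]) (simp_all only: ent)
qed

text \<open>One step of the eigenvalue equation: with \<open>z\<close> the energy minus the
  potential at \<open>n\<close>, it maps the column \<open>(u n, u (n - 1))\<close> to
  \<open>(u (n + 1), u n)\<close>.\<close>

definition mT :: "'a :: comm_ring_1 \<Rightarrow> 'a m2" where "mT z = M2 z (- 1) 1 0"

lemma mT_entries [simp]: "m11 (mT z) = z" "m12 (mT z) = - 1" "m21 (mT z) = 1" "m22 (mT z) = 0"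
  by (simp_all add: mT_def)

lemma mdet_mT [simp]: "mdet (mT z) = 1" by (simp add: mdet_def)

section \<open>Polynomial dependence on energies and potential values\<close>

definition poly_fun :: "('a :: comm_ring_1 \<Rightarrow> 'a) \<Rightarrow> bool" where
  "poly_fun f \<longleftrightarrow> (\<exists>p. \<forall>x. f x = poly p x)"

lemma poly_fun_intros:
  fixes c :: "'a :: comm_ring_1" and f g :: "'a \<Rightarrow> 'a"
  shows
  "poly_fun (\<lambda>x. c)" "poly_fun (\<lambda>x::'a. x)"
  "poly_fun f \<Longrightarrow> poly_fun g \<Longrightarrow> poly_fun (\<lambda>x. f x + g x)"
  "poly_fun f \<Longrightarrow> poly_fun g \<Longrightarrow> poly_fun (\<lambda>x. f x - g x)"
  "poly_fun f \<Longrightarrow> poly_fun g \<Longrightarrow> poly_fun (\<lambda>x. f x * g x)"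
proof -
  have "\<forall>x. c = poly [:c:] x" "\<forall>x::'a. x = poly [:0, 1:] x" for c :: 'a by simp_all
  hence "\<exists>p. \<forall>x. c = poly p x" "\<exists>p. \<forall>x::'a. x = poly p x" for c :: 'a by blast+
  thus "poly_fun (\<lambda>x. c)" "poly_fun (\<lambda>x::'a. x)" unfolding poly_fun_def by blast+
  assume "poly_fun f" "poly_fun g"
  thus "poly_fun (\<lambda>x. f x + g x)" "poly_fun (\<lambda>x. f x - g x)" "poly_fun (\<lambda>x. f x * g x)"
    unfolding poly_fun_def by (metis poly_add, metis poly_diff, metis poly_mult)
qed

lemma poly_fun_zero:
  fixes f :: "'a :: {comm_ring_1, ring_no_zero_divisors} \<Rightarrow> 'a"
  assumes "poly_fun f" "infinite S" "\<And>x. x \<in> S \<Longrightarrow> f x = 0"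
  shows "f x = 0"
proof -
  obtain p where p: "\<And>x. f x = poly p x" using assms(1) by (auto simp: poly_fun_def)
  have "S \<subseteq> {x. poly p x = 0}" using assms(3) p by auto
  hence "p = 0" using poly_roots_finite[of p] assms(2) finite_subset by blast
  thus ?thesis by (simp add: p)
qed

definition poly_m2 :: "('a :: comm_ring_1 \<Rightarrow> 'a m2) \<Rightarrow> bool" where
  "poly_m2 F \<longleftrightarrow> poly_fun (\<lambda>x. m11 (F x)) \<and> poly_fun (\<lambda>x. m12 (F x)) \<and>
     poly_fun (\<lambda>x. m21 (F x)) \<and> poly_fun (\<lambda>x. m22 (F x))"

lemma poly_m2_intros:
  "poly_m2 (\<lambda>x. C)" "poly_m2 (\<lambda>x. mT (x - c))"
  "poly_m2 F \<Longrightarrow> poly_m2 G \<Longrightarrow> poly_m2 (\<lambda>x. F x - G x)"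
  "poly_m2 F \<Longrightarrow> poly_m2 G \<Longrightarrow> poly_m2 (\<lambda>x. F x * G x)"
  by (auto simp: poly_m2_def intro!: poly_fun_intros)

lemma poly_m2_power: "poly_m2 F \<Longrightarrow> poly_m2 (\<lambda>x. F x ^ n)"
  by (induction n) (auto intro!: poly_m2_intros)

text \<open>The entries \<open>m11\<close> and \<open>m21\<close> of the powers are Chebyshev
  polynomials of the second kind in \<open>b / 2\<close>. The last bound makes \<open>m11\<close> of
  each positive power unbounded in \<open>b\<close>; the others carry the induction.\<close>

lemma mT_power_growth:
  fixes b :: real
  assumes "b \<ge> 2"
  shows "m21 (mT b ^ n) \<ge> 0 \<and> m11 (mT b ^ n) \<ge> m21 (mT b ^ n) \<and> m11 (mT b ^ n) \<ge> 1 \<and>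
    m11 (mT b ^ Suc n) \<ge> b - 1"
proof (induction n)
  case (Suc n)
  let ?p = "m11 (mT b ^ n)" and ?q = "m21 (mT b ^ n)"
  have IH: "0 \<le> ?q" "?q \<le> ?p" "1 \<le> ?p" "b * ?p - ?q \<ge> b - 1" using Suc by auto
  have "b * ?p - ?q \<ge> ?p"
  proof -
    have "2 * ?p \<le> b * ?p" using assms IH by (intro mult_right_mono) auto
    thus ?thesis using IH by linarith
  qed
  moreover have "b * (b * ?p - ?q) - ?p \<ge> b - 1"
  proof -
    have "(b - 1) * 1 \<le> (b - 1) * (b * ?p - ?q)" using assms IH by (intro mult_left_mono) auto
    thus ?thesis using calculation by (simp add: algebra_simps)
  qed
  ultimately show ?case using IH assms by auto
qed (use assms in auto)

text \<open>If the matrices commuted for all \<open>b\<close> near \<open>a\<close>, they would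
  commute for all \<open>b\<close>, both products being polynomial in \<open>b\<close>. Then
  \<open>B * mT b ^ k\<close> would stay in the bounded part of the commutant of \<open>X\<close>,
  although the entry \<open>m11\<close> of \<open>mT b ^ k\<close> is at least
  \<open>b - 1\<close>.\<close>

lemma exists_noncommuting:
  fixes X B :: "real m2"
  assumes X: "mdet X = 1" "\<bar>mtr X\<bar> < 2" and B: "mdet B = 1" and "k \<ge> 1" "e > 0"
  shows "\<exists>b. \<bar>b - a\<bar> < e \<and> X * (B * mT b ^ k) \<noteq> (B * mT b ^ k) * X"
proof (rule ccontr)
  assume "\<not> ?thesis"
  hence none_b: "X * (B * mT b ^ k) = (B * mT b ^ k) * X" if "\<bar>b - a\<bar> < e" for b
    using that by blast
  define F where "F b = X * (B * mT (b - 0) ^ k) - (B * mT (b - 0) ^ k) * X" for b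
  have "poly_m2 F" unfolding F_def by (intro poly_m2_intros poly_m2_power)
  moreover have zero: "F b = 0" if "b \<in> {a - e <..< a + e}" for b
  proof -
    have "\<bar>b - a\<bar> < e" using that by auto
    thus ?thesis using none_b by (auto simp: F_def)
  qed
  moreover have "infinite {a - e <..< a + e}" using \<open>e > 0\<close> by (simp add: infinite_Ioo)
  ultimately have "F b = 0" for b
    unfolding poly_m2_def m2_eq_iff[of "F b"]
    using poly_fun_zero[where S = "{a - e <..< a + e}" and x = b and f = "\<lambda>x. m11 (F x)"]
      poly_fun_zero[where S = "{a - e <..< a + e}" and x = b and f = "\<lambda>x. m12 (F x)"]
      poly_fun_zero[where S = "{a - e <..< a + e}" and x = b and f = "\<lambda>x. m21 (F x)"]
      poly_fun_zero[where S = "{a - e <..< a + e}" and x = b and f = "\<lambda>x. m22 (F x)"]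
    by (simp add: zero_m2_def)
  hence comm: "X * (B * mT b ^ k) = (B * mT b ^ k) * X" for b by (simp add: F_def)
  obtain K where K: "\<And>Y. mdet Y = 1 \<Longrightarrow> X * Y = Y * X \<Longrightarrow>
     \<bar>m11 Y\<bar> \<le> K \<and> \<bar>m12 Y\<bar> \<le> K \<and> \<bar>m21 Y\<bar> \<le> K \<and> \<bar>m22 Y\<bar> \<le> K"
    using commutant_elliptic_bounded[OF X] by blast
  define b where "b = 2 + \<bar>m22 B\<bar> * K + \<bar>m12 B\<bar> * K"
  define Y where "Y = B * mT b ^ k"
  have "mdet Y = 1" by (simp add: Y_def mdet_mult mdet_power B)
  hence KY: "\<bar>m11 Y\<bar> \<le> K" "\<bar>m21 Y\<bar> \<le> K" using K[of Y] comm[of b] by (simp_all only: Y_def)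
  hence "K \<ge> 0" by linarith
  have "mT b ^ k = madj B * Y" by (simp add: Y_def mult.assoc[symmetric] madj_mult B)
  hence "m11 (mT b ^ k) = m22 B * m11 Y - m12 B * m21 Y" by simp
  also have "\<dots> \<le> \<bar>m22 B * m11 Y\<bar> + \<bar>m12 B * m21 Y\<bar>" by linarith
  also have "\<dots> \<le> \<bar>m22 B\<bar> * K + \<bar>m12 B\<bar> * K"
    unfolding abs_mult using KY by (intro add_mono mult_left_mono) auto
  finally have "m11 (mT b ^ k) \<le> b - 2" by (simp add: b_def)
  moreover have "b \<ge> 2" using \<open>K \<ge> 0\<close> by (simp add: b_def)
  ultimately show False using mT_power_growth[of b "k - 1"] \<open>k \<ge> 1\<close> by simp
qed

text \<open>Only words with nonnegative exponents arise from running through consecutive periods of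
  a potential. For recurrence times \<open>r\<close> and \<open>s\<close>, the powers
  \<open>X^(r-1)\<close> and \<open>Y^(s-1)\<close> stand in for the inverses in the commutator,
  whose trace exceeds 2 strictly, so a good approximation suffices. \<open>Y\<close> is elliptic
  too, by continuity of the trace for \<open>b\<close> close to \<open>a\<close>.\<close>

lemma exists_hyperbolic_word:
  fixes B :: "real m2"
  assumes B: "mdet B = 1" and ell: "\<bar>mtr (B * mT a ^ k)\<bar> < 2" and "k \<ge> 1" "e > 0"
  obtains b n m where "\<bar>b - a\<bar> < e"
    "mtr (B * mT a ^ k * (B * mT b ^ k) * (B * mT a ^ k) ^ n * (B * mT b ^ k) ^ m) > 2"
proof -
  define X where "X = B * mT a ^ k"
  have X: "mdet X = 1" "\<bar>mtr X\<bar> < 2" using ell by (auto simp: X_def mdet_mult mdet_power B)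
  have "poly_m2 (\<lambda>b. B * mT (b - 0) ^ k)" by (intro poly_m2_intros poly_m2_power)
  then obtain p q where pq: "\<And>b. m11 (B * mT b ^ k) = poly p b" "\<And>b. m22 (B * mT b ^ k) = poly q b"
    unfolding poly_m2_def poly_fun_def by auto
  have "mtr (B * mT b ^ k) = poly p b + poly q b" for b by (simp only: mtr_def pq)
  hence "continuous (at a) (\<lambda>b. \<bar>mtr (B * mT b ^ k)\<bar>)" by (simp add: continuous_intros)
  hence "\<forall>\<^sub>F b in at a. \<bar>mtr (B * mT b ^ k)\<bar> < 2"
    using ell unfolding continuous_at by (rule order_tendstoD)
  then obtain d where d: "d > 0" "\<And>b. b \<noteq> a \<Longrightarrow> dist b a < d \<Longrightarrow> \<bar>mtr (B * mT b ^ k)\<bar> < 2"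
    unfolding eventually_at by auto
  obtain b where b: "\<bar>b - a\<bar> < min d e" "X * (B * mT b ^ k) \<noteq> (B * mT b ^ k) * X"
    using exists_noncommuting[OF X B \<open>k \<ge> 1\<close>, of "min d e" a] d(1) \<open>e > 0\<close> by auto
  define Y where "Y = B * mT b ^ k"
  have "b \<noteq> a" using b(2) by (auto simp: X_def)
  hence Y: "mdet Y = 1" "\<bar>mtr Y\<bar> < 2"
    using d(2)[of b] b(1) by (auto simp: Y_def mdet_mult mdet_power B dist_real_def)
  have comm: "mtr (X * Y * madj X * madj Y) > 2"
    using commutator_elliptic[OF X Y(1)] b(2) by (simp add: Y_def)
  obtain r where r: "\<And>i. r i \<ge> 1"
    "(\<lambda>i. m11 (X ^ r i)) \<longlonglongrightarrow> 1" "(\<lambda>i. m12 (X ^ r i)) \<longlonglongrightarrow> 0"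
    "(\<lambda>i. m21 (X ^ r i)) \<longlonglongrightarrow> 0" "(\<lambda>i. m22 (X ^ r i)) \<longlonglongrightarrow> 1"
    using elliptic_recurrent[OF X] by blast
  obtain s where s: "\<And>i. s i \<ge> 1"
    "(\<lambda>i. m11 (Y ^ s i)) \<longlonglongrightarrow> 1" "(\<lambda>i. m12 (Y ^ s i)) \<longlonglongrightarrow> 0"
    "(\<lambda>i. m21 (Y ^ s i)) \<longlonglongrightarrow> 0" "(\<lambda>i. m22 (Y ^ s i)) \<longlonglongrightarrow> 1"
    using elliptic_recurrent[OF Y] by blast
  have inv: "Z ^ (n - 1) = madj Z * Z ^ n" if "mdet Z = 1" "n \<ge> 1" for Z :: "real m2" and n
    using that by (cases n) (simp_all add: mult.assoc[symmetric] madj_mult)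
  have "(\<lambda>i. mtr (X * Y * (madj X * X ^ r i) * (madj Y * Y ^ s i)))
      \<longlonglongrightarrow> mtr (X * Y * (madj X * 1) * (madj Y * 1))"
    unfolding mtr_def m2_entries by (intro tendsto_intros r s)
  hence "\<forall>\<^sub>F i in sequentially. mtr (X * Y * (madj X * X ^ r i) * (madj Y * Y ^ s i)) > 2"
    using comm by (intro order_tendstoD) simp_all
  then obtain i where "mtr (X * Y * (madj X * X ^ r i) * (madj Y * Y ^ s i)) > 2"
    by (auto simp: eventually_sequentially)
  hence "mtr (X * Y * X ^ (r i - 1) * Y ^ (s i - 1)) > 2"
    using inv[OF X(1) r(1)] inv[OF Y(1) s(1)] by simp
  thus ?thesis using b(1) by (intro that[of b "r i - 1" "s i - 1"]) (auto simp: X_def Y_def)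
qed

section \<open>Transfer matrices and Floquet theory\<close>

primrec tmat :: "'a :: {real_algebra_1, comm_ring_1} \<Rightarrow> (int \<Rightarrow> real) \<Rightarrow> int \<Rightarrow> nat \<Rightarrow> 'a m2" where
  "tmat z w n 0 = 1"
| "tmat z w n (Suc j) = mT (z - of_real (w (n + int j))) * tmat z w n j"

lemma tmat_add: "tmat z w n (i + j) = tmat z w (n + int i) j * tmat z w n i"
  by (induction j) (simp_all add: mult.assoc add.assoc)

lemma tmat_cong:
  "(\<And>i. i < j \<Longrightarrow> w (n + int i) = w' (n' + int i)) \<Longrightarrow> tmat z w n j = tmat z w' n' j"
  by (induction j) auto

lemma mdet_tmat [simp]: "mdet (tmat z w n j) = 1"
  by (induction j) (simp_all add: mdet_mult)

lemma tmat_const: "(\<And>i. i < j \<Longrightarrow> w (n + int i) = a) \<Longrightarrow> tmat z w n j = mT (z - of_real a) ^ j"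
  by (induction j) auto

lemma poly_m2_tmat: "poly_m2 (\<lambda>z. tmat z w n j)"
  by (induction j) (auto intro!: poly_m2_intros)

lemma poly_fun_mtr: "poly_m2 F \<Longrightarrow> poly_fun (\<lambda>x. mtr (F x))"
  by (auto simp: poly_m2_def mtr_def intro!: poly_fun_intros)

lemma tmat_of_real_aux:
  shows "m11 (tmat (complex_of_real E) w n j) = of_real (m11 (tmat E w n j)) \<and>
    m12 (tmat (complex_of_real E) w n j) = of_real (m12 (tmat E w n j)) \<and>
    m21 (tmat (complex_of_real E) w n j) = of_real (m21 (tmat E w n j)) \<and>
    m22 (tmat (complex_of_real E) w n j) = of_real (m22 (tmat E w n j))"
  by (induction j) simp_all

lemma mtr_tmat_of_real: "mtr (tmat (complex_of_real E) w n j) = of_real (mtr (tmat E w n j))"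
  using tmat_of_real_aux[of E w n j] by (simp add: mtr_def)

lemma tmat_shift_potential: "tmat z (\<lambda>n. w n + s) n j = tmat (z - of_real s) w n j"
  by (induction j) (simp_all add: algebra_simps)

lemma periodic_add_mult:
  fixes v :: "int \<Rightarrow> 'a" and k :: int
  assumes "\<And>n. v (n + int Q) = v n"
  shows "v (n + int Q * k) = v n"
proof -
  have nat: "v (n + int Q * int k) = v n" for n k
  proof (induction k)
    case (Suc k)
    have "v (n + int Q * int (Suc k)) = v ((n + int Q * int k) + int Q)" by (simp add: algebra_simps)
    thus ?case using Suc assms by simp
  qed simp
  show ?thesis
  proof (cases "k \<ge> 0")
    case True
    thus ?thesis using nat[of n "nat k"] by simp
  next
    case False
    thus ?thesis using nat[of "n + int Q * k" "nat (- k)"] by (simp add: algebra_simps)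
  qed
qed

lemma periodic_mod:
  fixes v :: "int \<Rightarrow> 'a"
  assumes "\<And>n. v (n + int Q) = v n"
  shows "v (n mod int Q) = v n"
  using periodic_add_mult[of v Q, OF assms, of "n mod int Q" "n div int Q"] by simp

lemma mtr_tmat_period:
  assumes per: "\<And>n. w (n + int Q) = w n"
  shows "mtr (tmat z w n Q) = mtr (tmat z w 0 Q)"
proof -
  have step: "mtr (tmat z w (m + 1) Q) = mtr (tmat z w m Q)" for m
  proof -
    let ?T = "mT (z - of_real (w m))"
    have "?T * tmat z w m Q = tmat z w m (Q + 1)" by (simp add: per)
    also have "\<dots> = tmat z w (m + 1) Q * ?T"
      using tmat_add[of z w m 1 Q] by (simp add: add.commute)
    finally have "?T * tmat z w m Q * madj ?T = tmat z w (m + 1) Q"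
      by (simp add: mult.assoc madj_mult)
    hence "mtr (tmat z w (m + 1) Q) = mtr (madj ?T * (?T * tmat z w m Q))"
      by (metis mtr_commute)
    thus ?thesis by (simp add: mult.assoc[symmetric] madj_mult)
  qed
  have "mtr (tmat z w (n + int 1) Q) = mtr (tmat z w n Q)" for n using step by simp
  from periodic_add_mult[of "\<lambda>n. mtr (tmat z w n Q)", OF this, of 0 n] show ?thesis by simp
qed

definition m2_norm :: "complex m2 \<Rightarrow> real" where
  "m2_norm X = norm (m11 X) + norm (m12 X) + norm (m21 X) + norm (m22 X)"

lemma m2_norm_nonneg: "m2_norm X \<ge> 0" by (simp add: m2_norm_def)

lemma m2_norm_entry: "norm (m11 X) \<le> m2_norm X" by (simp add: m2_norm_def)

lemma m2_norm_add: "m2_norm (X + Y) \<le> m2_norm X + m2_norm Y"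
  unfolding m2_norm_def m2_entries
  using norm_triangle_ineq[of "m11 X" "m11 Y"] norm_triangle_ineq[of "m12 X" "m12 Y"]
    norm_triangle_ineq[of "m21 X" "m21 Y"] norm_triangle_ineq[of "m22 X" "m22 Y"] by linarith

lemma m2_norm_mult: "m2_norm (X * Y) \<le> m2_norm X * m2_norm Y"
proof -
  have "norm (a * b + c * d) \<le> norm a * norm b + norm c * norm d" for a b c d :: complex
    by (metis norm_mult norm_triangle_ineq)
  note le = this[of "m11 X" "m11 Y" "m12 X" "m21 Y"] this[of "m11 X" "m12 Y" "m12 X" "m22 Y"]
    this[of "m21 X" "m11 Y" "m22 X" "m21 Y"] this[of "m21 X" "m12 Y" "m22 X" "m22 Y"]
  have eq: "(a + b + c + d) * (p + q + r + s) = (a * p + b * r) + (a * q + b * s) + (c * p + d * r)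
      + (c * q + d * s) + (a * r + a * s + b * p + b * q + c * r + c * s + d * p + d * q)"
    for a b c d p q r s :: real by (simp add: algebra_simps)
  show ?thesis unfolding m2_norm_def m2_entries eq
    by (rule order_trans[OF add_mono[OF add_mono[OF add_mono[OF le(1,2)] le(3)] le(4)]]) simp
qed

lemma tmat_norm_bound:
  fixes z :: complex
  assumes "\<And>n. norm (z - of_real (w n)) \<le> K"
  shows "m2_norm (tmat z w n j) \<le> 2 * (K + 2) ^ j"
proof (induction j)
  case 0
  show ?case by (simp add: m2_norm_def)
next
  case (Suc j)
  have K: "0 \<le> K" using assms[of 0] norm_ge_zero order_trans by blast
  have "m2_norm (tmat z w n (Suc j)) \<le> m2_norm (mT (z - of_real (w (n + int j)))) * m2_norm (tmat z w n j)"
    by (simp add: m2_norm_mult)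
  also have "\<dots> \<le> (K + 2) * (2 * (K + 2) ^ j)"
    using assms[of "n + int j"] K Suc by (intro mult_mono m2_norm_nonneg) (auto simp: m2_norm_def)
  finally show ?case by simp
qed

text \<open>The column \<open>(u n, u (n - 1))\<close>, padded by a zero column so that it lies in
  the ring \<open>m2\<close> and transfer matrices act on it by multiplication.\<close>

definition state :: "(int \<Rightarrow> complex) \<Rightarrow> int \<Rightarrow> complex m2" where
  "state u n = M2 (u n) 0 (u (n - 1)) 0"

text \<open>Variation of constants: each \<open>f (n + int i)\<close> enters at its site and is
  carried on by the later one-step matrices. Their norm is at most \<open>K + 2\<close>, that is,
  \<open>K\<close> plus the two entries of modulus 1.\<close>

lemma state_tmat_bound:
  fixes z :: complex
  assumes K: "\<And>n. norm (z - of_real (w n)) \<le> K"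
    and u: "\<And>n. u (n - 1) + u (n + 1) + (complex_of_real (w n) - z) * u n = f n"
  shows "m2_norm (state u (n + int j) - tmat z w n j * state u n)
     \<le> (K + 2) ^ j * (\<Sum>i<j. norm (f (n + int i)))"
proof (induction j)
  case 0
  show ?case by (simp add: m2_norm_def zero_m2_def)
next
  case (Suc j)
  have K0: "0 \<le> K" using assms(1)[of 0] norm_ge_zero order_trans by blast
  let ?R = "state u (n + int j) - tmat z w n j * state u n"
  let ?T = "mT (z - of_real (w (n + int j)))"
  let ?f = "M2 (f (n + int j)) 0 0 0"
  have "u (n + int j + 1) = f (n + int j) - u (n + int j - 1) + (z - complex_of_real (w (n + int j))) * u (n + int j)"
    unfolding u[of "n + int j", symmetric] by (simp add: algebra_simps)
  hence "state u (n + int (Suc j)) = ?T * state u (n + int j) + ?f"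
    by (simp add: m2_eq_iff state_def algebra_simps)
  hence "state u (n + int (Suc j)) - tmat z w n (Suc j) * state u n = ?T * ?R + ?f"
    by (simp add: algebra_simps)
  hence "m2_norm (state u (n + int (Suc j)) - tmat z w n (Suc j) * state u n)
     \<le> m2_norm ?T * m2_norm ?R + norm (f (n + int j))"
    using m2_norm_add[of "?T * ?R" ?f] m2_norm_mult[of ?T ?R] by (simp add: m2_norm_def[of ?f])
  also have "\<dots> \<le> (K + 2) * ((K + 2) ^ j * (\<Sum>i<j. norm (f (n + int i)))) + norm (f (n + int j))"
    using K[of "n + int j"] K0 Suc by (intro add_mono mult_mono m2_norm_nonneg) (auto simp: m2_norm_def)
  also have "\<dots> \<le> (K + 2) * ((K + 2) ^ j * (\<Sum>i<j. norm (f (n + int i)))) + (K + 2) ^ Suc j * norm (f (n + int j))"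
    using mult_right_mono[of 1 "(K + 2) ^ Suc j" "norm (f (n + int j))"] K0
      one_le_power[of "K + 2" "Suc j"] by (intro add_left_mono) simp
  finally show ?case by (simp add: algebra_simps)
qed

text \<open>Cayley--Hamilton for the monodromy matrix turns an approximate eigenvector into an
  approximate solution of a recursion with step \<open>Q\<close> and constant coefficients.\<close>

lemma period_recursion_bound:
  fixes z :: complex
  assumes per: "\<And>n. w (n + int Q) = w n" and K: "\<And>n. norm (z - of_real (w n)) \<le> K"
  obtains C where "C \<ge> 0" "\<And>u f n. (\<And>n. u (n - 1) + u (n + 1) + (complex_of_real (w n) - z) * u n = f n) \<Longrightarrow>
    norm (u (n + int (2 * Q)) + u n - mtr (tmat z w 0 Q) * u (n + int Q))
      \<le> C * (\<Sum>i<2 * Q. norm (f (n + int i)))"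
proof -
  define t where "t = mtr (tmat z w 0 Q)"
  define L where "L = (K + 2) ^ Q"
  define C where "C = norm t * L + 2 * L * L + L"
  have K0: "0 \<le> K" using K[of 0] norm_ge_zero order_trans by blast
  have L: "L \<ge> 0" using K0 by (simp add: L_def)
  have "norm (u (n + int (2 * Q)) + u n - t * u (n + int Q)) \<le> C * (\<Sum>i<2 * Q. norm (f (n + int i)))"
    if u: "\<And>n. u (n - 1) + u (n + 1) + (complex_of_real (w n) - z) * u n = f n" for u f n
  proof -
    define M where "M = tmat z w n Q"
    define F where "F = (\<Sum>i<2 * Q. norm (f (n + int i)))"
    have M2: "tmat z w (n + int Q) Q = M" 
    proof -
      have "w (n + int Q + int i) = w (n + int i)" for i using per[of "n + int i"] by (simp only: ac_simps)
      thus ?thesis unfolding M_def by (intro tmat_cong)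
    qed
    have tM: "m11 M + m22 M = t"
      using mtr_tmat_period[of w Q z n, OF per] by (simp add: M_def t_def mtr_def)
    have dM: "m11 M * m22 M - m12 M * m21 M = 1"
      using mdet_tmat[of z w n Q] by (simp add: M_def mdet_def)
    define R1 where "R1 = state u (n + int Q) - M * state u n"
    define R2 where "R2 = state u (n + int (2 * Q)) - M * state u (n + int Q)"
    have F1: "(\<Sum>i<Q. norm (f (n + int i))) \<le> F"
      unfolding F_def by (rule sum_mono2) auto
    have "(\<Sum>i<Q. norm (f (n + int Q + int i))) = (\<Sum>i\<in>{Q..<2 * Q}. norm (f (n + int i)))"
      by (rule sum.reindex_bij_witness[of _ "\<lambda>i. i - Q" "\<lambda>i. i + Q"]) (auto simp: algebra_simps)
    also have "\<dots> \<le> F" unfolding F_def by (rule sum_mono2) auto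
    finally have F2: "(\<Sum>i<Q. norm (f (n + int Q + int i))) \<le> F" .
    have "m2_norm R1 \<le> L * (\<Sum>i<Q. norm (f (n + int i)))"
      unfolding R1_def M_def L_def by (rule state_tmat_bound[OF K u])
    hence R1: "m2_norm R1 \<le> L * F" by (rule order_trans[OF _ mult_left_mono[OF F1 L]])
    have "m2_norm R2 \<le> L * (\<Sum>i<Q. norm (f (n + int Q + int i)))"
    proof -
      have "n + int (2 * Q) = n + int Q + int Q" by simp
      thus ?thesis using state_tmat_bound[of z w K u f "n + int Q" Q, OF K u] by (simp only: M2 R2_def L_def)
    qed
    hence R2: "m2_norm R2 \<le> L * F" by (rule order_trans[OF _ mult_left_mono[OF F2 L]])
    have CH: "M * M = M2 t 0 0 t * M - 1"
      using dM by (simp add: m2_eq_iff tM[symmetric] algebra_simps)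
    have "state u (n + int (2 * Q)) = M * (M * state u n + R1) + R2"
      by (simp add: R1_def R2_def)
    also have "\<dots> = (M * M) * state u n + M * R1 + R2" by (simp add: algebra_simps)
    also have "\<dots> = M2 t 0 0 t * (M * state u n) - state u n + M * R1 + R2"
      unfolding CH by (simp add: algebra_simps)
    also have "M * state u n = state u (n + int Q) - R1" by (simp add: R1_def)
    finally have "state u (n + int (2 * Q)) + state u n - M2 t 0 0 t * state u (n + int Q)
        = M * R1 + R2 + M2 (- t) 0 0 (- t) * R1"
      by (simp add: m2_eq_iff algebra_simps)
    from arg_cong[OF this, of m11]
    have "u (n + int (2 * Q)) + u n - t * u (n + int Q) = m11 (M * R1) + m11 R2 - t * m11 R1"
      by (simp add: state_def)
    also have "norm \<dots> \<le> norm (m11 (M * R1)) + norm (m11 R2) + norm (t * m11 R1)"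
      by (intro order_trans[OF norm_triangle_ineq4] order_trans[OF norm_triangle_ineq] add_mono order_refl)
    also have "\<dots> \<le> m2_norm M * m2_norm R1 + m2_norm R2 + norm t * m2_norm R1"
      unfolding norm_mult
      by (intro add_mono mult_left_mono m2_norm_entry order_trans[OF m2_norm_entry m2_norm_mult]) auto
    also have "\<dots> \<le> 2 * L * (L * F) + L * F + norm t * (L * F)"
      using tmat_norm_bound[of z w K n Q, OF K] R1 R2 L
      by (intro add_mono mult_mono mult_left_mono m2_norm_nonneg) (auto simp: M_def L_def)
    also have "\<dots> = C * F" by (simp add: C_def algebra_simps)
    finally show ?thesis by (simp add: F_def)
  qed
  moreover have "C \<ge> 0" using L by (simp add: C_def)
  ultimately show ?thesis using that[of C] by (auto simp: t_def)
qed

section \<open>Gaps where the discriminant exceeds 2 in modulus\<close>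

lemma apply_ell2_sum: "apply_ell2 (\<Sum>i\<in>I. x i) n = (\<Sum>i\<in>I. apply_ell2 (x i) n)"
  by (induction I rule: infinite_finite_induct) (simp_all add: zero_ell2.rep_eq plus_ell2.rep_eq)

lift_definition abs_ell2 :: "'i ell2 \<Rightarrow> 'i ell2" is "\<lambda>x n. complex_of_real (norm (x n))"
  by simp

lemma norm_abs_ell2: "norm (abs_ell2 x) = norm x"
  by (rule power2_eq_imp_eq) (simp_all add: norm_ell2_sq abs_ell2.rep_eq)

text \<open>The recursion with step \<open>Q\<close> says that \<open>t\<close> times a shift of
  \<open>x\<close> is a sum of two shifts of \<open>x\<close>, up to a multiple of the residual.
  Shifts are isometries, so the triangle inequality bounds \<open>(norm t - 2) * norm x\<close> by
  the residual, without splitting solutions into growing and decaying ones.\<close>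

lemma trace_gt_2_imp_gap:
  fixes W :: "int \<Rightarrow>\<^sub>C real"
  assumes per: "\<And>n. W (n + int Q) = W n" and tr: "\<bar>mtr (tmat E W 0 Q)\<bar> > 2"
  obtains g where "g > 0" "gap W E g"
proof -
  define z where "z = complex_of_real E"
  define t where "t = mtr (tmat z W 0 Q)"
  have t: "norm t > 2" using tr by (simp add: t_def z_def mtr_tmat_of_real)
  have K: "norm (z - of_real (W n)) \<le> norm z + norm W" for n
    by (rule order_trans[OF norm_triangle_ineq4]) (use norm_bounded[of W n] in simp)
  obtain C where C: "C \<ge> 0" "\<And>u f n. (\<And>n. u (n - 1) + u (n + 1) + (complex_of_real (W n) - z) * u n = f n) \<Longrightarrow>
    norm (u (n + int (2 * Q)) + u n - t * u (n + int Q)) \<le> C * (\<Sum>i<2 * Q. norm (f (n + int i)))"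
    using period_recursion_bound[of W Q z, OF per K] unfolding t_def by blast
  have bound: "(norm t - 2) * norm x \<le> C * (real (2 * Q) * norm (shifted W z x))" for x
  proof -
    define f where "f = shifted W z x"
    define h where "h = (\<Sum>i<2 * Q. shift_ell2 (int i) (abs_ell2 f))"
    define G where "G = shift_ell2 (int (2 * Q)) x + x - scaleC_ell2 t (shift_ell2 (int Q) x)"
    have "norm (apply_ell2 G n) \<le> C * norm (apply_ell2 h n)" for n
    proof -
      have "apply_ell2 h n = complex_of_real (\<Sum>i<2 * Q. norm (f (n + int i)))"
        by (simp add: h_def apply_ell2_sum shift_ell2.rep_eq abs_ell2.rep_eq)
      hence "norm (apply_ell2 h n) = (\<Sum>i<2 * Q. norm (f (n + int i)))"
        by (simp only: norm_of_real) (simp add: sum_nonneg)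
      moreover have "norm (x (n + int (2 * Q)) + x n - t * x (n + int Q)) \<le> C * (\<Sum>i<2 * Q. norm (f (n + int i)))"
        by (rule C(2)) (simp add: f_def shifted_apply)
      ultimately show ?thesis
        by (simp add: G_def minus_ell2.rep_eq plus_ell2.rep_eq shift_ell2.rep_eq scaleC_ell2.rep_eq)
    qed
    hence "norm G \<le> C * norm h" using C(1) by (rule norm_ell2_le_mult)
    also have "norm h \<le> (\<Sum>i<2 * Q. norm f)"
      unfolding h_def by (rule sum_norm_le) (simp add: norm_shift_ell2 norm_abs_ell2)
    hence "C * norm h \<le> C * (real (2 * Q) * norm f)" using C(1) by (intro mult_left_mono) auto
    finally have G: "norm G \<le> C * (real (2 * Q) * norm f)" .
    have "norm t * norm x = norm (shift_ell2 (int (2 * Q)) x + x - G)"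
      by (simp add: G_def norm_scaleC_ell2 norm_shift_ell2)
    also have "\<dots> \<le> norm x + norm x + norm G"
      by (intro order_trans[OF norm_triangle_ineq4] add_mono order_refl order_trans[OF norm_triangle_ineq])
        (simp add: norm_shift_ell2)
    finally show ?thesis using G by (simp add: f_def algebra_simps)
  qed
  define D where "D = C * real (2 * Q) + 1"
  have D: "D > 0" using C(1) by (simp add: D_def add_nonneg_pos)
  have "(norm t - 2) / D * norm x \<le> norm (shifted W z x)" for x
  proof -
    have "C * (real (2 * Q) * norm (shifted W z x)) \<le> D * norm (shifted W z x)"
      unfolding D_def by (simp add: algebra_simps)
    thus ?thesis using bound[of x] D by (simp add: field_simps)
  qed
  thus ?thesis using t D by (intro that[of "(norm t - 2) / D"]) (auto simp: gap_def z_def)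
qed

section \<open>Floquet solutions and the spectra of periodic operators\<close>

lemma m2_singular_kernel:
  fixes N :: "complex m2"
  assumes "mdet N = 0"
  obtains x y where "x \<noteq> 0 \<or> y \<noteq> 0" "m11 N * x + m12 N * y = 0" "m21 N * x + m22 N * y = 0"
proof (cases "m11 N = 0 \<and> m12 N = 0")
  case False
  thus ?thesis using assms by (intro that[of "m12 N" "- m11 N"]) (auto simp: mdet_def algebra_simps)
next
  case True
  show ?thesis
  proof (cases "m21 N = 0 \<and> m22 N = 0")
    case False
    thus ?thesis using True by (intro that[of "m22 N" "- m21 N"]) auto
  next
    case True2: True
    show ?thesis using True True2 by (intro that[of 1 0]) auto
  qed
qed

text \<open>A matrix of determinant 1 whose trace is real and in \<open>[-2, 2]\<close> has an
  eigenvalue on the unit circle. The energy \<open>z\<close> may be nonreal, since the open mapping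
  argument controls only the trace.\<close>

lemma floquet_solution:
  assumes per: "\<And>n. w (n + int Q) = w n" and Q: "Q \<ge> 1"
    and tr: "mtr (tmat z w 0 Q) = complex_of_real t" "\<bar>t\<bar> \<le> 2"
  obtains u \<mu> n0 where "\<And>n. u (n - 1) + u (n + 1) + (complex_of_real (w n) - z) * u n = 0"
    "\<And>n. u (n + int Q) = \<mu> * u n" "norm \<mu> = 1" "u n0 \<noteq> 0"
proof -
  define M where "M = tmat z w 0 Q"
  define \<mu> where "\<mu> = cis (arccos (t / 2))"
  have mu: "norm \<mu> = 1" by (simp add: \<mu>_def)
  hence mu0: "\<mu> \<noteq> 0" by auto
  have cosarc: "cos (arccos (t / 2)) = t / 2" using tr(2) by (simp add: cos_arccos_abs)
  have "\<mu> + cnj \<mu> = complex_of_real t" by (simp add: \<mu>_def complex_eq_iff cosarc)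
  moreover have "\<mu> * cnj \<mu> = 1" using mu complex_norm_square[of \<mu>] by simp
  moreover have "\<mu> * \<mu> - (\<mu> + cnj \<mu>) * \<mu> + \<mu> * cnj \<mu> = 0" by (simp add: algebra_simps)
  ultimately have mu_eq: "\<mu> * \<mu> - complex_of_real t * \<mu> + 1 = 0" by simp
  have tM: "m11 M + m22 M = complex_of_real t" using tr(1) by (simp add: M_def mtr_def)
  have dM: "m11 M * m22 M - m12 M * m21 M = 1"
    using mdet_tmat[of z w 0 Q] by (simp add: M_def mdet_def)
  have "mdet (M - M2 \<mu> 0 0 \<mu>) = (m11 M * m22 M - m12 M * m21 M) - (m11 M + m22 M) * \<mu> + \<mu> * \<mu>"
    by (simp add: mdet_def algebra_simps)
  also have "\<dots> = 0" unfolding tM dM using mu_eq by (simp add: algebra_simps)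
  finally have "mdet (M - M2 \<mu> 0 0 \<mu>) = 0" .
  then obtain x y where xy: "x \<noteq> 0 \<or> y \<noteq> 0" "m11 M * x + m12 M * y = \<mu> * x" "m21 M * x + m22 M * y = \<mu> * y"
    by (rule m2_singular_kernel) (auto simp: algebra_simps)
  define s where "s = M2 x 0 y 0"
  define r where "r j = m11 (tmat z w 0 j * s)" for j
  have Ms: "M * s = M2 \<mu> 0 0 \<mu> * s" using xy by (simp add: m2_eq_iff s_def)
  have r_rec: "r (Suc (Suc j)) = (z - of_real (w (int j + 1))) * r (Suc j) - r j" for j
    by (simp add: r_def algebra_simps)
  have r_per: "r (j + Q) = \<mu> * r j" for j
  proof -
    have "tmat z w 0 (Q + j) = tmat z w 0 j * M"
      unfolding tmat_add M_def by (simp, rule arg_cong[where f = "\<lambda>A. A * tmat z w 0 Q"], rule tmat_cong)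
        (use per in \<open>simp add: add.commute\<close>)
    hence "r (j + Q) = m11 (tmat z w 0 j * (M * s))" by (simp add: r_def mult.assoc add.commute)
    also have "\<dots> = \<mu> * r j" unfolding Ms r_def by (simp add: algebra_simps)
    finally show ?thesis .
  qed
  have r_per2: "r (j + N * Q) = \<mu> ^ N * r j" for j N
  proof (induction N)
    case (Suc N)
    have "r (j + Suc N * Q) = r ((j + N * Q) + Q)" by (simp add: algebra_simps)
    thus ?case using Suc by (simp add: r_per)
  qed simp
  \<comment> \<open>Extension to negative sites: moving \<open>n\<close> to the right by
    \<open>\<bar>n\<bar>\<close> periods makes it nonnegative, and dividing by a power of the
    multiplier undoes the move. By \<open>u_eq\<close> any other sufficient number of periods gives
    the same value.\<close>
  define u where "u n = r (nat (n + int (nat \<bar>n\<bar> * Q))) / \<mu> ^ nat \<bar>n\<bar>" for n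
  have le: "\<bar>n\<bar> \<le> int (nat \<bar>n\<bar> * Q)" for n
    using Q mult_left_mono[of 1 "int Q" "\<bar>n\<bar>"] by simp
  have u_eq: "u n = r (nat (n + int (N * Q))) / \<mu> ^ N" if "n + int (N * Q) \<ge> 0" for n N
  proof -
    define K where "K = nat \<bar>n\<bar>"
    have pos: "n + int (K * Q) \<ge> 0" using le[of n] unfolding K_def by linarith
    have "r (nat (n + int (K * Q)) + N * Q) = r (nat (n + int (N * Q)) + K * Q)"
    proof (rule arg_cong[where f = r])
      have "int (nat (n + int (K * Q)) + N * Q) = int (nat (n + int (N * Q)) + K * Q)"
        using pos that by simp
      thus "nat (n + int (K * Q)) + N * Q = nat (n + int (N * Q)) + K * Q" by linarith
    qed
    hence "\<mu> ^ N * r (nat (n + int (K * Q))) = \<mu> ^ K * r (nat (n + int (N * Q)))"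
      by (simp add: r_per2)
    thus ?thesis using mu0 by (simp add: u_def K_def field_simps)
  qed
  have eq: "u (n - 1) + u (n + 1) + (complex_of_real (w n) - z) * u n = 0" for n
  proof -
    define N where "N = nat \<bar>n\<bar> + 1"
    have pos: "n - 1 + int (N * Q) \<ge> 0"
      using le[of n] Q unfolding N_def by (simp add: algebra_simps)
    define j where "j = nat (n - 1 + int (N * Q))"
    have j: "int j = n - 1 + int (N * Q)" using pos by (simp add: j_def)
    have "nat (n + int (N * Q)) = Suc j" "nat (n + 1 + int (N * Q)) = Suc (Suc j)"
      using j by linarith+
    hence u3: "u (n - 1) = r j / \<mu> ^ N" "u n = r (Suc j) / \<mu> ^ N" "u (n + 1) = r (Suc (Suc j)) / \<mu> ^ N"
      using pos u_eq[of "n - 1" N] u_eq[of n N] u_eq[of "n + 1" N] by (simp_all add: j_def)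
    have "w (int j + 1) = w n"
      using periodic_add_mult[of w Q n "int N", OF per] by (simp add: j mult.commute)
    thus ?thesis unfolding u3 r_rec using mu0 by (simp add: field_simps)
  qed
  have qper: "u (n + int Q) = \<mu> * u n" for n
  proof -
    define N where "N = nat \<bar>n\<bar>"
    have pos: "n + int (N * Q) \<ge> 0" using le[of n] unfolding N_def by linarith
    have "nat (n + int Q + int (N * Q)) = nat (n + int (N * Q)) + Q" using pos by linarith
    thus ?thesis using u_eq[of n N] u_eq[of "n + int Q" N] pos by (simp add: r_per)
  qed
  have "r 0 = x" by (simp add: r_def s_def)
  \<comment> \<open>The component \<open>y\<close> stands for the value at site -1; it is read off
    one period later, where \<open>r\<close> is defined.\<close>
  moreover have "r (Q - 1) = \<mu> * y"
  proof -
    have "m21 (tmat z w 0 (Suc (Q - 1)) * s) = r (Q - 1)" by (simp add: r_def)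
    moreover have "m21 (tmat z w 0 Q * s) = \<mu> * y" using arg_cong[OF Ms, of m21] by (simp add: M_def s_def)
    ultimately show ?thesis using Q by simp
  qed
  moreover have "u (int j) = r j" for j using u_eq[of "int j" 0] by simp
  ultimately have "u 0 \<noteq> 0 \<or> u (int (Q - 1)) \<noteq> 0"
    using xy(1) mu0 by (metis mult_eq_0_iff of_nat_0)
  thus ?thesis using that[OF eq qper mu] by blast
qed

lemma shifted_cutoff:
  fixes W :: "int \<Rightarrow>\<^sub>C real"
  assumes "a < b" "\<And>n. a \<le> n \<Longrightarrow> n < b \<Longrightarrow> u (n - 1) + u (n + 1) + (complex_of_real (W n) - z) * u n = 0"
  shows "apply_ell2 (shifted W z (cutoff {a..<b} u)) n =
    (if n = a - 1 then u a else 0) + (if n = b then u (b - 1) else 0)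
    - (if n = a then u (a - 1) else 0) - (if n = b - 1 then u b else 0)"
proof (cases "a \<le> n \<and> n < b")
  case True
  hence eq: "(complex_of_real (W n) - z) * u n = - u (n - 1) - u (n + 1)"
    using assms(2)[of n] by (simp add: algebra_simps eq_neg_iff_add_eq_0)
  have "n + 1 < b \<or> n = b - 1" "a \<le> n - 1 \<or> n = a" using True by auto
  thus ?thesis using True by (auto simp: shifted_apply cutoff_apply eq)
next
  case False
  thus ?thesis using assms(1) by (auto simp: shifted_apply cutoff_apply)
qed

text \<open>A truncated solution violates the equation only at the two sites next to each cut.
  \<open>a + 1 < b\<close> makes these four sites distinct, so the squared norm is exactly the sum
  of the four contributions.\<close>

lemma norm_shifted_cutoff:
  fixes W :: "int \<Rightarrow>\<^sub>C real"
  assumes "a + 1 < b" "\<And>n. a \<le> n \<Longrightarrow> n < b \<Longrightarrow> u (n - 1) + u (n + 1) + (complex_of_real (W n) - z) * u n = 0"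
  shows "(norm (shifted W z (cutoff {a..<b} u)))\<^sup>2 =
    (norm (u (a - 1)))\<^sup>2 + (norm (u a))\<^sup>2 + (norm (u (b - 1)))\<^sup>2 + (norm (u b))\<^sup>2"
proof -
  let ?x = "shifted W z (cutoff {a..<b} u)"
  have x: "apply_ell2 ?x n = (if n = a - 1 then u a else 0) + (if n = b then u (b - 1) else 0)
    - (if n = a then u (a - 1) else 0) - (if n = b - 1 then u b else 0)" for n
    using assms by (intro shifted_cutoff) auto
  have "(norm ?x)\<^sup>2 = (\<Sum>n\<in>{a - 1, a, b - 1, b}. (norm (apply_ell2 ?x n))\<^sup>2)"
    by (rule norm_sq_finite_support) (auto simp: x)
  also have "\<dots> = (norm (u (a - 1)))\<^sup>2 + (norm (u a))\<^sup>2 + (norm (u (b - 1)))\<^sup>2 + (norm (u b))\<^sup>2"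
    using assms(1) by (simp add: x)
  finally show ?thesis .
qed

lemma norm_cutoff: "(norm (cutoff {a..<b::int} u))\<^sup>2 = (\<Sum>n\<in>{a..<b}. (norm (u n))\<^sup>2)"
  by (subst norm_sq_finite_support[of "{a..<b}"]) (auto simp: cutoff_apply)

lemma quasi_periodic_norm:
  assumes "\<And>n. u (n + int Q) = \<mu> * u n" "norm \<mu> = 1"
  shows "norm (u (n + int Q)) = norm (u n :: complex)"
  using assms by (simp add: norm_mult)

text \<open>Truncated to \<open>N\<close> periods, a Floquet solution has squared norm proportional
  to \<open>N\<close>, while the residual at the cuts stays bounded; this excludes a bounded
  inverse. The conclusion concerns \<open>spectrum\<close> because \<open>z\<close> is not yet known
  to be real.\<close>

lemma floquet_imp_spectrum:
  fixes W :: "int \<Rightarrow>\<^sub>C real"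
  assumes Q: "Q \<ge> 1" and u: "\<And>n. u (n - 1) + u (n + 1) + (complex_of_real (W n) - z) * u n = 0"
    and qp: "\<And>n. u (n + int Q) = \<mu> * u n" "norm \<mu> = 1" and "u n0 \<noteq> 0"
  shows "z \<in> spectrum (schroedinger W)"
proof (rule ccontr)
  assume "z \<notin> spectrum (schroedinger W)"
  then obtain B where B: "B o\<^sub>L shifted W z = id_blinfun" by (auto simp: spectrum_def shifted_def)
  have inv: "norm x \<le> norm B * norm (shifted W z x)" for x
    using norm_blinfun[of B "shifted W z x"] arg_cong[OF B, of "\<lambda>A. blinfun_apply A x"] by simp
  define v where "v n = norm (u n)" for n
  have per: "v (n + int Q) = v n" for n unfolding v_def by (rule quasi_periodic_norm[of u Q \<mu>, OF qp])
  define C where "C = (\<Sum>n\<in>{0..<int Q}. v n)"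
  have vC: "v n \<le> C" for n
  proof -
    have "v (n mod int Q) \<le> C"
      unfolding C_def by (rule member_le_sum) (use Q in \<open>auto simp: v_def\<close>)
    thus ?thesis by (simp add: periodic_mod[of v Q, OF per])
  qed
  define S where "S = (\<Sum>n\<in>{0..<int Q}. (v n)\<^sup>2)"
  have "(v (n0 mod int Q))\<^sup>2 \<le> S"
    unfolding S_def by (rule member_le_sum) (use Q in \<open>auto simp: v_def\<close>)
  moreover have "v n0 > 0" using \<open>u n0 \<noteq> 0\<close> by (simp add: v_def)
  ultimately have S: "S > 0" by (simp add: periodic_mod[of v Q, OF per]) (metis less_le_trans zero_less_power2 less_irrefl)
  have sums: "(\<Sum>n\<in>{0..<int (N * Q)}. (v n)\<^sup>2) = real N * S" for N
  proof (induction N)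
    case (Suc N)
    have "{0..<int (Suc N * Q)} = {0..<int (N * Q)} \<union> {int (N * Q)..<int (Suc N * Q)}"
      by (rule ivl_disj_un_two(3)[symmetric]) (simp_all del: of_nat_mult)
    moreover have "(\<Sum>n\<in>{int (N * Q)..<int (Suc N * Q)}. (v n)\<^sup>2) = S"
      unfolding S_def
      by (rule sum.reindex_bij_witness[of _ "\<lambda>n. n + int Q * int N" "\<lambda>n. n - int Q * int N"])
        (use periodic_add_mult[of v Q _ "- int N", OF per] in \<open>auto simp: algebra_simps\<close>)
    ultimately show ?case using Suc by (simp add: sum.union_disjoint algebra_simps)
  qed simp
  have "real N * S \<le> (norm B)\<^sup>2 * (4 * C\<^sup>2)" if "N \<ge> 2" for N
  proof -
    let ?x = "cutoff {0..<int (N * Q)} u"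
    have NQ: "1 < N * Q" using that Q by (metis less_le_trans mult_le_mono nat_mult_1_right one_less_numeral_iff semiring_norm(76) mult_1_right)
    have "(norm (shifted W z ?x))\<^sup>2 = (v (0 - 1))\<^sup>2 + (v 0)\<^sup>2 + (v (int (N * Q) - 1))\<^sup>2 + (v (int (N * Q)))\<^sup>2"
      unfolding v_def by (rule norm_shifted_cutoff) (use NQ u in \<open>simp_all del: of_nat_mult\<close>)
    also have "\<dots> \<le> C\<^sup>2 + C\<^sup>2 + C\<^sup>2 + C\<^sup>2"
      using vC by (intro add_mono power_mono) (simp_all add: v_def)
    finally have bound: "(norm (shifted W z ?x))\<^sup>2 \<le> 4 * C\<^sup>2" by simp
    have "real N * S = (norm ?x)\<^sup>2" unfolding norm_cutoff sums[symmetric] v_def ..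
    also have "\<dots> \<le> (norm B * norm (shifted W z ?x))\<^sup>2" by (intro power_mono inv) auto
    also have "\<dots> \<le> (norm B)\<^sup>2 * (4 * C\<^sup>2)"
      unfolding power_mult_distrib by (intro mult_left_mono bound) auto
    finally show ?thesis .
  qed
  note bd = this
  obtain N :: nat where "real N > (norm B)\<^sup>2 * (4 * C\<^sup>2) / S" using reals_Archimedean2 by blast
  hence "real N * S > (norm B)\<^sup>2 * (4 * C\<^sup>2)" using S by (simp add: field_simps)
  moreover have "real N * S \<le> real (N + 2) * S" using S by simp
  ultimately show False using bd[of "N + 2"] by simp
qed

lemma periodic_spectrum_complex:
  fixes W :: "int \<Rightarrow>\<^sub>C real"
  assumes per: "\<And>n. W (n + int Q) = W n" and Q: "Q \<ge> 1"
    and tr: "mtr (tmat z W 0 Q) = complex_of_real t" "\<bar>t\<bar> \<le> 2"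
  shows "z \<in> spectrum (schroedinger W)"
proof -
  obtain u \<mu> n0 where "\<And>n. u (n - 1) + u (n + 1) + (complex_of_real (W n) - z) * u n = 0"
    "\<And>n. u (n + int Q) = \<mu> * u n" "norm \<mu> = 1" "u n0 \<noteq> 0"
    using floquet_solution[of W Q z t] assms by blast
  thus ?thesis using floquet_imp_spectrum Q by blast
qed

lemma periodic_spec_iff:
  fixes W :: "int \<Rightarrow>\<^sub>C real"
  assumes per: "\<And>n. W (n + int Q) = W n" and Q: "Q \<ge> 1"
  shows "E \<in> spec W \<longleftrightarrow> \<bar>mtr (tmat E W 0 Q)\<bar> \<le> 2"
proof
  assume "E \<in> spec W"
  thus "\<bar>mtr (tmat E W 0 Q)\<bar> \<le> 2"
    using trace_gt_2_imp_gap[of W Q E, OF per] gap_imp_not_spec by (metis not_less)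
next
  assume "\<bar>mtr (tmat E W 0 Q)\<bar> \<le> 2"
  thus "E \<in> spec W"
    using periodic_spectrum_complex[of W Q "complex_of_real E", OF per Q mtr_tmat_of_real]
    by (simp add: spec_def)
qed

lemma exists_large_trace:
  fixes W :: "int \<Rightarrow>\<^sub>C real"
  assumes "\<And>n. W (n + int Q) = W n" "Q \<ge> 1"
  shows "\<exists>E::real. \<bar>mtr (tmat E W 0 Q)\<bar> > 2"
proof -
  have "3 + norm W \<notin> spec W"
  proof
    assume "3 + norm W \<in> spec W"
    hence "\<bar>3 + norm W\<bar> \<le> 2 + norm W" using spec_bounded[of W] by (auto simp: dist_norm)
    thus False using norm_ge_zero[of W] by linarith
  qed
  thus ?thesis using periodic_spec_iff[OF assms] not_le by blast
qed

text \<open>The squared discriminant minus 4 is a nonzero polynomial, because the discriminant is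
  large at some energy outside the spectrum. So an arbitrarily small change of energy reaches strict
  ellipticity or hyperbolicity.\<close>

lemma exists_nonparabolic:
  fixes W :: "int \<Rightarrow>\<^sub>C real"
  assumes per: "\<And>n. W (n + int Q) = W n" "Q \<ge> 1" and "e > 0"
  shows "\<exists>E'. \<bar>E' - E\<bar> < (e::real) \<and> \<bar>mtr (tmat E' W 0 Q)\<bar> \<noteq> 2"
proof (rule ccontr)
  assume none: "\<not> ?thesis"
  define f where "f x = mtr (tmat x W 0 Q) * mtr (tmat x W 0 Q) - 4" for x :: real
  have "f x = 0" for x
  proof (rule poly_fun_zero[of f "{E - e<..<E + e}"])
    show "poly_fun f" unfolding f_def by (intro poly_fun_intros poly_fun_mtr poly_m2_tmat)
    show "infinite {E - e<..<E + e}" using \<open>e > 0\<close> by (simp add: infinite_Ioo)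
    fix y assume "y \<in> {E - e<..<E + e}"
    hence "\<bar>mtr (tmat y W 0 Q)\<bar> = 2" using none by (auto simp: abs_less_iff)
    hence "mtr (tmat y W 0 Q) * mtr (tmat y W 0 Q) = 2 * 2" by (metis abs_mult_self_eq)
    thus "f y = 0" by (simp add: f_def)
  qed
  note zero = this
  obtain x :: real where x: "\<bar>mtr (tmat x W 0 Q)\<bar> > 2" using exists_large_trace[of W Q, OF per] by blast
  hence "\<bar>mtr (tmat x W 0 Q)\<bar> * \<bar>mtr (tmat x W 0 Q)\<bar> > 2 * 2" by (intro mult_strict_mono) auto
  thus False using zero[of x] by (simp add: f_def)
qed

text \<open>Near \<open>E\<close> the discriminant, an open map on the complex plane, takes real values in \<open>[-2, 2]\<close>
  other than its value at \<open>E\<close>; the points where it does so lie in the spectrum, hence are real.\<close>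

lemma periodic_spec_no_isolated:
  fixes W :: "int \<Rightarrow>\<^sub>C real"
  assumes per: "\<And>n. W (n + int Q) = W n" "Q \<ge> 1" and "E \<in> spec W" "e > 0"
  shows "\<exists>E'\<in>spec W. E' \<noteq> E \<and> dist E' E < e"
proof -
  define D where "D z = mtr (tmat z W 0 Q)" for z :: complex
  define t where "t = mtr (tmat E W 0 Q)"
  have t: "\<bar>t\<bar> \<le> 2" using periodic_spec_iff[of W Q E, OF per] \<open>E \<in> spec W\<close> by (simp add: t_def)
  have Dt: "D (complex_of_real x) = complex_of_real (mtr (tmat x W 0 Q))" for x
    by (simp add: D_def mtr_tmat_of_real)
  have "poly_fun D" unfolding D_def by (intro poly_fun_mtr poly_m2_tmat)
  then obtain p where "D = poly p" by (auto simp: poly_fun_def fun_eq_iff)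
  hence hol: "D holomorphic_on UNIV" by (auto intro!: holomorphic_intros)
  have nc: "\<not> D constant_on UNIV"
  proof
    assume "D constant_on UNIV"
    then obtain c where c: "\<And>z. D z = c" by (auto simp: constant_on_def)
    obtain x :: real where x: "\<bar>mtr (tmat x W 0 Q)\<bar> > 2" using exists_large_trace[of W Q, OF per] by blast
    have "complex_of_real (mtr (tmat x W 0 Q)) = complex_of_real t" using c Dt unfolding t_def by metis
    thus False using x t by simp
  qed
  have "open (D ` ball (complex_of_real E) e)"
    by (rule open_mapping_thm[OF hol _ _ _ _ nc]) auto
  moreover have "complex_of_real t \<in> D ` ball (complex_of_real E) e"
    using Dt[of E] \<open>e > 0\<close> by (intro image_eqI[of _ _ "complex_of_real E"]) (auto simp: t_def)
  ultimately obtain d where d: "d > 0" "ball (complex_of_real t) d \<subseteq> D ` ball (complex_of_real E) e"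
    unfolding open_contains_ball by blast
  \<comment> \<open>A step of length at most 1, down from a positive \<open>t\<close> and up
    otherwise, cannot leave \<open>[-2, 2]\<close>; taking at most half of \<open>d\<close> keeps it
    inside the ball.\<close>
  define h where "h = min (d / 2) 1"
  define s where "s = (if t > 0 then t - h else t + h)"
  have s: "\<bar>s\<bar> \<le> 2" "s \<noteq> t" "\<bar>s - t\<bar> < d" using t d(1) by (auto simp: s_def h_def min_def)
  have "complex_of_real s \<in> ball (complex_of_real t) d"
    using s(3) by (simp add: dist_norm abs_minus_commute flip: of_real_diff)
  hence "complex_of_real s \<in> D ` ball (complex_of_real E) e" using d(2) by blast
  then obtain z where z: "dist (complex_of_real E) z < e" "D z = complex_of_real s" by auto
  have zs: "z \<in> spectrum (schroedinger W)"
    using periodic_spectrum_complex[of W Q z s, OF per] z(2) s(1) by (simp add: D_def)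
  then obtain E' where E': "z = complex_of_real E'"
    using spectrum_schroedinger_real Reals_cases by (metis subset_iff)
  have "E' \<in> spec W" using zs by (simp add: spec_def E')
  moreover have "E' \<noteq> E" using z(2) s(2) Dt[of E] by (auto simp: E' t_def)
  moreover have "dist E' E < e" using z(1) by (simp add: E' dist_commute)
  ultimately show ?thesis by blast
qed

section \<open>Opening a gap by a small periodic perturbation\<close>

lemma repeat_apply: "k \<ge> 1 \<Longrightarrow> apply_bcontfun (repeat V k) n = V (n div int k)"
  using floor_divide_of_int_eq[of n "int k", where 'a = real] by (simp add: repeat.rep_eq)

lemma scaled_repeat_apply: "k \<ge> 1 \<Longrightarrow> apply_bcontfun (c *\<^sub>R repeat V k) n = c * V (n div int k)"
  by (simp add: scaleR_bcontfun.rep_eq repeat_apply)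

lemma scaled_repeat_periodic:
  assumes "\<And>n. apply_bcontfun V (n + int p) = V n" "k \<ge> 1"
  shows "apply_bcontfun (c *\<^sub>R repeat V k) (n + int (p * k)) = (c *\<^sub>R repeat V k) n"
proof -
  have "(n + int (p * k)) div int k = n div int k + int p" using assms(2) by simp
  thus ?thesis by (simp only: scaled_repeat_apply[OF assms(2)] assms(1))
qed

lemma bcontfun_ofI: "(\<And>n. \<bar>f n\<bar> \<le> C) \<Longrightarrow> apply_bcontfun (Bcontfun f) n = (f n :: real)" for f :: "int \<Rightarrow> real"
  by (subst Bcontfun_inverse) (auto simp: bcontfun_def bounded_iff)

lemma tmat_blocks:
  "(\<And>i. i < j \<Longrightarrow> tmat z w (n + int (i * Q)) Q = A) \<Longrightarrow> tmat z w n (j * Q) = A ^ j"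
proof (induction j)
  case (Suc j)
  have "tmat z w n (j * Q + Q) = A * A ^ j"
    unfolding tmat_add using Suc by (simp del: of_nat_mult)
  thus ?case by (simp add: add.commute)
qed simp

text \<open>The constant \<open>s\<close> moves a nonparabolic energy \<open>E'\<close> near
  \<open>E\<close> to \<open>E\<close>. If \<open>E'\<close> lies in a gap, that is all. Otherwise
  \<open>V\<close> is also altered at the first site of selected periods; \<open>repeat\<close>
  turns this site into \<open>k\<close> consecutive ones, whence the factors \<open>mT b ^ k\<close>
  in the words. Shift and alteration each cost less than \<open>e / 3\<close>.\<close>

lemma exists_periodic_gap:
  fixes V :: "int \<Rightarrow>\<^sub>C real"
  assumes per: "\<And>n. V (n + int p) = V n" and p: "p \<ge> 1" and "e > 0" "c \<noteq> 0" and k: "k \<ge> 1"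
  shows "\<exists>w. (\<exists>q\<ge>1. \<forall>n. apply_bcontfun w (n + int q) = w n) \<and> dist w V < e \<and>
    E \<notin> spec (c *\<^sub>R repeat w k)"
proof -
  define W where "W = c *\<^sub>R repeat V k"
  define Q where "Q = p * k"
  have Q: "Q \<ge> 1" using p k by (simp add: Q_def)
  have Wper: "W (n + int Q) = W n" for n
    unfolding W_def Q_def by (rule scaled_repeat_periodic) (use per k in auto)
  define h where "h = \<bar>c\<bar> * e / 3"
  have h: "h > 0" using \<open>e > 0\<close> \<open>c \<noteq> 0\<close> by (simp add: h_def)
  obtain E' where E': "\<bar>E' - E\<bar> < h" "\<bar>mtr (tmat E' W 0 Q)\<bar> \<noteq> 2"
    using exists_nonparabolic[of W Q h E, OF Wper Q h] by blast
  define s where "s = (E - E') / c"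
  have cs: "c * s = E - E'" using \<open>c \<noteq> 0\<close> by (simp add: s_def)
  have s: "\<bar>s\<bar> < e / 3"
    using E'(1) \<open>c \<noteq> 0\<close> by (simp add: s_def h_def field_simps abs_minus_commute)
  \<comment> \<open>\<open>N\<close> counts the old periods in a new one, and \<open>Z\<close>
    selects those that receive the alteration \<open>d\<close>. The trace bound is stated for any
    \<open>W'\<close> with the right values, so both cases share the construction of the potential
    below.\<close>
  obtain d N Z where dN: "N \<ge> (1::nat)" "\<bar>d\<bar> < e / 3"
    and tr: "\<And>W'. (\<And>i j. i < N \<Longrightarrow> j < Q \<Longrightarrow>
         W' (int (i * Q) + int j) = W (int j) + (E - E') + (if j < k \<and> i \<in> Z then c * d else 0)) \<Longrightarrow>
       \<bar>mtr (tmat E W' 0 (N * Q))\<bar> > 2"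
  proof (cases "\<bar>mtr (tmat E' W 0 Q)\<bar> > 2")
    case True
    have "\<bar>mtr (tmat E W' 0 (1 * Q))\<bar> > 2"
      if "\<And>i j. i < 1 \<Longrightarrow> j < Q \<Longrightarrow>
         W' (int (i * Q) + int j) = W (int j) + (E - E') + (if j < k \<and> i \<in> {} then c * 0 else 0)" for W'
    proof -
      have "tmat E W' 0 Q = tmat E (\<lambda>n. W n + (E - E')) 0 Q"
        by (rule tmat_cong) (use that[of 0] in simp)
      thus ?thesis using True by (simp add: tmat_shift_potential)
    qed
    thus ?thesis using \<open>e > 0\<close> by (intro that[of 1 0 "{}"]) auto
  next
    case False
    hence ell: "\<bar>mtr (tmat E' W 0 Q)\<bar> < 2" using E'(2) by linarith
    define B where "B = tmat E' W (int k) (Q - k)"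
    define a where "a = E' - W 0"
    have kQ: "k \<le> Q" using p by (simp add: Q_def)
    have W0: "W (int i) = W 0" if "i < k" for i
      using that k by (simp add: W_def repeat_apply)
    have "tmat E' W 0 Q = B * mT a ^ k"
    proof -
      have "tmat E' W 0 (k + (Q - k)) = B * tmat E' W 0 k" unfolding tmat_add B_def by simp
      also have "tmat E' W 0 k = mT a ^ k"
        using tmat_const[of k W 0 "W 0" E'] W0 by (simp add: a_def)
      finally show ?thesis using kQ by simp
    qed
    hence ell: "\<bar>mtr (B * mT a ^ k)\<bar> < 2" using ell by simp
    obtain b n m where b: "\<bar>b - a\<bar> < h"
      and hyp: "mtr (B * mT a ^ k * (B * mT b ^ k) * (B * mT a ^ k) ^ n * (B * mT b ^ k) ^ m) > 2"
      using exists_hyperbolic_word[OF _ ell k h] by (auto simp: B_def)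
    define d where "d = (a - b) / c"
    have cd: "c * d = a - b" using \<open>c \<noteq> 0\<close> by (simp add: d_def)
    have d: "\<bar>d\<bar> < e / 3"
      using b \<open>c \<noteq> 0\<close> by (simp add: d_def h_def field_simps abs_minus_commute)
    \<comment> \<open>Later sites multiply from the left, so \<open>X * Y * X^n * Y^m\<close> is
      read from right to left: \<open>m\<close> altered periods, \<open>n\<close> unaltered ones,
      one altered, one unaltered.\<close>
    define N where "N = m + (n + 2)"
    define Z where "Z = {..<m} \<union> {m + n}"
    have "\<bar>mtr (tmat E W' 0 (N * Q))\<bar> > 2"
      if W': "\<And>i j. i < N \<Longrightarrow> j < Q \<Longrightarrow>
         W' (int (i * Q) + int j) = W (int j) + (E - E') + (if j < k \<and> i \<in> Z then c * d else 0)" for W'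
    proof -
      have block: "tmat E W' (int (i * Q)) Q = B * mT (if i \<in> Z then b else a) ^ k" if "i < N" for i
      proof -
        have "tmat E W' (int (i * Q)) (k + (Q - k))
            = tmat E W' (int (i * Q) + int k) (Q - k) * tmat E W' (int (i * Q)) k"
          by (rule tmat_add)
        also have "tmat E W' (int (i * Q) + int k) (Q - k) = tmat E (\<lambda>n. W n + (E - E')) (int k) (Q - k)"
        proof (rule tmat_cong)
          fix j assume "j < Q - k"
          thus "W' (int (i * Q) + int k + int j) = W (int k + int j) + (E - E')"
            using W'[OF that, of "k + j"] by (simp add: add.assoc)
        qed
        also have "\<dots> = B" by (simp add: tmat_shift_potential B_def)
        also have "tmat E W' (int (i * Q)) k = mT (E - of_real (W 0 + (E - E') + (if i \<in> Z then c * d else 0))) ^ k"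
          by (rule tmat_const) (use W'[OF that] W0 kQ in auto)
        also have "E - of_real (W 0 + (E - E') + (if i \<in> Z then c * d else 0)) = (if i \<in> Z then b else a)"
          by (simp add: cd a_def)
        finally show ?thesis using kQ by simp
      qed
      define X where "X = B * mT a ^ k"
      define Y where "Y = B * mT b ^ k"
      have "tmat E W' 0 (m * Q) = Y ^ m"
        by (rule tmat_blocks) (simp add: block N_def Z_def Y_def del: of_nat_mult)
      moreover have "tmat E W' (int (m * Q)) (n * Q) = X ^ n"
      proof (rule tmat_blocks)
        fix i assume "i < n"
        hence "tmat E W' (int ((m + i) * Q)) Q = X" by (subst block) (auto simp: N_def Z_def X_def)
        thus "tmat E W' (int (m * Q) + int (i * Q)) Q = X" by (simp add: algebra_simps)
      qed
      moreover have "tmat E W' (int ((m + n) * Q)) Q = Y" by (subst block) (auto simp: N_def Z_def Y_def)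
      moreover have "tmat E W' (int ((m + n + 1) * Q)) Q = X" by (subst block) (auto simp: N_def Z_def X_def)
      moreover have "tmat E W' 0 (N * Q) = tmat E W' 0 (m * Q + (n * Q + (Q + Q)))"
        by (simp add: N_def algebra_simps)
      ultimately have "tmat E W' 0 (N * Q) = X * Y * X ^ n * Y ^ m"
        unfolding tmat_add by (simp add: algebra_simps)
      thus ?thesis using hyp by (simp add: X_def Y_def)
    qed
    moreover have "N \<ge> 1" by (simp add: N_def)
    ultimately show ?thesis using d that[of N d Z] by blast
  qed
  define f where "f x = V x + s + (if int p dvd x \<and> nat ((x div int p) mod int N) \<in> Z then d else 0)" for x
  have fV: "\<bar>f x - V x\<bar> \<le> 2 / 3 * e" for x
    using s dN(2) abs_triangle_ineq[of s d] by (auto simp: f_def)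
  define w where "w = Bcontfun f"
  have wf: "apply_bcontfun w x = f x" for x
    unfolding w_def
  proof (rule bcontfun_ofI[of f "norm V + 2 / 3 * e"])
    fix x
    have "\<bar>f x\<bar> \<le> \<bar>V x\<bar> + \<bar>f x - V x\<bar>" by linarith
    thus "\<bar>f x\<bar> \<le> norm V + 2 / 3 * e" using norm_bounded[of V x] fV[of x] by simp
  qed
  have "dist w V \<le> 2 / 3 * e"
    by (rule dist_bound) (use fV in \<open>simp add: wf dist_real_def\<close>)
  hence dist: "dist w V < e" using \<open>e > 0\<close> by linarith
  have wper: "w (x + int (p * N)) = w x" for x
  proof -
    have "(x + int (p * N)) div int p = x div int p + int N" using p by simp
    moreover have "V (x + int (p * N)) = V x" using periodic_add_mult[of V p x "int N", OF per] by simp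
    moreover have "int p dvd x + int (p * N) \<longleftrightarrow> int p dvd x" by (simp add: dvd_add_left_iff)
    ultimately show ?thesis by (simp add: wf f_def del: of_nat_mult)
  qed
  define W' where "W' = c *\<^sub>R repeat w k"
  have "\<bar>mtr (tmat E W' 0 (N * Q))\<bar> > 2"
  proof (rule tr)
    fix i j assume ij: "i < N" "j < Q"
    have j: "j div k < p" using ij by (simp add: Q_def less_mult_imp_div_less mult.commute)
    have "int (i * Q) + int j = int j + int (p * i) * int k" by (simp add: Q_def)
    hence "(int (i * Q) + int j) div int k = int (p * i) + int (j div k)"
      using k by (simp add: zdiv_int del: of_nat_mult)
    hence "W' (int (i * Q) + int j) = c * f (int (p * i) + int (j div k))"
      by (simp only: W'_def scaled_repeat_apply[OF k] wf)
    also have "V (int (p * i) + int (j div k)) = V (int (j div k))"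
      using periodic_add_mult[of V p "int (j div k)" "int i", OF per] by (simp add: add.commute)
    hence "f (int (p * i) + int (j div k)) = V (int (j div k)) + s + (if j < k \<and> i \<in> Z then d else 0)"
    proof -
      have "(int (p * i) + int (j div k)) div int p = int i" using j p by simp
      moreover have "int p dvd int (p * i) + int (j div k) \<longleftrightarrow> j < k"
      proof -
        have "int p dvd int (p * i) + int (j div k) \<longleftrightarrow> p dvd j div k"
          by (simp add: dvd_add_right_iff)
        also have "\<dots> \<longleftrightarrow> j div k = 0" using j by (auto dest: dvd_imp_le)
        also have "\<dots> \<longleftrightarrow> j < k" using k by (simp add: div_eq_0_iff)
        finally show ?thesis .
      qed
      ultimately show ?thesis using ij \<open>V (int (p * i) + int (j div k)) = V (int (j div k))\<close>
        by (simp add: f_def del: of_nat_mult)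
    qed
    also have "c * (V (int (j div k)) + s + (if j < k \<and> i \<in> Z then d else 0))
        = W (int j) + (E - E') + (if j < k \<and> i \<in> Z then c * d else 0)"
      by (simp only: W_def scaled_repeat_apply[OF k] zdiv_int cs[symmetric]) (simp add: algebra_simps)
    finally show "W' (int (i * Q) + int j) = W (int j) + (E - E') + (if j < k \<and> i \<in> Z then c * d else 0)" .
  qed
  note big = this
  have W'per: "W' (n + int (N * Q)) = W' n" for n
    unfolding W'_def using scaled_repeat_periodic[of w "p * N" k c n, OF wper k] by (simp only: Q_def ac_simps)
  have NQ: "N * Q \<ge> 1" "p * N \<ge> 1" using dN(1) p Q by auto
  have "E \<notin> spec W'" unfolding periodic_spec_iff[of W' "N * Q" E, OF W'per NQ(1)] using big by linarith
  hence Enot: "E \<notin> spec (c *\<^sub>R repeat w k)" unfolding W'_def .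
  have "\<exists>q\<ge>1. \<forall>n. apply_bcontfun w (n + int q) = w n"
    by (rule exI[of _ "p * N"]) (use NQ(2) wper in blast)
  with dist Enot show ?thesis by blast
qed

section \<open>Finitely many perturbations for all parameters, by compactness\<close>

lemma gap_mono: "gap W E g \<Longrightarrow> g' \<le> g \<Longrightarrow> gap W E g'"
  unfolding gap_def by (meson mult_right_mono norm_ge_zero order_trans)

lemma norm_repeat_le: "k \<ge> 1 \<Longrightarrow> norm (repeat V k) \<le> norm V"
  by (rule norm_bound) (use norm_bounded[of V] in \<open>simp add: repeat_apply\<close>)

text \<open>A gap of \<open>w\<close> at one pair \<open>(c, E)\<close> survives with half its size
  at nearby pairs, and finitely many such neighbourhoods cover a compact set of pairs. Couplings
  stay away from 0, where no perturbation has an effect. Large energies are left to \<open>V\<close>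
  itself.\<close>

lemma finite_gap_family_fixed:
  fixes V :: "int \<Rightarrow>\<^sub>C real"
  assumes per: "\<And>n. V (n + int p) = V n" and p: "p \<ge> 1" and "e > 0" and J: "J > 0" and k: "k \<ge> 1"
  shows "\<exists>F g. finite F \<and> g > 0 \<and>
    (\<forall>w\<in>F. dist w V < e \<and> (\<exists>q\<ge>1. \<forall>n. apply_bcontfun w (n + int q) = w n)) \<and>
    (\<forall>c E. 1 / J \<le> \<bar>c\<bar> \<longrightarrow> \<bar>c\<bar> \<le> J \<longrightarrow> (\<exists>w\<in>F. gap (c *\<^sub>R repeat w k) E g))"
proof -
  \<comment> \<open>Beyond this radius \<open>gap_far\<close> gives a gap of size at least 1 for
    every admissible multiple of \<open>V\<close>.\<close>
  define R where "R = 3 + J * norm V"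
  define T where "T = ({-J..-(1/J)} \<union> {1/J..J}) \<times> {-R..R}"
  have "compact T" unfolding T_def by (intro compact_Times compact_Un compact_Icc)
  have "\<exists>w g. (\<exists>q\<ge>1. \<forall>n. apply_bcontfun w (n + int q) = w n) \<and> dist w V < e \<and>
      g > 0 \<and> gap (fst t *\<^sub>R repeat w k) (snd t) g" if "t \<in> T" for t
  proof -
    have c0: "fst t \<noteq> 0" using that J by (auto simp: T_def divide_le_0_iff)
    obtain w where w: "\<exists>q\<ge>1. \<forall>n. apply_bcontfun w (n + int q) = w n" "dist w V < e"
      "snd t \<notin> spec (fst t *\<^sub>R repeat w k)"
      using exists_periodic_gap[of V p e "fst t" k "snd t", OF per p \<open>e > 0\<close> c0 k] by blast
    obtain g where "g > 0" "gap (fst t *\<^sub>R repeat w k) (snd t) g"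
      using not_spec_imp_gap[OF w(3)] by blast
    thus ?thesis using w(1,2) by blast
  qed
  then obtain w g where w: "\<And>t. t \<in> T \<Longrightarrow> \<exists>q\<ge>1. \<forall>n. apply_bcontfun (w t) (n + int q) = w t n"
    "\<And>t. t \<in> T \<Longrightarrow> dist (w t) V < e" "\<And>t. t \<in> T \<Longrightarrow> g t > 0"
    "\<And>t. t \<in> T \<Longrightarrow> gap (fst t *\<^sub>R repeat (w t) k) (snd t) (g t)"
    by metis
  define r where "r t = g t / (2 * (norm (w t) + 1))" for t
  have wpos: "norm (w t) + 1 > 0" for t by (simp add: add_nonneg_pos)
  have r: "r t > 0" if "t \<in> T" for t using w(3)[OF that] wpos[of t] by (simp add: r_def)
  have near: "gap (c *\<^sub>R repeat (w t) k) E (g t / 2)" if t: "t \<in> T" "dist (c, E) t < r t" for t c E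
  proof -
    have d: "dist c (fst t) \<le> r t" "dist E (snd t) \<le> r t"
      using t(2) dist_fst_le[of "(c, E)" t] dist_snd_le[of "(c, E)" t] by simp_all
    have "dist (fst t *\<^sub>R repeat (w t) k) (c *\<^sub>R repeat (w t) k) = \<bar>fst t - c\<bar> * norm (repeat (w t) k)"
      by (simp add: dist_norm flip: scaleR_diff_left)
    also have "\<dots> \<le> r t * norm (w t)"
      using d(1) r[OF t(1)] norm_repeat_le[OF k, of "w t"]
      by (intro mult_mono) (auto simp: dist_real_def abs_minus_commute)
    finally have "dist (fst t *\<^sub>R repeat (w t) k) (c *\<^sub>R repeat (w t) k) + dist (snd t) E \<le> r t * (norm (w t) + 1)"
      using d(2) by (simp add: dist_commute algebra_simps)
    also have "\<dots> = g t / 2" using wpos[of t] by (simp add: r_def field_simps)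
    finally have "g t / 2 \<le> g t - dist (fst t *\<^sub>R repeat (w t) k) (c *\<^sub>R repeat (w t) k) - dist (snd t) E"
      by simp
    thus ?thesis by (rule gap_mono[OF gap_perturb[OF w(4)[OF t(1)]]])
  qed
  have "T \<subseteq> (\<Union>t\<in>T. ball t (r t))" using r by auto
  then obtain D where D: "D \<subseteq> T" "finite D" "T \<subseteq> (\<Union>t\<in>D. ball t (r t))"
    using compactE_image[OF \<open>compact T\<close>, of T "\<lambda>t. ball t (r t)"] by auto
  define F where "F = insert V (w ` D)"
  define g0 where "g0 = Min (insert 1 ((\<lambda>t. g t / 2) ` D))"
  have g0: "g0 > 0" using D w(3) by (auto simp: g0_def)
  have g0': "g0 \<le> 1" "\<And>t. t \<in> D \<Longrightarrow> g0 \<le> g t / 2"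
    unfolding g0_def using D(2) by (intro Min_le; simp)+
  have "\<exists>v\<in>F. gap (c *\<^sub>R repeat v k) E g0" if c: "1 / J \<le> \<bar>c\<bar>" "\<bar>c\<bar> \<le> J" for c E
  proof (cases "\<bar>E\<bar> \<le> R")
    case True
    have "(c, E) \<in> T" using c True by (auto simp: T_def abs_if split: if_splits)
    then obtain t where t: "t \<in> D" "dist (c, E) t < r t" using D(3) by (auto simp: dist_commute)
    hence "gap (c *\<^sub>R repeat (w t) k) E g0"
      using near[of t c E] D(1) by (intro gap_mono[OF _ g0'(2)[OF t(1)]]) auto
    thus ?thesis using t(1) by (auto simp: F_def)
  next
    case False
    have "norm (c *\<^sub>R repeat V k) \<le> J * norm V"
      using c norm_repeat_le[OF k, of V] J by (auto intro!: mult_mono)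
    hence "g0 \<le> \<bar>E\<bar> - 2 - norm (c *\<^sub>R repeat V k)" using False g0'(1) by (simp add: R_def)
    thus ?thesis using gap_mono[OF gap_far] by (auto simp: F_def)
  qed
  hence "\<forall>c E. 1 / J \<le> \<bar>c\<bar> \<longrightarrow> \<bar>c\<bar> \<le> J \<longrightarrow> (\<exists>v\<in>F. gap (c *\<^sub>R repeat v k) E g0)" by simp
  moreover have "finite F" using D by (simp add: F_def)
  moreover have "\<forall>v\<in>F. dist v V < e \<and> (\<exists>q\<ge>1. \<forall>n. apply_bcontfun v (n + int q) = v n)"
  proof
    fix v assume "v \<in> F"
    then consider "v = V" | t where "t \<in> T" "v = w t" using D(1) by (auto simp: F_def)
    thus "dist v V < e \<and> (\<exists>q\<ge>1. \<forall>n. apply_bcontfun v (n + int q) = v n)"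
    proof cases
      case 1
      have "\<exists>q\<ge>1. \<forall>n. apply_bcontfun V (n + int q) = V n" using p per by blast
      thus ?thesis using 1 \<open>e > 0\<close> by simp
    next
      case 2
      thus ?thesis using w(1)[of t] w(2)[of t] by simp
    qed
  qed
  ultimately show ?thesis by (intro exI[of _ F] exI[of _ g0] conjI g0)
qed

lemma finite_gap_family:
  fixes V :: "int \<Rightarrow>\<^sub>C real"
  assumes per: "\<And>n. V (n + int p) = V n" and p: "p \<ge> 1" and "e > 0" and J: "J > 0"
  obtains F g where "finite F" "g > 0"
    "\<And>w. w \<in> F \<Longrightarrow> dist w V < e \<and> (\<exists>q\<ge>1. \<forall>n. apply_bcontfun w (n + int q) = w n)"
    "\<And>c k E. 1 / J \<le> \<bar>c\<bar> \<Longrightarrow> \<bar>c\<bar> \<le> J \<Longrightarrow> 1 \<le> k \<Longrightarrow> k \<le> K \<Longrightarrow> \<exists>w\<in>F. gap (c *\<^sub>R repeat w k) E g"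
proof -
  define P where "P k F g \<longleftrightarrow> finite F \<and> g > 0 \<and>
    (\<forall>w\<in>F. dist w V < e \<and> (\<exists>q\<ge>1. \<forall>n. apply_bcontfun w (n + int q) = w n)) \<and>
    (\<forall>c E. 1 / J \<le> \<bar>c\<bar> \<longrightarrow> \<bar>c\<bar> \<le> J \<longrightarrow> (\<exists>w\<in>F. gap (c *\<^sub>R repeat w k) E g))" for k F and g :: real
  have "\<exists>F g. P k F g" if "k \<ge> 1" for k
    unfolding P_def by (rule finite_gap_family_fixed[of V p e J k, OF per p \<open>e > 0\<close> J that])
  then obtain F g where "\<And>k. k \<ge> 1 \<Longrightarrow> P k (F k) (g k)" by metis
  hence F: "\<And>k. k \<ge> 1 \<Longrightarrow> finite (F k)" "\<And>k. k \<ge> 1 \<Longrightarrow> g k > 0"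
    "\<And>k w. k \<ge> 1 \<Longrightarrow> w \<in> F k \<Longrightarrow> dist w V < e \<and> (\<exists>q\<ge>1. \<forall>n. apply_bcontfun w (n + int q) = w n)"
    "\<And>k c E. k \<ge> 1 \<Longrightarrow> 1 / J \<le> \<bar>c\<bar> \<Longrightarrow> \<bar>c\<bar> \<le> J \<Longrightarrow> \<exists>w\<in>F k. gap (c *\<^sub>R repeat w k) E (g k)"
    unfolding P_def by blast+
  define g0 where "g0 = Min (insert 1 (g ` {1..K}))"
  have g0: "g0 > 0" using F(2) by (auto simp: g0_def)
  have g0': "g0 \<le> g k" if "1 \<le> k" "k \<le> K" for k
    unfolding g0_def by (rule Min_le) (use that in auto)
  show ?thesis
  proof (rule that[of "\<Union>k\<in>{1..K}. F k" g0])
    show "\<exists>w\<in>\<Union>k\<in>{1..K}. F k. gap (c *\<^sub>R repeat w k) E g0"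
      if ck: "1 / J \<le> \<bar>c\<bar>" "\<bar>c\<bar> \<le> J" "1 \<le> k" "k \<le> K" for c k E
    proof -
      obtain w where w: "w \<in> F k" "gap (c *\<^sub>R repeat w k) E (g k)" using F(4)[OF ck(3,1,2)] by blast
      have "gap (c *\<^sub>R repeat w k) E g0" by (rule gap_mono[OF w(2) g0'[OF ck(3,4)]])
      thus ?thesis using w(1) ck by auto
    qed
    show "finite (\<Union>k\<in>{1..K}. F k)" using F(1) by simp
    show "dist w V < e \<and> (\<exists>q\<ge>1. \<forall>n. apply_bcontfun w (n + int q) = w n)"
      if "w \<in> (\<Union>k\<in>{1..K}. F k)" for w
    proof -
      from that obtain k where "k \<ge> 1" "w \<in> F k" by auto
      thus ?thesis by (rule F(3))
    qed
  qed (rule g0)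
qed

lemma common_period:
  assumes "finite F" "\<And>w. w \<in> F \<Longrightarrow> \<exists>q\<ge>1. \<forall>n. apply_bcontfun w (n + int q) = w n"
  obtains q where "q \<ge> 1" "\<And>w n. w \<in> F \<Longrightarrow> apply_bcontfun w (n + int q) = w n"
proof -
  from assms have "\<exists>q\<ge>1. \<forall>w\<in>F. \<forall>n. apply_bcontfun w (n + int q) = w n"
  proof (induction F)
    case empty
    show ?case by (rule exI[of _ 1]) simp
  next
    case (insert w F)
    have "\<exists>q\<ge>1. \<forall>w\<in>F. \<forall>n. apply_bcontfun w (n + int q) = w n"
      by (rule insert.IH) (rule insert.prems, simp)
    then obtain q where q: "q \<ge> 1" "\<And>v n. v \<in> F \<Longrightarrow> apply_bcontfun v (n + int q) = v n" by blast
    obtain r where r: "r \<ge> 1" "\<And>n. apply_bcontfun w (n + int r) = w n" using insert.prems[of w] by blast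
    have "apply_bcontfun v (n + int (q * r)) = v n" if "v \<in> insert w F" for v n
    proof (cases "v = w")
      case True
      thus ?thesis using periodic_add_mult[of w r n "int q", OF r(2)] by (simp add: mult.commute)
    next
      case False
      hence "v \<in> F" using that by simp
      thus ?thesis using periodic_add_mult[of v q n "int r", OF q(2)] by simp
    qed
    moreover have "q * r \<ge> 1" using q(1) r(1) by (metis mult_le_mono nat_mult_1)
    ultimately show ?case by blast
  qed
  thus ?thesis using that by blast
qed

section \<open>Counting approximate eigenvalues of a finite block\<close>

text \<open>With \<open>y\<close> the sum of the \<open>c i *\<^sub>R x i\<close>, the sum
  \<open>B\<close> of squares is the inner product of \<open>y\<close> and \<open>e\<close>. Hence
  \<open>B^2\<close> is at most \<open>(norm y)^2\<close>, and near orthogonality bounds this by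
  \<open>(1 + card I * \<kappa>) * B\<close>.\<close>

lemma almost_orthonormal_bessel:
  fixes x :: "'i \<Rightarrow> 'a :: real_inner"
  assumes "finite I" "\<And>i. i \<in> I \<Longrightarrow> norm (x i) = 1" "\<And>i j. i \<in> I \<Longrightarrow> j \<in> I \<Longrightarrow> i \<noteq> j \<Longrightarrow> \<bar>x i \<bullet> x j\<bar> \<le> \<kappa>"
    and "\<kappa> \<ge> 0" "norm e = 1"
  shows "(\<Sum>i\<in>I. (x i \<bullet> e)\<^sup>2) \<le> 1 + real (card I) * \<kappa>"
proof -
  define c where "c i = x i \<bullet> e" for i
  define B where "B = (\<Sum>i\<in>I. (c i)\<^sup>2)"
  define y where "y = (\<Sum>i\<in>I. c i *\<^sub>R x i)"
  have B0: "B \<ge> 0" by (simp add: B_def sum_nonneg)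
  have "B = y \<bullet> e" by (simp add: B_def y_def inner_sum_left c_def power2_eq_square)
  also have "\<dots> \<le> norm y * norm e" by (rule norm_cauchy_schwarz)
  finally have "B \<le> norm y" using assms(5) by simp
  hence B2: "B\<^sup>2 \<le> (norm y)\<^sup>2" using B0 by (rule power_mono)
  have "(norm y)\<^sup>2 = (\<Sum>i\<in>I. \<Sum>j\<in>I. c i * c j * (x i \<bullet> x j))"
    unfolding power2_norm_eq_inner y_def inner_sum_left
    by (intro sum.cong refl) (simp add: inner_sum_right mult.assoc mult.left_commute sum_distrib_left)
  also have "\<dots> \<le> (\<Sum>i\<in>I. \<Sum>j\<in>I. (if i = j then (c i)\<^sup>2 else 0) + \<kappa> / 2 * ((c i)\<^sup>2 + (c j)\<^sup>2))"
  proof (intro sum_mono)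
    fix i j assume ij: "i \<in> I" "j \<in> I"
    have nn: "0 \<le> \<kappa> / 2 * ((c i)\<^sup>2 + (c j)\<^sup>2)" using assms(4) by simp
    show "c i * c j * (x i \<bullet> x j) \<le> (if i = j then (c i)\<^sup>2 else 0) + \<kappa> / 2 * ((c i)\<^sup>2 + (c j)\<^sup>2)"
    proof (cases "i = j")
      case True
      have "x i \<bullet> x i = 1" using assms(2)[OF ij(1)] by (simp add: norm_eq_1)
      thus ?thesis using True nn by (simp add: power2_eq_square)
    next
      case False
      have am: "\<bar>c i * c j\<bar> \<le> ((c i)\<^sup>2 + (c j)\<^sup>2) / 2"
        using sum_squares_bound[of "\<bar>c i\<bar>" "\<bar>c j\<bar>"] by (simp add: abs_mult)
      have "c i * c j * (x i \<bullet> x j) \<le> \<bar>c i * c j\<bar> * \<bar>x i \<bullet> x j\<bar>" by (metis abs_ge_self abs_mult)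
      also have "\<dots> \<le> ((c i)\<^sup>2 + (c j)\<^sup>2) / 2 * \<kappa>"
        by (intro mult_mono am assms(3)[OF ij False]) auto
      finally show ?thesis using False by (simp add: mult.commute)
    qed
  qed
  also have "\<dots> = B + (\<Sum>i\<in>I. \<Sum>j\<in>I. \<kappa> / 2 * ((c i)\<^sup>2 + (c j)\<^sup>2))"
    using assms(1) by (simp add: sum.distrib B_def)
  also have "(\<Sum>i\<in>I. \<Sum>j\<in>I. \<kappa> / 2 * ((c i)\<^sup>2 + (c j)\<^sup>2)) = \<kappa> / 2 * (real (card I) * B + real (card I) * B)"
    unfolding sum_distrib_left[symmetric] by (simp add: sum.distrib B_def sum_distrib_left)
  finally have "B * B \<le> (1 + real (card I) * \<kappa>) * B" using B2 by (simp add: power2_eq_square algebra_simps)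
  moreover have "0 \<le> real (card I) * \<kappa>" using assms(4) by simp
  ultimately have "B \<le> 1 + real (card I) * \<kappa>"
    using B0 by (cases "B = 0") (auto simp: mult_le_cancel_right)
  thus ?thesis by (simp add: B_def c_def)
qed

text \<open>For finite \<open>D\<close> these are the approximate eigenvalues, with error
  \<open>\<delta>\<close>, of the compression of the operator to \<open>D\<close>, a finite
  symmetric matrix. Vectors supported in \<open>D\<close> replace the matrix, so that estimates in
  \<open>ell2\<close> apply directly.\<close>

definition block_approx :: "(int \<Rightarrow>\<^sub>C real) \<Rightarrow> int set \<Rightarrow> real \<Rightarrow> real set" where
  "block_approx W D \<delta> = {E. \<exists>x. x \<noteq> 0 \<and> (\<forall>n. n \<notin> D \<longrightarrow> apply_ell2 x n = 0) \<and>
     norm (cutoff D (shifted W (complex_of_real E) x)) \<le> \<delta> * norm x}"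

lemma inner_cutoff:
  assumes "finite D" "\<And>n. n \<notin> D \<Longrightarrow> apply_ell2 y n = 0"
  shows "x \<bullet> y = cutoff D x \<bullet> y"
proof -
  have "y \<bullet> x = (\<Sum>n\<in>D. apply_ell2 y n \<bullet> x n)" using assms by (rule inner_finite_support)
  also have "\<dots> = y \<bullet> cutoff D x" 
    by (subst inner_finite_support[OF assms]) (use assms(1) in \<open>auto simp: cutoff_apply intro!: sum.cong\<close>)
  finally show ?thesis by (simp add: inner_commute)
qed

lemma norm_basis: "norm (cutoff {n} (\<lambda>_. z)) = norm z"
  by (rule power2_eq_imp_eq) (subst norm_sq_finite_support[of "{n}"], auto simp: cutoff_apply)

lemma inner_basis: "x \<bullet> cutoff {n} (\<lambda>_. z) = apply_ell2 x n \<bullet> z"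
proof -
  have "cutoff {n} (\<lambda>_. z) \<bullet> x = (\<Sum>m\<in>{n}. apply_ell2 (cutoff {n} (\<lambda>_. z)) m \<bullet> x m)"
    by (rule inner_finite_support) (auto simp: cutoff_apply)
  thus ?thesis by (simp add: cutoff_apply inner_commute)
qed

text \<open>Symmetry bounds \<open>(E - E') * (x E \<bullet> x E')\<close> by
  \<open>2 * \<delta>\<close>, so vectors for separated energies are almost orthogonal. The inner
  product is real, so each site contributes the two unit vectors with entries 1 and
  \<open>\<i>\<close>. The hypothesis on \<open>s\<close> makes the Bessel constant 3/2, so the
  total mass is at most 3 per site.\<close>

lemma block_approx_separated:
  assumes D: "finite D" and T: "finite T" "T \<subseteq> block_approx W D \<delta>"
    and sep: "\<And>E E'. E \<in> T \<Longrightarrow> E' \<in> T \<Longrightarrow> E \<noteq> E' \<Longrightarrow> \<bar>E - E'\<bar> \<ge> s"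
    and s: "s > 0" "\<delta> \<ge> 0" "s \<ge> 4 * \<delta> * (3 * real (card D) + 1)"
  shows "card T \<le> 3 * card D"
proof (rule ccontr)
  assume "\<not> ?thesis"
  then obtain I where I: "I \<subseteq> T" "card I = 3 * card D + 1" "finite I"
    using obtain_subset_with_card_n[of "3 * card D + 1" T] by auto
  define N where "N = 3 * real (card D) + 1"
  have N: "N \<ge> 1" "real (card I) = N" using I by (simp_all add: N_def)
  have "\<exists>x. norm x = 1 \<and> (\<forall>n. n \<notin> D \<longrightarrow> apply_ell2 x n = 0) \<and>
     norm (cutoff D (shifted W (complex_of_real E) x)) \<le> \<delta>" if "E \<in> I" for E
  proof -
    have "E \<in> block_approx W D \<delta>" using that I T by auto
    then obtain x where x: "x \<noteq> 0" "\<And>n. n \<notin> D \<Longrightarrow> apply_ell2 x n = 0"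
      "norm (cutoff D (shifted W (complex_of_real E) x)) \<le> \<delta> * norm x" by (auto simp: block_approx_def)
    define y where "y = (1 / norm x) *\<^sub>R x"
    have "cutoff D (shifted W (complex_of_real E) y) = (1 / norm x) *\<^sub>R cutoff D (shifted W (complex_of_real E) x)"
      by (rule ell2_eqI) (use D in \<open>simp add: y_def cutoff_apply blinfun.scaleR_right scaleR_ell2.rep_eq\<close>)
    hence "norm (cutoff D (shifted W (complex_of_real E) y)) \<le> \<delta>"
      using x(1,3) by (simp add: field_simps)
    moreover have "norm y = 1" using x(1) by (simp add: y_def)
    moreover have "\<forall>n. n \<notin> D \<longrightarrow> apply_ell2 y n = 0" using x(2) by (simp add: y_def scaleR_ell2.rep_eq)
    ultimately show ?thesis by blast
  qed
  then obtain x where x: "\<And>E. E \<in> I \<Longrightarrow> norm (x E) = 1" "\<And>E n. E \<in> I \<Longrightarrow> n \<notin> D \<Longrightarrow> apply_ell2 (x E) n = 0"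
     "\<And>E. E \<in> I \<Longrightarrow> norm (cutoff D (shifted W (complex_of_real E) (x E))) \<le> \<delta>"
    by metis
  have res: "\<bar>shifted W (complex_of_real E) (x E) \<bullet> x E'\<bar> \<le> \<delta>" if "E \<in> I" "E' \<in> I" for E E'
  proof -
    have "shifted W (complex_of_real E) (x E) \<bullet> x E' = cutoff D (shifted W (complex_of_real E) (x E)) \<bullet> x E'"
      by (rule inner_cutoff[OF D x(2)[OF that(2)]])
    also have "\<bar>\<dots>\<bar> \<le> norm (cutoff D (shifted W (complex_of_real E) (x E))) * norm (x E')"
      by (rule Cauchy_Schwarz_ineq2)
    also have "\<dots> \<le> \<delta>" using x(1)[OF that(2)] x(3)[OF that(1)] by simp
    finally show ?thesis .
  qed
  have orth: "\<bar>x E \<bullet> x E'\<bar> \<le> 1 / (2 * N)" if E: "E \<in> I" "E' \<in> I" "E \<noteq> E'" for E E'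
  proof -
    have "shifted W (complex_of_real E') (x E') = shifted W (complex_of_real E) (x E') + (E - E') *\<^sub>R x E'"
      by (rule ell2_eqI) (simp add: shifted_apply plus_ell2.rep_eq minus_ell2.rep_eq scaleR_ell2.rep_eq scaleR_conv_of_real algebra_simps)
    hence "(E - E') * (x E \<bullet> x E') = x E \<bullet> shifted W (complex_of_real E') (x E') - x E \<bullet> shifted W (complex_of_real E) (x E')"
      by (simp add: inner_add_right)
    also have "\<dots> = shifted W (complex_of_real E') (x E') \<bullet> x E - shifted W (complex_of_real E) (x E) \<bullet> x E'"
      by (simp only: inner_shifted[of W E "x E" "x E'"]
          inner_commute[of "x E" "shifted W (complex_of_real E') (x E')"])
    finally have "\<bar>E - E'\<bar> * \<bar>x E \<bullet> x E'\<bar> \<le> 2 * \<delta>"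
      using res[OF E(2,1)] res[OF E(1,2)] by (simp flip: abs_mult)
    moreover have "s * \<bar>x E \<bullet> x E'\<bar> \<le> \<bar>E - E'\<bar> * \<bar>x E \<bullet> x E'\<bar>"
      using sep[of E E'] E I by (intro mult_right_mono) auto
    ultimately have "s * \<bar>x E \<bullet> x E'\<bar> \<le> 2 * \<delta>" by simp
    moreover have "2 * \<delta> \<le> s * (1 / (2 * N))" using s(3) N by (simp add: N_def field_simps)
    ultimately have "s * \<bar>x E \<bullet> x E'\<bar> \<le> s * (1 / (2 * N))" by (rule order_trans)
    thus ?thesis using s(1) by (simp only: mult_le_cancel_left_pos)
  qed
  have bessel: "(\<Sum>E\<in>I. (x E \<bullet> e)\<^sup>2) \<le> 3 / 2" if "norm e = 1" for e
  proof -
    have "(\<Sum>E\<in>I. (x E \<bullet> e)\<^sup>2) \<le> 1 + real (card I) * (1 / (2 * N))"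
      by (rule almost_orthonormal_bessel[OF I(3) x(1) orth _ that]) (use N in auto)
    thus ?thesis using N by simp
  qed
  have "N = (\<Sum>E\<in>I. (norm (x E))\<^sup>2)" using x(1) N by simp
  also have "\<dots> = (\<Sum>E\<in>I. \<Sum>n\<in>D. (norm (apply_ell2 (x E) n))\<^sup>2)"
    by (intro sum.cong refl norm_sq_finite_support D x(2))
  also have "\<dots> = (\<Sum>n\<in>D. (\<Sum>E\<in>I. (x E \<bullet> cutoff {n} (\<lambda>_. 1))\<^sup>2) + (\<Sum>E\<in>I. (x E \<bullet> cutoff {n} (\<lambda>_. \<i>))\<^sup>2))"
    by (subst sum.swap) (simp add: inner_basis cmod_power2 sum.distrib inner_complex_def)
  also have "\<dots> \<le> (\<Sum>n\<in>D. 3 / 2 + 3 / 2)"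
    by (intro sum_mono add_mono bessel) (simp_all add: norm_basis)
  also have "\<dots> = N - 1" by (simp add: N_def)
  finally show False by simp
qed

lemma separated_cover:
  fixes S :: "real set"
  assumes "s > 0" and card: "\<And>T. finite T \<Longrightarrow> T \<subseteq> S \<Longrightarrow>
     (\<And>x y. x \<in> T \<Longrightarrow> y \<in> T \<Longrightarrow> x \<noteq> y \<Longrightarrow> \<bar>x - y\<bar> \<ge> s) \<Longrightarrow> card T \<le> K"
  obtains T where "finite T" "card T \<le> K" "S \<subseteq> (\<Union>x\<in>T. ball x s)"
proof -
  define P where "P T \<longleftrightarrow> finite T \<and> T \<subseteq> S \<and> (\<forall>x\<in>T. \<forall>y\<in>T. x \<noteq> y \<longrightarrow> \<bar>x - y\<bar> \<ge> s)" for T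
  have PK: "P T \<Longrightarrow> card T \<le> K" for T using card unfolding P_def by simp
  have "P {}" by (simp add: P_def)
  then obtain T where T: "P T" "\<And>T'. P T' \<Longrightarrow> card T' \<le> card T"
    using ex_has_greatest_nat[of P "{}" card "Suc K"] PK by (metis le_imp_less_Suc)
  have "x \<in> (\<Union>y\<in>T. ball y s)" if "x \<in> S" for x
  proof (rule ccontr)
    assume "x \<notin> (\<Union>y\<in>T. ball y s)"
    hence far: "\<And>y. y \<in> T \<Longrightarrow> \<bar>x - y\<bar> \<ge> s" by (auto simp: dist_real_def abs_minus_commute not_less)
    hence "x \<notin> T" using assms(1) by fastforce
    moreover have "P (insert x T)"
      using T(1) that far unfolding P_def by (auto simp: abs_minus_commute)
    ultimately show False using T(1) T(2)[of "insert x T"] by (simp add: P_def)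
  qed
  hence "S \<subseteq> (\<Union>y\<in>T. ball y s)" by blast
  moreover have "finite T" using T(1) by (simp add: P_def)
  ultimately show ?thesis using that[of T] PK[OF T(1)] by blast
qed

lemma block_approx_cover:
  assumes "finite D" "s > 0" "\<delta> \<ge> 0" "s \<ge> 4 * \<delta> * (3 * real (card D) + 1)"
  obtains T where "finite T" "card T \<le> 3 * card D" "block_approx W D \<delta> \<subseteq> (\<Union>x\<in>T. ball x s)"
proof (rule separated_cover[of s "block_approx W D \<delta>" "3 * card D"])
  fix T assume T: "finite T" "T \<subseteq> block_approx W D \<delta>"
    "\<And>x y. x \<in> T \<Longrightarrow> y \<in> T \<Longrightarrow> x \<noteq> y \<Longrightarrow> \<bar>x - y\<bar> \<ge> s"
  show "card T \<le> 3 * card D" by (rule block_approx_separated[OF assms(1) T assms(2-4)])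
qed (use assms that in blast)+

section \<open>Decay of solutions across a gap\<close>

lemma sum_symmetric_interval:
  fixes v :: "int \<Rightarrow> real"
  shows "(\<Sum>n\<in>{c - int (Suc r)..<c + int (Suc r)}. v n)
    = v (c - int r - 1) + v (c + int r) + (\<Sum>n\<in>{c - int r..<c + int r}. v n)"
proof -
  have "{c - int (Suc r)..<c + int (Suc r)} = insert (c - int r - 1) (insert (c + int r) {c - int r..<c + int r})"
    by auto
  thus ?thesis by simp
qed

text \<open>Let \<open>S r\<close> be the mass of \<open>u\<close> within \<open>r\<close> of
  \<open>c\<close>. The gap inequality of \<open>\<omega>\<close>, applied to a truncation of
  \<open>u\<close>, bounds \<open>g^2 * S (r + 1)\<close> by the mass next to the cuts, which is
  exactly \<open>S (r + 2) - S r\<close>. So each widening by 2 multiplies the mass by at least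
  \<open>1 + g^2\<close>, and \<open>u\<close> is small in the middle of a gapped window.\<close>

lemma growth_across_gap:
  fixes W \<omega> :: "int \<Rightarrow>\<^sub>C real"
  assumes u: "\<And>n. u (n - 1) + u (n + 1) + (complex_of_real (W n) - complex_of_real E) * u n = 0"
    and gap: "gap \<omega> E g" "g > 0"
    and eq: "\<And>n. c - int (2 * t) \<le> n \<Longrightarrow> n < c + int (2 * t) \<Longrightarrow> W n = \<omega> n"
  shows "(1 + g\<^sup>2) ^ t * ((norm (u (c - 1)))\<^sup>2 + (norm (u c))\<^sup>2)
    \<le> (\<Sum>n\<in>{c - int (2 * t + 1)..<c + int (2 * t + 1)}. (norm (u n))\<^sup>2)"
proof -
  define v where "v n = (norm (u n))\<^sup>2" for n
  define S where "S r = (\<Sum>n\<in>{c - int r..<c + int r}. v n)" for r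
  have v0: "v n \<ge> 0" for n by (simp add: v_def)
  have S_Suc: "S (Suc r) = v (c - int r - 1) + v (c + int r) + S r" for r
    unfolding S_def by (rule sum_symmetric_interval)
  have step: "g\<^sup>2 * S (Suc r) \<le> S (Suc (Suc r)) - S r" if "Suc r \<le> 2 * t" for r
  proof -
    let ?x = "cutoff {c - int (Suc r)..<c + int (Suc r)} u"
    have "(g * norm ?x)\<^sup>2 \<le> (norm (shifted \<omega> (complex_of_real E) ?x))\<^sup>2"
      using gap unfolding gap_def by (intro power_mono) auto
    also have "\<dots> = v (c - int (Suc r) - 1) + v (c - int (Suc r)) + v (c + int (Suc r) - 1) + v (c + int (Suc r))"
      unfolding v_def
    proof (rule norm_shifted_cutoff)
      fix n assume "c - int (Suc r) \<le> n" "n < c + int (Suc r)"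
      hence "W n = \<omega> n" using that by (intro eq) linarith+
      thus "u (n - 1) + u (n + 1) + (complex_of_real (\<omega> n) - complex_of_real E) * u n = 0" using u[of n] by simp
    qed simp
    also have "\<dots> = S (Suc (Suc r)) - S r"
      using S_Suc[of "Suc r"] S_Suc[of r] by (simp add: algebra_simps)
    also have "(g * norm ?x)\<^sup>2 = g\<^sup>2 * S (Suc r)"
      unfolding power_mult_distrib norm_cutoff S_def v_def ..
    finally show ?thesis .
  qed
  have mono: "S r \<le> S (Suc r)" for r using S_Suc[of r] v0[of "c - int r - 1"] v0[of "c + int r"] by linarith
  have "i \<le> t \<Longrightarrow> (1 + g\<^sup>2) ^ i * S 1 \<le> S (2 * i + 1)" for i
  proof (induction i)
    case (Suc i)
    have "(1 + g\<^sup>2) ^ Suc i * S 1 \<le> (1 + g\<^sup>2) * S (2 * i + 1)"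
      using Suc by (simp add: mult.assoc mult_left_mono)
    also have "\<dots> \<le> S (2 * i + 1) + g\<^sup>2 * S (Suc (2 * i + 1))"
      using mult_left_mono[OF mono[of "2 * i + 1"], of "g\<^sup>2"] by (simp add: algebra_simps)
    also have "\<dots> \<le> S (Suc (Suc (2 * i + 1)))" using step[of "2 * i + 1"] Suc.prems by simp
    finally show ?case by simp
  qed simp
  from this[of t] have "(1 + g\<^sup>2) ^ t * S 1 \<le> S (2 * t + 1)" by simp
  moreover have "S 1 = v (c - 1) + v c" using S_Suc[of 0] by (simp add: S_def)
  ultimately show ?thesis by (simp add: S_def v_def)
qed

lemma periodic_sum:
  fixes v :: "int \<Rightarrow> real"
  assumes "\<And>n. v (n + int Q) = v n"
  shows "(\<Sum>n\<in>{a..<a + int Q}. v n) = (\<Sum>n\<in>{b..<b + int Q}. v n)"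
proof -
  define f where "f a = (\<Sum>n\<in>{a..<a + int Q}. v n)" for a
  have "f (a + int 1) = f a" for a
  proof (cases "Q = 0")
    case False
    have "{a..<a + int Q} = insert a {a + 1..<a + int Q}" "{a + 1..<a + 1 + int Q} = insert (a + int Q) {a + 1..<a + int Q}"
      using False by auto
    thus ?thesis using assms[of a] by (simp add: f_def)
  qed (simp add: f_def)
  from periodic_add_mult[of f 1, OF this, of b "a - b"] show ?thesis by (simp add: f_def)
qed

text \<open>Here \<open>c\<close> is the middle of the gapped window, and the block runs from
  \<open>c\<close> to its translate by one period. By quasi-periodicity the residual at both ends
  has the size of \<open>u\<close> near \<open>c\<close>, exponentially small relative to the mass
  of a period. The bound \<open>4 * t + 2 \<le> Q\<close> fits the window into one period.\<close>

lemma spec_in_block_approx: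
  fixes W \<omega> :: "int \<Rightarrow>\<^sub>C real"
  assumes per: "\<And>n. W (n + int Q) = W n" and E: "E \<in> spec W" and gap: "gap \<omega> E g" "g > 0"
    and eq: "\<And>n. c - int (2 * t) \<le> n \<Longrightarrow> n < c + int (2 * t) \<Longrightarrow> W n = \<omega> n" and Q: "4 * t + 2 \<le> Q"
  shows "E \<in> block_approx W {c..<c + int Q} ((1 / sqrt (1 + g\<^sup>2)) ^ t)"
proof -
  have Q1: "Q \<ge> 1" using Q by simp
  have "\<bar>mtr (tmat E W 0 Q)\<bar> \<le> 2" using periodic_spec_iff[of W Q E, OF per Q1] E by simp
  then obtain u \<mu> n0 where u: "\<And>n. u (n - 1) + u (n + 1) + (complex_of_real (W n) - complex_of_real E) * u n = 0"
    and qp: "\<And>n. u (n + int Q) = \<mu> * u n" "norm \<mu> = 1" and n0: "u n0 \<noteq> 0"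
    using floquet_solution[of W Q "complex_of_real E", OF per Q1 mtr_tmat_of_real] by metis
  define v where "v n = (norm (u n))\<^sup>2" for n
  have vper: "v (n + int Q) = v n" for n unfolding v_def by (simp only: quasi_periodic_norm[of u Q \<mu>, OF qp])
  define N where "N = (\<Sum>n\<in>{c..<c + int Q}. v n)"
  let ?D = "{c..<c + int Q}"
  define x where "x = cutoff ?D u"
  have nx: "(norm x)\<^sup>2 = N" unfolding x_def norm_cutoff N_def v_def ..
  have "0 < v n0" using n0 by (simp add: v_def)
  also have "v n0 \<le> (\<Sum>n\<in>{n0..<n0 + int Q}. v n)"
    by (rule member_le_sum) (use Q in \<open>auto simp: v_def\<close>)
  also have "\<dots> = N" unfolding N_def by (rule periodic_sum[of v Q, OF vper])
  finally have N: "N > 0" .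
  hence x0: "x \<noteq> 0" using nx by auto
  let ?r = "cutoff ?D (shifted W (complex_of_real E) x)"
  have r: "apply_ell2 ?r n = (if n \<in> ?D then - (if n = c then u (c - 1) else 0) - (if n = c + int Q - 1 then u (c + int Q) else 0) else 0)" for n
    unfolding x_def using shifted_cutoff[of c "c + int Q" u W "complex_of_real E" n] Q1 u by (simp add: cutoff_apply)
  have "(norm ?r)\<^sup>2 = (\<Sum>n\<in>{c, c + int Q - 1}. (norm (apply_ell2 ?r n))\<^sup>2)"
    by (rule norm_sq_finite_support) (auto simp: r)
  also have "\<dots> = v (c - 1) + v (c + int Q)" using Q by (simp add: r v_def)
  also have "\<dots> = v (c - 1) + v c" by (simp add: vper)
  finally have nr: "(norm ?r)\<^sup>2 = v (c - 1) + v c" .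
  have "(1 + g\<^sup>2) ^ t * (norm ?r)\<^sup>2 \<le> (\<Sum>n\<in>{c - int (2 * t + 1)..<c + int (2 * t + 1)}. v n)"
    unfolding nr v_def by (rule growth_across_gap[OF u gap eq])
  also have "\<dots> \<le> (\<Sum>n\<in>{c - int (2 * t + 1)..<c - int (2 * t + 1) + int Q}. v n)"
    by (rule sum_mono2) (use Q in \<open>auto simp: v_def\<close>)
  also have "\<dots> = N" unfolding N_def by (rule periodic_sum[of v Q, OF vper])
  finally have "(1 + g\<^sup>2) ^ t * (norm ?r)\<^sup>2 \<le> (norm x)\<^sup>2" by (simp only: nx)
  moreover have pos: "1 + g\<^sup>2 > 0" by (simp add: add_pos_nonneg)
  ultimately have "(norm ?r)\<^sup>2 \<le> (norm x)\<^sup>2 / (1 + g\<^sup>2) ^ t" by (simp add: field_simps)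
  also have "\<dots> = ((1 / sqrt (1 + g\<^sup>2)) ^ t * norm x)\<^sup>2"
  proof -
    have "((1 / sqrt (1 + g\<^sup>2)) ^ t)\<^sup>2 = ((1 / sqrt (1 + g\<^sup>2))\<^sup>2) ^ t"
      by (simp only: power_mult[symmetric] mult.commute)
    also have "\<dots> = 1 / (1 + g\<^sup>2) ^ t" using pos by (simp add: power_divide)
    finally show ?thesis by (simp only: power_mult_distrib) simp
  qed
  finally have "norm ?r \<le> (1 / sqrt (1 + g\<^sup>2)) ^ t * norm x"
    by (rule power2_le_imp_le) simp
  moreover have "\<forall>n. n \<notin> ?D \<longrightarrow> apply_ell2 x n = 0" by (simp add: x_def cutoff_apply)
  ultimately show ?thesis using x0 unfolding block_approx_def by blast
qed

section \<open>Periodic approximants with thin spectra\<close>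

text \<open>The scale \<open>s\<close> has three roles: exponent, bound for the sum and, if
  \<open>s < 1\<close> and \<open>T\<close> is nonempty, bound for the diameter
  \<open>2 * r\<close>. Finite covers by open intervals are used because, for a compact spectrum,
  they survive small perturbations.\<close>

definition thinly_covered :: "real \<Rightarrow> real set \<Rightarrow> bool" where
  "thinly_covered s S \<longleftrightarrow> (\<exists>T r. finite T \<and> r > 0 \<and> S \<subseteq> (\<Union>x\<in>T. ball x r) \<and>
     real (card T) * (2 * r) powr s < s)"

lemma exponential_beats_polynomial:
  fixes q M A s :: real
  assumes "0 < q" "q < 1" "M > 0" "A > 0" "s > 0"
  obtains t :: nat where
    "M * (A * real (4 * t + 2)) * (2 * (4 * q ^ t * (3 * (A * real (4 * t + 2)) + 1))) powr s < s"
proof -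
  define b where "b = - ln q"
  have b: "b > 0" using assms by (simp add: b_def)
  have q: "q ^ t = exp (- b * real t)" for t :: nat
    using assms(1) by (simp add: b_def exp_of_nat_mult[symmetric] mult.commute powr_def flip: powr_realpow)
  have "((\<lambda>t. M * (A * real (4 * t + 2)) *
      (2 * (4 * exp (- b * real t) * (3 * (A * real (4 * t + 2)) + 1))) powr s) \<longlongrightarrow> 0) at_top"
    using assms(3-5) b by real_asymp
  hence "\<forall>\<^sub>F t in at_top. M * (A * real (4 * t + 2)) *
      (2 * (4 * exp (- b * real t) * (3 * (A * real (4 * t + 2)) + 1))) powr s < s"
    using assms(5) by (rule order_tendstoD)
  then obtain t where "M * (A * real (4 * t + 2)) *
      (2 * (4 * exp (- b * real t) * (3 * (A * real (4 * t + 2)) + 1))) powr s < s"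
    by (auto simp: eventually_at_top_linorder)
  thus ?thesis by (intro that[of t]) (simp only: q)
qed

text \<open>Each stretch yields one block, cut at its middle, and hence one family of intervals.
  Every energy has a gapped stretch, so the union of these \<open>m\<close> families covers the
  spectrum.\<close>

lemma exists_thin_periodic:
  fixes V :: "int \<Rightarrow>\<^sub>C real"
  assumes per: "\<And>n. V (n + int p) = V n" and p: "p \<ge> 1" and "e > 0" and J: "J > 0" and s: "s > 0"
  shows "\<exists>P. (\<exists>q\<ge>1. \<forall>n. apply_bcontfun P (n + int q) = P n) \<and> dist P V < e \<and>
    (\<forall>c k. 1 / J \<le> \<bar>c\<bar> \<longrightarrow> \<bar>c\<bar> \<le> J \<longrightarrow> 1 \<le> k \<longrightarrow> k \<le> K \<longrightarrow> thinly_covered s (spec (c *\<^sub>R repeat P k)))"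
proof -
  obtain F0 g where F0: "finite F0" and g: "g > 0"
    and F0_near: "\<And>w. w \<in> F0 \<Longrightarrow> dist w V < e / 2 \<and> (\<exists>q\<ge>1. \<forall>n. apply_bcontfun w (n + int q) = w n)"
    and F0_gap: "\<And>c k E. 1 / J \<le> \<bar>c\<bar> \<Longrightarrow> \<bar>c\<bar> \<le> J \<Longrightarrow> 1 \<le> k \<Longrightarrow> k \<le> K \<Longrightarrow> \<exists>w\<in>F0. gap (c *\<^sub>R repeat w k) E g"
    using finite_gap_family[of V p "e / 2" J K, OF per p half_gt_zero[OF \<open>e > 0\<close>] J] by metis
  \<comment> \<open>Adding \<open>V\<close> makes the list of stretches nonempty even when
    \<open>F0\<close> is empty, as it may be for \<open>K = 0\<close>.\<close>
  define F where "F = insert V F0"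
  have "\<exists>q\<ge>1. \<forall>n. apply_bcontfun w (n + int q) = w n" if "w \<in> F" for w
  proof (cases "w = V")
    case True
    thus ?thesis using p per by blast
  next
    case False
    thus ?thesis using that F0_near[of w] by (simp add: F_def)
  qed
  moreover have "finite F" using F0 by (simp add: F_def)
  ultimately obtain q where q: "q \<ge> 1" and qper: "\<And>w n. w \<in> F \<Longrightarrow> apply_bcontfun w (n + int q) = w n"
    using common_period[of F] by metis
  have near: "dist w V < e / 2" if "w \<in> F" for w
    using that F0_near[of w] \<open>e > 0\<close> by (auto simp: F_def)
  obtain ws where ws: "set ws = F" using finite_list[OF \<open>finite F\<close>] by blast
  define m where "m = length ws"
  have m: "m \<ge> 1" using ws by (auto simp: m_def F_def Suc_le_eq)
  \<comment> \<open>Independent of \<open>t\<close>, and such that all periods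
    \<open>m * B * k\<close> below are at most \<open>A * (4 * t + 2)\<close>.\<close>
  define A where "A = real (m * q * (K + 1))"
  define \<rho> where "\<rho> = 1 / sqrt (1 + g\<^sup>2)"
  have "1 < sqrt (1 + g\<^sup>2)" using g by simp
  moreover from this have "0 < sqrt (1 + g\<^sup>2)" by linarith
  ultimately have rho: "0 < \<rho>" "\<rho> < 1"
    unfolding \<rho>_def by (simp_all only: zero_less_divide_1_iff divide_less_eq_1_pos)
  have "m * q * (K + 1) > 0" using m q by simp
  hence A: "A > 0" unfolding A_def by (simp only: of_nat_0_less_iff)
  obtain t where t: "3 * real m * (A * real (4 * t + 2)) *
      (2 * (4 * \<rho> ^ t * (3 * (A * real (4 * t + 2)) + 1))) powr s < s"
    using exponential_beats_polynomial[OF rho _ A s, of "3 * real m"] m by auto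
  define B where "B = (4 * t + 2) * q"
  have B2: "4 * t + 2 \<le> B" unfolding B_def using mult_le_mono2[OF q, of "4 * t + 2"] by simp
  hence B: "B \<ge> 1" "4 * t + 2 \<le> B" by linarith+
  \<comment> \<open>Each potential in the list is evaluated at \<open>x\<close> itself, not
    restarted at the beginning of its stretch, so \<open>P\<close> agrees with it there.\<close>
  define f where "f x = apply_bcontfun (ws ! nat ((x div int B) mod int m)) x" for x
  have idx: "ws ! nat ((x div int B) mod int m) \<in> F" for x
  proof -
    have "nat ((x div int B) mod int m) < m"
      using m pos_mod_bound[of "int m" "x div int B"] pos_mod_sign[of "int m" "x div int B"] by linarith
    thus ?thesis unfolding ws[symmetric] m_def by (rule nth_mem)
  qed
  have fV: "\<bar>f x - V x\<bar> \<le> e / 2" for x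
    using near[OF idx[of x]] dist_bounded[of "ws ! nat ((x div int B) mod int m)" x V]
    by (simp add: f_def dist_real_def)
  define P where "P = Bcontfun f"
  have Pf: "apply_bcontfun P x = f x" for x
    unfolding P_def
  proof (rule bcontfun_ofI[of f "norm V + e / 2"])
    fix x
    have "\<bar>f x\<bar> \<le> \<bar>V x\<bar> + \<bar>f x - V x\<bar>" by linarith
    thus "\<bar>f x\<bar> \<le> norm V + e / 2" using norm_bounded[of V x] fV[of x] by simp
  qed
  have "dist P V \<le> e / 2"
    by (rule dist_bound) (use fV in \<open>simp add: Pf dist_real_def\<close>)
  hence dist: "dist P V < e" using \<open>e > 0\<close> by linarith
  have Pper: "P (x + int (m * B)) = P x" for x
  proof -
    have "(x + int (m * B)) div int B = x div int B + int m" using B by simp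
    hence "f (x + int (m * B)) = apply_bcontfun (ws ! nat ((x div int B) mod int m)) (x + int q * int (m * (4 * t + 2)))"
      by (simp add: f_def B_def algebra_simps)
    also have "\<dots> = f x"
      unfolding f_def by (rule periodic_add_mult) (rule qper[OF idx])
    finally show ?thesis by (simp only: Pf)
  qed
  have "thinly_covered s (spec (c *\<^sub>R repeat P k))"
    if c: "1 / J \<le> \<bar>c\<bar>" "\<bar>c\<bar> \<le> J" and k: "1 \<le> k" "k \<le> K" for c k
  proof -
    define W where "W = c *\<^sub>R repeat P k"
    define Q where "Q = m * B * k"
    define r where "r = 4 * \<rho> ^ t * (3 * (A * real (4 * t + 2)) + 1)"
    \<comment> \<open>The offset \<open>2 * t + 1\<close> keeps \<open>2 * t\<close> sites on either
      side of the cut inside stretch \<open>i\<close>, whose length after repetition,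
      \<open>B * k\<close>, is at least \<open>4 * t + 2\<close>.\<close>
    define \<gamma> where "\<gamma> i = int (i * (B * k)) + int (2 * t + 1)" for i
    have Wper: "W (n + int Q) = W n" for n
      unfolding W_def Q_def by (rule scaled_repeat_periodic[OF Pper k(1)])
    have QA: "real Q \<le> A * real (4 * t + 2)"
    proof -
      have "Q \<le> m * q * (K + 1) * (4 * t + 2)"
      proof -
        have "(m * q * (4 * t + 2)) * k \<le> (m * q * (4 * t + 2)) * (K + 1)" using k(2) by (intro mult_le_mono2) simp
        thus ?thesis unfolding Q_def B_def by (simp only: ac_simps)
      qed
      thus ?thesis unfolding A_def by (simp only: of_nat_mult[symmetric] of_nat_le_iff)
    qed
    have Q: "4 * t + 2 \<le> Q"
    proof -
      have "B * 1 \<le> B * (m * k)" using m k by (intro mult_le_mono) auto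
      moreover have "Q = B * (m * k)" by (simp only: Q_def ac_simps)
      ultimately show ?thesis using B by linarith
    qed
    have r0: "r > 0" using rho A by (simp add: r_def add_nonneg_pos)
    have "\<exists>T. finite T \<and> card T \<le> 3 * Q \<and> block_approx W {\<gamma> i..<\<gamma> i + int Q} (\<rho> ^ t) \<subseteq> (\<Union>x\<in>T. ball x r)" for i
    proof -
      have cd: "card {\<gamma> i..<\<gamma> i + int Q} = Q" by simp
      have "4 * \<rho> ^ t * (3 * real Q + 1) \<le> r"
        unfolding r_def using QA rho by (intro mult_left_mono) auto
      thus ?thesis
        using block_approx_cover[of "{\<gamma> i..<\<gamma> i + int Q}" r "\<rho> ^ t" W] r0 rho unfolding cd
        by (metis finite_atLeastLessThan_int less_imp_le zero_less_power)
    qed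
    then obtain T where T: "\<And>i. finite (T i)" "\<And>i. card (T i) \<le> 3 * Q"
      "\<And>i. block_approx W {\<gamma> i..<\<gamma> i + int Q} (\<rho> ^ t) \<subseteq> (\<Union>x\<in>T i. ball x r)" by metis
    have cover: "spec W \<subseteq> (\<Union>x\<in>(\<Union>i<m. T i). ball x r)"
    proof
      fix E assume E: "E \<in> spec W"
      obtain w where w: "w \<in> F0" "gap (c *\<^sub>R repeat w k) E g" using F0_gap[OF c k] by blast
      then obtain i where i: "i < m" "ws ! i = w"
        using ws unfolding F_def m_def by (metis insertCI in_set_conv_nth)
      have "E \<in> block_approx W {\<gamma> i..<\<gamma> i + int Q} (\<rho> ^ t)"
        unfolding \<rho>_def
      proof (rule spec_in_block_approx[of W Q E "c *\<^sub>R repeat w k" g "\<gamma> i" t, OF Wper E w(2) g _ Q])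
        fix n assume n: "\<gamma> i - int (2 * t) \<le> n" "n < \<gamma> i + int (2 * t)"
        have "B * 1 \<le> B * k" using k by (intro mult_le_mono) auto
        hence "int (B * k) \<ge> int (4 * t + 2)" using B(2) by linarith
        hence "int (i * (B * k)) \<le> n" "n < int (i * (B * k)) + int (B * k)"
          using n unfolding \<gamma>_def by linarith+
        hence "n div int (B * k) = int i"
          using k B by (intro int_div_pos_eq[where r = "n - int (i * (B * k))"]) auto
        hence "n div (int k * int B) = int i" by (simp add: mult.commute)
        hence "(n div int k) div int B = int i" by (simp only: zdiv_zmult2_eq[OF of_nat_0_le_iff])
        hence "f (n div int k) = w (n div int k)" using i by (simp add: f_def)
        thus "W n = (c *\<^sub>R repeat w k) n"
          by (simp only: W_def scaled_repeat_apply[OF k(1)] Pf)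
      qed
      thus "E \<in> (\<Union>x\<in>(\<Union>i<m. T i). ball x r)" using T(3)[of i] i(1) by blast
    qed
    have "card (\<Union>i<m. T i) \<le> (\<Sum>i<m. card (T i))" by (rule card_UN_le) simp
    also have "\<dots> \<le> (\<Sum>i<m. 3 * Q)" by (intro sum_mono T(2))
    finally have "card (\<Union>i<m. T i) \<le> 3 * m * Q" by simp
    hence "real (card (\<Union>i<m. T i)) \<le> real (3 * m * Q)" by (simp only: of_nat_le_iff)
    also have "\<dots> \<le> 3 * real m * (A * real (4 * t + 2))"
      using mult_left_mono[OF QA, of "3 * real m"] by simp
    finally have "real (card (\<Union>i<m. T i)) * (2 * r) powr s \<le> 3 * real m * (A * real (4 * t + 2)) * (2 * r) powr s"
      by (rule mult_right_mono) simp
    also have "\<dots> < s" using t by (simp only: r_def)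
    finally have "real (card (\<Union>i<m. T i)) * (2 * r) powr s < s" .
    moreover have "finite (\<Union>i<m. T i)" using T(1) by simp
    ultimately show ?thesis unfolding thinly_covered_def W_def[symmetric] using cover r0 by blast
  qed
  moreover have "\<exists>q\<ge>1. \<forall>n. apply_bcontfun P (n + int q) = P n"
  proof (intro exI[of _ "m * B"] conjI allI)
    show "m * B \<ge> 1" using m B(1) by (metis mult_le_mono nat_mult_1)
  qed (rule Pper)
  ultimately show ?thesis using dist by (intro exI[of _ P] conjI allI impI)
qed

section \<open>Thin coverings and Hausdorff dimension\<close>

lemma thin_radius_small:
  fixes r s :: real
  assumes "r > 0" "0 < s" "s < 1" "(2 * r) powr s < s"
  shows "2 * r < s"
proof (rule ccontr)
  assume "\<not> 2 * r < s"
  hence "s powr s \<le> (2 * r) powr s" using assms by (intro powr_mono2) auto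
  moreover have "s powr 1 \<le> s powr s" using assms by (intro powr_mono') auto
  ultimately show False using assms by simp
qed

lemma thin_cover_sum:
  fixes r s s' :: real and N :: nat
  assumes "r > 0" "0 < s" "s < 1" "real N * (2 * r) powr s < s" "s \<le> s'" "N > 0"
  shows "2 * r < s" "real N * (2 * r) powr s' < s"
proof -
  have "(2 * r) powr s \<le> real N * (2 * r) powr s"
    using mult_right_mono[of 1 "real N" "(2 * r) powr s"] assms(6) by simp
  hence "(2 * r) powr s < s" using assms(4) by linarith
  with assms(1-3) show small: "2 * r < s" by (rule thin_radius_small)
  have "(2 * r) powr s' \<le> (2 * r) powr s" using small assms by (intro powr_mono') auto
  hence "real N * (2 * r) powr s' \<le> real N * (2 * r) powr s" by (rule mult_left_mono) simp
  thus "real N * (2 * r) powr s' < s" using assms by linarith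
qed

lemma hausdorff_premeasure_thin:
  fixes S :: "real set"
  assumes "thinly_covered s S" "0 < s" "s < 1" "s \<le> \<sigma>" "s \<le> \<delta>"
  shows "hausdorff_premeasure \<sigma> \<delta> S \<le> ennreal s"
proof -
  obtain T r where T: "finite T" "r > 0" "S \<subseteq> (\<Union>x\<in>T. ball x r)" "real (card T) * (2 * r) powr s < s"
    using assms(1) by (auto simp: thinly_covered_def)
  obtain xs where xs: "set xs = T" "distinct xs" using finite_distinct_list[OF T(1)] by blast
  define U where "U i = (if i < length xs then ball (xs ! i) r else {})" for i
  have len: "length xs = card T" using xs distinct_card by fastforce
  have small: "2 * r < s" "real (length xs) * (2 * r) powr \<sigma> < s" if "length xs > 0"
    using thin_cover_sum[of r s "length xs" \<sigma>] T assms that by (simp_all add: len)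
  have diam: "diameter (U i) = (if i < length xs then 2 * r else 0)" for i
    using T(2) by (simp add: U_def)
  have "S \<subseteq> (\<Union>i. U i)"
  proof
    fix y assume "y \<in> S"
    then obtain x where "x \<in> T" "y \<in> ball x r" using T(3) by blast
    then obtain i where "i < length xs" "y \<in> ball (xs ! i) r" using xs(1) by (metis in_set_conv_nth)
    hence "y \<in> U i" by (simp add: U_def)
    thus "y \<in> (\<Union>i. U i)" by blast
  qed
  moreover have "bounded (U i) \<and> diameter (U i) \<le> \<delta>" for i
  proof (cases "i < length xs")
    case True
    hence "length xs > 0" by linarith
    hence "2 * r < s" by (rule small)
    thus ?thesis using True assms(5) unfolding diam by (simp add: U_def)
  next
    case False
    thus ?thesis using assms(2,5) unfolding diam by (simp add: U_def)
  qed
  ultimately have "hausdorff_premeasure \<sigma> \<delta> S \<le> (\<Sum>i. ennreal (diameter (U i) powr \<sigma>))"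
    unfolding hausdorff_premeasure_def by (intro INF_lower) simp
  also have "\<dots> = (\<Sum>i<length xs. ennreal ((2 * r) powr \<sigma>))"
    by (subst suminf_finite[of "{..<length xs}"]) (auto simp: diam)
  also have "\<dots> = ennreal (real (length xs) * (2 * r) powr \<sigma>)"
    by (simp add: ennreal_mult ennreal_of_nat_eq_real_of_nat)
  also have "\<dots> \<le> ennreal s"
    using small assms(2) by (cases "length xs > 0") (auto intro!: ennreal_leI)
  finally show ?thesis .
qed

lemma hausdorff_dim_zero:
  fixes S :: "real set"
  assumes thin: "\<And>e. e > 0 \<Longrightarrow> \<exists>s>0. s < e \<and> thinly_covered s S"
  shows "hausdorff_dim S = 0"
proof -
  have pre: "hausdorff_premeasure \<sigma> \<delta> S = 0" if "\<sigma> > 0" "\<delta> > 0" for \<sigma> \<delta>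
  proof -
    have "hausdorff_premeasure \<sigma> \<delta> S \<le> 0 + ennreal e" if "e > 0" for e :: real
    proof -
      obtain s where s: "s > 0" "s < min (min \<sigma> \<delta>) (min e 1)" "thinly_covered s S"
      proof -
        have "min (min \<sigma> \<delta>) (min e 1) > 0" using \<open>\<sigma> > 0\<close> \<open>\<delta> > 0\<close> \<open>e > 0\<close> by simp
        from thin[OF this] show thesis using that by blast
      qed
      have "hausdorff_premeasure \<sigma> \<delta> S \<le> ennreal s"
        using s by (intro hausdorff_premeasure_thin) auto
      also have "\<dots> \<le> ennreal e" using s by (intro ennreal_leI) auto
      finally show ?thesis by simp
    qed
    hence "hausdorff_premeasure \<sigma> \<delta> S \<le> 0" by (rule ennreal_le_epsilon)
    thus ?thesis by simp
  qed
  have meas: "hausdorff_measure \<sigma> S = 0" if "\<sigma> > 0" for \<sigma>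
    unfolding hausdorff_measure_def using pre[OF that] by (simp add: SUP_eq_const)
  have le: "hausdorff_dim S \<le> ennreal \<sigma>" if "\<sigma> > 0" for \<sigma>
    unfolding hausdorff_dim_def by (rule INF_lower) (simp add: meas that)
  have "hausdorff_dim S \<le> 0"
  proof (rule ennreal_le_epsilon)
    fix e :: real assume "e > 0"
    thus "hausdorff_dim S \<le> 0 + ennreal e" using le[of e] by simp
  qed
  thus ?thesis by simp
qed

text \<open>With exponent 1 the cover bounds the total length by \<open>s\<close>, which can be
  taken smaller than the length of any interval inside \<open>S\<close>.\<close>

lemma interior_empty_of_thin:
  fixes S :: "real set"
  assumes thin: "\<And>e. e > 0 \<Longrightarrow> \<exists>s>0. s < e \<and> thinly_covered s S"
  shows "interior S = {}"
proof (rule ccontr)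
  assume "interior S \<noteq> {}"
  then obtain a d where d: "d > 0" "ball a d \<subseteq> S" by (auto simp: mem_interior)
  have "min d 1 > 0" using d(1) by simp
  then obtain s where s: "s > 0" "s < min d 1" "thinly_covered s S" using thin by blast
  obtain T r where T: "finite T" "r > 0" "S \<subseteq> (\<Union>x\<in>T. ball x r)" "real (card T) * (2 * r) powr s < s"
    using s(3) by (auto simp: thinly_covered_def)
  have "ball a d \<noteq> {}" using d(1) by simp
  hence "T \<noteq> {}" using d(2) T(3) by auto
  hence card: "card T > 0" using T(1) by (simp add: card_gt_0_iff)
  have sum: "real (card T) * (2 * r) powr 1 < s"
    using thin_cover_sum(2)[of r s "card T" 1] T s card by simp
  have len: "emeasure lborel (ball x \<rho>) = ennreal (2 * \<rho>)" if "\<rho> > 0" for x \<rho> :: real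
    using that by (simp add: ball_eq_greaterThanLessThan)
  have "ennreal (2 * d) \<le> emeasure lborel (\<Union>x\<in>T. ball x r)"
    unfolding len[OF d(1), symmetric, of a] by (rule emeasure_mono) (use d(2) T(3) T(1) in auto)
  also have "\<dots> \<le> (\<Sum>x\<in>T. emeasure lborel (ball x r))"
    by (rule emeasure_subadditive_finite) (use T(1) in auto)
  also have "\<dots> = ennreal (real (card T) * (2 * r))"
    using T(2) by (simp add: len ennreal_mult ennreal_of_nat_eq_real_of_nat)
  finally have "2 * d \<le> real (card T) * (2 * r)" using T(2) d(1) by (simp add: ennreal_le_iff)
  thus False using sum T(2) s d(1) by simp
qed

section \<open>Genericity\<close>

definition thin_perfect :: "real \<Rightarrow> real set \<Rightarrow> bool" where
  "thin_perfect s S \<longleftrightarrow> thinly_covered s S \<and> (\<forall>E\<in>S. \<exists>E'\<in>S. E' \<noteq> E \<and> dist E' E < s)"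

lemma open_thinly_covered_spec: "open {W. thinly_covered s (spec W)}"
  unfolding open_dist
proof (intro ballI)
  fix W assume "W \<in> {W. thinly_covered s (spec W)}"
  then obtain T r where T: "finite T" "r > 0" "spec W \<subseteq> (\<Union>x\<in>T. ball x r)" "real (card T) * (2 * r) powr s < s"
    by (auto simp: thinly_covered_def)
  have "open (\<Union>x\<in>T. ball x r)" by (intro open_UN ballI open_ball)
  then obtain d where d: "d > 0" "(\<Union>x\<in>spec W. ball x d) \<subseteq> (\<Union>x\<in>T. ball x r)"
    using compact_subset_open_imp_ball_epsilon_subset[OF compact_spec _ T(3)] by blast
  have "thinly_covered s (spec W')" if W': "dist W' W < d" for W'
  proof -
    have "spec W' \<subseteq> (\<Union>x\<in>T. ball x r)"
    proof
      fix E' assume "E' \<in> spec W'"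
      then obtain E where "E \<in> spec W" "dist E E' < d" by (rule spec_dist[OF _ W'])
      thus "E' \<in> (\<Union>x\<in>T. ball x r)" using d(2) by (auto simp: subset_iff)
    qed
    thus ?thesis using T unfolding thinly_covered_def by blast
  qed
  thus "\<exists>e>0. \<forall>W'. dist W' W < e \<longrightarrow> W' \<in> {W. thinly_covered s (spec W)}" using d(1) by blast
qed

text \<open>Neighbours must be found for infinitely many points at once, so the complement is shown
  to be closed. Points isolated at scale \<open>s\<close>, for converging potentials, accumulate at
  a spectral point of the limit; a neighbour of that point within \<open>s\<close> would persist as
  a neighbour of the approximating points.\<close>

lemma open_no_isolated_spec: "open {W. \<forall>E\<in>spec W. \<exists>E'\<in>spec W. E' \<noteq> E \<and> dist E' E < s}"
proof -
  define X where "X = {W. \<exists>E\<in>spec W. \<forall>E'\<in>spec W. E' \<noteq> E \<longrightarrow> s \<le> dist E' E}"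
  have "closed X"
    unfolding closed_sequential_limits
  proof (intro allI impI, elim conjE)
    fix W W0 assume W: "\<forall>n. W n \<in> X" "W \<longlonglongrightarrow> W0"
    have "\<exists>E. E \<in> spec (W n) \<and> (\<forall>E'\<in>spec (W n). E' \<noteq> E \<longrightarrow> s \<le> dist E' E)" for n
      using W(1)[rule_format, of n] unfolding X_def by blast
    then obtain E where E: "\<And>n. E n \<in> spec (W n)"
      "\<And>n E'. E' \<in> spec (W n) \<Longrightarrow> E' \<noteq> E n \<Longrightarrow> s \<le> dist E' (E n)"
      by metis
    have "Bseq W" using W(2) convergent_imp_Bseq convergentI by blast
    then obtain K where K: "\<And>n. norm (W n) \<le> K" unfolding Bseq_def by blast
    have "E n \<in> cball 0 (2 + K)" for n using E(1)[of n] spec_bounded[of "W n"] K[of n] by fastforce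
    then obtain E0 f where f: "strict_mono f" "(E \<circ> f) \<longlonglongrightarrow> E0"
      using compact_imp_seq_compact[OF compact_cball, of "0::real" "2 + K"] unfolding seq_compact_def by metis
    have Wf: "(W \<circ> f) \<longlonglongrightarrow> W0" using W(2) f(1) by (rule LIMSEQ_subseq_LIMSEQ)
    have "(\<lambda>n. ((W \<circ> f) n, (E \<circ> f) n)) \<longlonglongrightarrow> (W0, E0)" by (intro tendsto_Pair Wf f(2))
    hence "(W0, E0) \<in> {(W, E). E \<in> spec W}"
      by (rule closed_sequentially[OF closed_spec_pairs, rotated]) (simp add: E(1))
    hence E0: "E0 \<in> spec W0" by simp
    have "s \<le> dist E' E0" if E': "E' \<in> spec W0" "E' \<noteq> E0" for E'
    proof (rule ccontr)
      assume "\<not> s \<le> dist E' E0"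
      \<comment> \<open>Half of the smaller margin: a spectral point \<open>E''\<close> within
        \<open>d\<close> of \<open>E'\<close> still differs from \<open>E (f n)\<close> and is
        closer to it than \<open>s\<close>.\<close>
      define d where "d = min (dist E' E0) (s - dist E' E0) / 2"
      have d: "d > 0" "2 * d \<le> dist E' E0" "dist E' E0 + 2 * d \<le> s"
        using E'(2) \<open>\<not> s \<le> dist E' E0\<close> by (auto simp: d_def)
      have "\<forall>\<^sub>F n in sequentially. dist ((W \<circ> f) n) W0 < d \<and> dist ((E \<circ> f) n) E0 < d"
        by (intro eventually_conj tendstoD Wf f(2) d(1))
      then obtain n where n: "dist (W (f n)) W0 < d" "dist (E (f n)) E0 < d"
        by (auto simp: eventually_sequentially)
      obtain E'' where E'': "E'' \<in> spec (W (f n))" "dist E'' E' < d"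
        using spec_dist[OF E'(1), of "W (f n)" d] n(1) by (auto simp: dist_commute)
      have "dist E' E0 \<le> dist E'' E' + dist E'' (E (f n)) + dist (E (f n)) E0"
        using dist_triangle[of E' E0 "E (f n)"] dist_triangle[of E' "E (f n)" E''] by (simp add: dist_commute)
      hence "E'' \<noteq> E (f n)" using n(2) E''(2) d(2) by auto
      hence "s \<le> dist E'' (E (f n))" using E(2)[OF E''(1)] by simp
      moreover have "dist E'' (E (f n)) \<le> dist E'' E' + dist E' E0 + dist (E (f n)) E0"
        using dist_triangle[of E'' "E (f n)" E'] dist_triangle[of E' "E (f n)" E0] by (simp add: dist_commute)
      ultimately show False using n(2) E''(2) d(3) by linarith
    qed
    thus "W0 \<in> X" using E0 unfolding X_def by blast
  qed
  moreover have "{W. \<forall>E\<in>spec W. \<exists>E'\<in>spec W. E' \<noteq> E \<and> dist E' E < s} = - X"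
    by (rule set_eqI) (simp add: X_def not_le)
  ultimately show ?thesis by (simp add: open_Compl)
qed

lemma open_thin_perfect_spec: "open {W. thin_perfect s (spec W)}"
  unfolding thin_perfect_def Collect_conj_eq by (intro open_Int open_thinly_covered_spec open_no_isolated_spec)

lemma dist_repeat_le: "k \<ge> 1 \<Longrightarrow> dist (repeat V k) (repeat V' k) \<le> dist V V'"
  by (rule dist_bound) (simp add: repeat_apply dist_bounded)

text \<open>One index \<open>j\<close> governs the range of \<open>c\<close>, the range of
  \<open>k\<close> and the scale, so the countable intersection reaches all nonzero
  \<open>c\<close>, all \<open>k\<close> and arbitrarily small scales. The range of \<open>c\<close>
  excludes 0, where the spectrum is the interval \<open>[-2, 2]\<close>.\<close>

definition thin_perfect_potentials :: "nat \<Rightarrow> (int \<Rightarrow>\<^sub>C real) set" where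
  "thin_perfect_potentials j = {V. \<forall>c k. 1 / (real j + 1) \<le> \<bar>c\<bar> \<longrightarrow> \<bar>c\<bar> \<le> real j + 1 \<longrightarrow> 1 \<le> k \<longrightarrow> k \<le> j + 1 \<longrightarrow>
     thin_perfect (1 / (real j + 1)) (spec (c *\<^sub>R repeat V k))}"

text \<open>By the tube lemma, compactness of the range of \<open>c\<close> makes the intersection
  over uncountably many couplings open; the finitely many \<open>k\<close> are intersected
  directly.\<close>

lemma open_thin_perfect_potentials: "open (thin_perfect_potentials j)"
proof -
  define C where "C = {- (real j + 1)..- (1 / (real j + 1))} \<union> {1 / (real j + 1)..real j + 1}"
  have C: "c \<in> C \<longleftrightarrow> 1 / (real j + 1) \<le> \<bar>c\<bar> \<and> \<bar>c\<bar> \<le> real j + 1" for c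
  proof -
    have "0 < d \<Longrightarrow> (c \<in> {-a..-d} \<union> {d..a}) = (d \<le> \<bar>c\<bar> \<and> \<bar>c\<bar> \<le> a)" for a d :: real
      by (cases "c \<ge> 0") auto
    from this[of "1 / (real j + 1)" "real j + 1"] show ?thesis unfolding C_def by simp
  qed
  have "compact C" unfolding C_def by (intro compact_Un compact_Icc)
  have op: "open {V. \<forall>c\<in>C. thin_perfect (1 / (real j + 1)) (spec (c *\<^sub>R repeat V k))}" if k: "k \<ge> 1" for k
  proof (subst open_subopen, intro ballI)
    fix V assume V: "V \<in> {V. \<forall>c\<in>C. thin_perfect (1 / (real j + 1)) (spec (c *\<^sub>R repeat V k))}"
    have "continuous_on UNIV (\<lambda>V. repeat V k)"
      unfolding continuous_on_iff
    proof (intro ballI allI impI)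
      fix x :: "int \<Rightarrow>\<^sub>C real" and e :: real
      assume "e > 0"
      thus "\<exists>d>0. \<forall>x'\<in>UNIV. dist x' x < d \<longrightarrow> dist (repeat x' k) (repeat x k) < e"
        using le_less_trans[OF dist_repeat_le[OF k]] by (intro exI[of _ e]) simp
    qed
    hence "continuous_on UNIV (\<lambda>q :: (int \<Rightarrow>\<^sub>C real) \<times> real. snd q *\<^sub>R repeat (fst q) k)"
      by (intro continuous_intros continuous_on_compose2[of UNIV "\<lambda>V. repeat V k" UNIV fst]) auto
    hence op: "open ((\<lambda>q. snd q *\<^sub>R repeat (fst q) k) -` {W. thin_perfect (1 / (real j + 1)) (spec W)})"
      by (rule open_vimage[OF open_thin_perfect_spec])
    have sub: "{V} \<times> C \<subseteq> (\<lambda>q. snd q *\<^sub>R repeat (fst q) k) -` {W. thin_perfect (1 / (real j + 1)) (spec W)}"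
      using V by auto
    obtain X where X: "V \<in> X" "open X"
      "X \<times> C \<subseteq> (\<lambda>q. snd q *\<^sub>R repeat (fst q) k) -` {W. thin_perfect (1 / (real j + 1)) (spec W)}"
      using Elementary_Topology.tube_lemma[OF \<open>compact C\<close> op sub] by (elim exE conjE)
    have "X \<subseteq> {V. \<forall>c\<in>C. thin_perfect (1 / (real j + 1)) (spec (c *\<^sub>R repeat V k))}"
      using X(3) by (auto simp: subset_iff)
    thus "\<exists>T. open T \<and> V \<in> T \<and> T \<subseteq> {V. \<forall>c\<in>C. thin_perfect (1 / (real j + 1)) (spec (c *\<^sub>R repeat V k))}"
      using X(1,2) by blast
  qed
  have "thin_perfect_potentials j = (\<Inter>k\<in>{1..j + 1}. {V. \<forall>c\<in>C. thin_perfect (1 / (real j + 1)) (spec (c *\<^sub>R repeat V k))})"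
    by (auto simp: thin_perfect_potentials_def C)
  thus ?thesis using op by (auto intro!: open_INT)
qed

lemma dense_thin_perfect_potentials: "LP \<subseteq> closure (LP \<inter> thin_perfect_potentials j)"
proof
  fix V assume "V \<in> LP"
  have "\<exists>P\<in>LP \<inter> thin_perfect_potentials j. dist P V < e" if "e > 0" for e
  proof -
    have "e / 2 > 0" using that by simp
    then obtain V0 where V0: "periodic V0" "dist V0 V < e / 2"
      using \<open>V \<in> LP\<close> unfolding LP_def closure_approachable by blast
    then obtain p where p: "p \<ge> 1" "\<And>n. V0 (n + int p) = V0 n" by (auto simp: periodic_def)
    define s where "s = 1 / (real j + 1)"
    have s: "s > 0" "real j + 1 > 0" by (simp_all add: s_def)
    obtain P where P: "\<exists>q\<ge>1. \<forall>n. apply_bcontfun P (n + int q) = P n" "dist P V0 < e / 2"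
      "\<And>c k. 1 / (real j + 1) \<le> \<bar>c\<bar> \<Longrightarrow> \<bar>c\<bar> \<le> real j + 1 \<Longrightarrow> 1 \<le> k \<Longrightarrow> k \<le> j + 1 \<Longrightarrow>
         thinly_covered s (spec (c *\<^sub>R repeat P k))"
      using exists_thin_periodic[of V0 p "e / 2" "real j + 1" s "j + 1", OF p(2,1) \<open>e / 2 > 0\<close> s(2,1)] by metis
    obtain q where q: "q \<ge> 1" "\<And>n. apply_bcontfun P (n + int q) = P n" using P(1) by blast
    have "thin_perfect s (spec (c *\<^sub>R repeat P k))"
      if "1 / (real j + 1) \<le> \<bar>c\<bar>" "\<bar>c\<bar> \<le> real j + 1" "1 \<le> k" "k \<le> j + 1" for c k
    proof -
      have per: "(c *\<^sub>R repeat P k) (n + int (q * k)) = (c *\<^sub>R repeat P k) n" for n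
        by (rule scaled_repeat_periodic[OF q(2) that(3)])
      have qk: "q * k \<ge> 1" using q(1) that(3) by (metis mult_le_mono nat_mult_1)
      have "\<exists>E'\<in>spec (c *\<^sub>R repeat P k). E' \<noteq> E \<and> dist E' E < s" if "E \<in> spec (c *\<^sub>R repeat P k)" for E
        by (rule periodic_spec_no_isolated[OF per qk that s(1)])
      thus ?thesis using P(3)[OF that] unfolding thin_perfect_def by blast
    qed
    hence "P \<in> thin_perfect_potentials j" by (simp add: thin_perfect_potentials_def s_def)
    moreover have "periodic P" using P(1) by (simp add: periodic_def)
    hence "P \<in> LP" unfolding LP_def by (simp add: closure_subset[THEN subsetD])
    moreover have "dist P V < e" using dist_triangle[of P V V0] P(2) V0(2) by linarith
    ultimately show ?thesis by blast
  qed
  thus "V \<in> closure (LP \<inter> thin_perfect_potentials j)" unfolding closure_approachable by blast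
qed

lemma completely_metrizable_LP: "completely_metrizable_space (top_of_set LP)"
proof -
  have "complete (UNIV :: (int \<Rightarrow>\<^sub>C real) set)"
    unfolding complete_def
  proof (intro allI impI, elim conjE)
    fix f :: "nat \<Rightarrow> int \<Rightarrow>\<^sub>C real"
    assume "Cauchy f"
    then obtain g where "uniform_limit UNIV f g sequentially"
      using uniformly_convergent_eq_cauchy[of "\<lambda>_. True" f]
      unfolding Cauchy_def uniform_limit_sequentially_iff
      by (metis dist_fun_lt_imp_dist_val_lt)
    then obtain l where "f \<longlonglongrightarrow> l" by (rule uniform_limit_bcontfunE[OF _ sequentially_bot])
    thus "\<exists>l\<in>UNIV. f \<longlonglongrightarrow> l" by blast
  qed
  hence "completely_metrizable_space (euclidean :: (int \<Rightarrow>\<^sub>C real) topology)"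
    using Met_TC.completely_metrizable_space_mtopology by auto
  thus ?thesis by (rule completely_metrizable_space_closedin) (simp add: LP_def)
qed

theorem theorem1p3:
  shows "\<exists>G. G \<subseteq> LP \<and> gdelta_in (top_of_set LP) G \<and> LP \<subseteq> closure G \<and>
    (\<forall>V\<in>G. \<forall>c::real. \<forall>k::nat. c \<noteq> 0 \<longrightarrow> k \<ge> 1 \<longrightarrow>
      cantor_set (spec (c *\<^sub>R repeat V k)) \<and>
      hausdorff_dim (spec (c *\<^sub>R repeat V k)) = 0)"
proof -
  define U where "U j = LP \<inter> thin_perfect_potentials j" for j
  define G where "G = (\<Inter>j. U j)"
  have opU: "openin (top_of_set LP) (U j)" for j
    unfolding U_def by (intro openin_open_Int open_thin_perfect_potentials)
  have "G \<subseteq> LP" by (auto simp: G_def U_def)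
  moreover have "gdelta_in (top_of_set LP) G"
    unfolding G_def by (rule gdelta_in_Inter) (use opU open_imp_gdelta_in in auto)
  moreover have "LP \<subseteq> closure G"
  proof -
    have "(top_of_set LP) closure_of \<Inter>(range U) = topspace (top_of_set LP)"
    proof (rule Baire_category)
      show "completely_metrizable_space (top_of_set LP) \<or>
          locally_compact_space (top_of_set LP) \<and> regular_space (top_of_set LP)"
        by (rule disjI1[OF completely_metrizable_LP])
      fix T assume "T \<in> range U"
      then obtain j where T: "T = U j" by blast
      have "LP \<inter> closure (LP \<inter> (LP \<inter> thin_perfect_potentials j)) = LP"
        using dense_thin_perfect_potentials[of j] by (simp add: Int_absorb2 Int_left_absorb)
      thus "openin (top_of_set LP) T \<and> top_of_set LP closure_of T = topspace (top_of_set LP)"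
        using opU unfolding T by (simp add: closure_of_subtopology U_def)
    qed simp
    hence "LP \<inter> closure (LP \<inter> G) = LP" by (simp add: closure_of_subtopology G_def)
    moreover have "closure (LP \<inter> G) \<subseteq> closure G" by (intro closure_mono) simp
    ultimately show ?thesis by blast
  qed
  moreover have "cantor_set (spec (c *\<^sub>R repeat V k)) \<and> hausdorff_dim (spec (c *\<^sub>R repeat V k)) = 0"
    if V: "V \<in> G" and c: "c \<noteq> 0" and k: "k \<ge> 1" for V c k
  proof -
    let ?S = "spec (c *\<^sub>R repeat V k)"
    have thin_perfect: "\<exists>s>0. s < e \<and> thin_perfect s ?S" if "e > 0" for e
    proof -
      \<comment> \<open>At least \<open>k\<close>, \<open>\<bar>c\<bar>\<close>,
        \<open>1 / \<bar>c\<bar>\<close> and \<open>1 / e\<close>, so that \<open>c\<close> and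
        \<open>k\<close> are in range and the scale is below \<open>e\<close>.\<close>
      define j where "j = k + nat \<lceil>\<bar>c\<bar> + 1 / \<bar>c\<bar> + 1 / e\<rceil>"
      have pos: "1 / \<bar>c\<bar> > 0" "1 / e > 0" using c that by simp_all
      have "\<bar>c\<bar> + 1 / \<bar>c\<bar> + 1 / e \<le> real (nat \<lceil>\<bar>c\<bar> + 1 / \<bar>c\<bar> + 1 / e\<rceil>)" by linarith
      hence "\<bar>c\<bar> + 1 / \<bar>c\<bar> + 1 / e \<le> real j" by (simp add: j_def)
      hence j: "\<bar>c\<bar> \<le> real j + 1" "1 / \<bar>c\<bar> \<le> real j + 1" "1 / e < real j + 1" using pos by linarith+
      have "1 / (real j + 1) \<le> \<bar>c\<bar>" using j(2) c by (simp add: field_simps)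
      moreover have "V \<in> thin_perfect_potentials j" using V by (auto simp: G_def U_def)
      moreover have "k \<le> j + 1" by (simp add: j_def)
      ultimately have "thin_perfect (1 / (real j + 1)) ?S" using j(1) k by (simp add: thin_perfect_potentials_def)
      moreover have "1 / (real j + 1) < e" using j(3) that by (simp add: field_simps)
      ultimately show ?thesis by (intro exI[of _ "1 / (real j + 1)"]) auto
    qed
    have thin: "\<exists>s>0. s < e \<and> thinly_covered s ?S" if "e > 0" for e
      using thin_perfect[OF that] unfolding thin_perfect_def by blast
    have "\<not> E isolated_in ?S" if "E \<in> ?S" for E
    proof -
      have "\<exists>E'\<in>?S. E' \<noteq> E \<and> dist E' E < e" if "e > 0" for e
        using thin_perfect[OF that] \<open>E \<in> ?S\<close> unfolding thin_perfect_def by (metis less_trans)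
      thus ?thesis by (simp add: isolated_in_islimpt_iff islimpt_approachable)
    qed
    hence "cantor_set ?S"
      unfolding cantor_set_def using spec_nonempty compact_spec interior_empty_of_thin[OF thin] by blast
    thus ?thesis using hausdorff_dim_zero[OF thin] by blast
  qed
  ultimately show ?thesis by blast
qed

end
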